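(* The unit functor constructed by Garner's small object argument is universal among adjunctions of awfs. Precisely: let $(\mathbb C,\mathbb F)$ be the awfs on a category $\mathcal M$ generated, via Garner's small object argument, by a small category $\mathcal J\to\mathcal M^{\mathbf 2}$, with unit functor $u\colon\mathcal J\to\mathbb C\text{-}\mathbf{coalg}$, and let $(\mathbb L,\mathbb R)$ be any awfs on a category $\mathcal N$. Let $G\colon\mathcal M^{\mathbf 2}\rightleftarrows\mathcal N^{\mathbf 2}\colon H$ be an adjunction which is either of the form $T^{\mathbf 2}\dashv S^{\mathbf 2}$ for an adjunction $T\dashv S\colon\mathcal M\rightleftarrows\mathcal N$, or of the form $i\widehat\otimes-\dashv\widehat{\mathrm{hom}}(i,-)$ for an arrow $i$ in one of the variables of a two-variable adjunction, or a composite of the two. Then every functor $\Phi\colon\mathcal J\to\mathbb L\text{-}\mathbf{coalg}$ lifting $G$ (that is, whose composite with $\mathbb L\text{-}\mathbf{coalg}\to\mathcal N^{\mathbf 2}$ is $\mathcal J\to\mathcal M^{\mathbf 2}\xrightarrow{G}\mathcal N^{\mathbf 2}$) factors as $\Phi=\tilde G\cdot u$, where $\tilde G\colon\mathbb C\text{-}\mathbf{coalg}\to\mathbb L\text{-}\mathbf{coalg}$ is the lifted left adjoint of a unique adjunction of awfs $(\mathbb C,\mathbb F)\to(\mathbb L,\mathbb R)$ over $G\dashv H$.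
   Context: $\mathcal M^{\mathbf 2}$ is the arrow category; a morphism $(u,v)\colon f\Rightarrow g$ is a commutative square $gu=vf$ (a lifting problem of $f$ against $g$). A functorial factorization $\vec E=(L,R)$ factors each arrow functorially as $f=Rf\cdot Lf$ with $Lf\colon\mathrm{dom}f\to Ef$, $Rf\colon Ef\to\mathrm{cod}f$, with canonical $\vec\epsilon_f=(1,Rf)\colon Lf\Rightarrow f$, $\vec\eta_f=(Lf,1)\colon f\Rightarrow Rf$. An algebraic weak factorization system (awfs) $(\mathbb L,\mathbb R)$ is a comonad $\mathbb L=(L,\vec\epsilon,\vec\delta)$ and a monad $\mathbb R=(R,\vec\eta,\vec\mu)$ on the arrow category arising from a functorial factorization, with $\vec\delta_f=(1,\delta_f)$, $\delta_f\colon Ef\to ELf$, $\vec\mu_f=(\mu_f,1)$, $\mu_f\colon ERf\to Ef$, such that $(\delta,\mu)\colon LR\Rightarrow RL$ is a distributive law. A coalgebra structure on $j$ is given by $s\colon\mathrm{cod}j\to Ej$, an algebra structure on $f$ by $r\colon Ef\to\mathrm{dom}f$; the canonical solution to $(u,v)\colon j\Rightarrow f$ is $r\cdot E(u,v)\cdot s$. $(\mathbb C,\mathbb F)$ factors arrows through $Q$ and $(\mathbb L,\mathbb R)$ through $E$. Generation: for $\mathcal J\to\mathcal M^{\mathbf 2}$ with $\mathcal J$ small, $\mathcal J^{\pitchfork}$ is the category over $\mathcal M^{\mathbf 2}$ of pairs $(f,\phi_f)$ of an arrow $f$ and a choice $\phi_f$ of solutions to all lifting problems of objects of $\mathcal J$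 against $f$, compatible with morphisms of $\mathcal J$. If $\mathcal M$ permits the small object argument (e.g. locally presentable or, more generally, locally bounded), Garner's small object argument produces an awfs $(\mathbb C,\mathbb F)$ with a unit functor $u\colon\mathcal J\to\mathbb C\text{-}\mathbf{coalg}$ over $\mathcal M^{\mathbf 2}$, characterized by: $u$ is universal among functors over $\mathcal M^{\mathbf 2}$ from $\mathcal J$ to coalgebra categories of awfs on $\mathcal M$ (with respect to morphisms of awfs, i.e. natural transformations $\xi$ between the middle-object functors giving simultaneously a comonad morphism $(1,\xi)$ and a monad morphism $(\xi,1)$), and the functor $\mathbb F\text{-}\mathbf{alg}\to\mathcal J^{\pitchfork}$ given by canonical solutions against $u$ is an isomorphism. A two-variable adjunction $(\otimes,\mathrm{hom},\mathrm{hom}_r)\colon\mathcal K\times\mathcal M\to\mathcal N$ consists of bifunctors with natural isomorphisms $\mathcal N(k\otimes m,n)\cong\mathcal M(m,\mathrm{hom}(k,n))\cong\mathcal K(k,\mathrm{hom}_r(m,n))$ ($\mathcal K,\mathcal M$ with pullbacks, $\mathcal N$ with pushouts). For $i\colon A\to B$ in $\mathcal K$, $j\colon J\to K$ in $\mathcal M$, $f\colon X\to Y$ in $\mathcal N$: $i\widehat\otimes j\colon A\otimes K\sqcup_{A\otimes J}B\otimes J\to B\otimes K$ and $\widehat{\mathrm{hom}}(i,f)\colon\mathrm{hom}(B,X)\to\mathrm{hom}(B,Y)\times_{\mathrm{hom}(A,Y)}\mathrm{hom}(A,X)$; these give adjoint functors $i\widehat\otimes-\dashv\widehat{\mathrm{hom}}(i,-)$.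 A composite of such an adjunction with one of the form $T^{\mathbf 2}\dashv S^{\mathbf 2}$ is again of the form $i\widehat\otimes-\dashv\widehat{\mathrm{hom}}(i,-)$ for the composite two-variable adjunction. Adjunctions of awfs $(\mathbb C,\mathbb F)\to(\mathbb L,\mathbb R)$. Over $T^{\mathbf 2}\dashv S^{\mathbf 2}$: natural transformations $\lambda_j\colon TQj\to E(Tj)$ and $\rho_f\colon Q(Sf)\to SEf$ that are mates with respect to $T^{\mathbf 2}\dashv S^{\mathbf 2}$ and $T\dashv S$, such that $(j,t)\mapsto(Tj,\lambda_j\cdot Tt)$ defines a lifted functor $\mathbb C\text{-}\mathbf{coalg}\to\mathbb L\text{-}\mathbf{coalg}$ and $(f,r)\mapsto(Sf,Sr\cdot\rho_f)$ defines a lifted functor $\mathbb R\text{-}\mathbf{alg}\to\mathbb F\text{-}\mathbf{alg}$. Over $i\widehat\otimes-\dashv\widehat{\mathrm{hom}}(i,-)$ with $i\colon A\to B$: natural transformations $\lambda_j\colon B\otimes Qj\to E(i\widehat\otimes j)$ and $\rho_f\colon Q\widehat{\mathrm{hom}}(i,f)\to\mathrm{hom}(B,Ef)$ that are mates with respect to $i\widehat\otimes-\dashv\widehat{\mathrm{hom}}(i,-)$ and $B\otimes-\dashv\mathrm{hom}(B,-)$, such that $(j,t)\mapsto(i\widehat\otimes j,\lambda_j\cdot(B\otimes t))$ defines a lifted functor $\mathbb C\text{-}\mathbf{coalg}\to\mathbb L\text{-}\mathbf{coalg}$ (the lifted left adjoint) and $(f,r)\mapsto(\widehat{\mathrm{hom}}(i,f),\mathrm{hom}(B,r)\cdot\rho_f)$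 defines a lifted functor $\mathbb R\text{-}\mathbf{alg}\to\mathbb F\text{-}\mathbf{alg}$. (For $T\dashv S$, $T'\dashv S'$, transformations $\lambda\colon T'H\Rightarrow GT$ and $\rho\colon HS\Rightarrow S'G$ are mates if $\rho=S'G\epsilon\cdot S'\lambda_S\cdot\iota_{HS}$, $\epsilon$ the counit of $T\dashv S$, $\iota$ the unit of $T'\dashv S'$.) *)

theory Defs
  imports Main "HOL-Library.FuncSet"
begin

section \<open>Categories and functors\<close>

record ('o, 'a) cat =
  Obj :: "'o set"
  Arr :: "'a set"
  Dom :: "'a \<Rightarrow> 'o"
  Cod :: "'a \<Rightarrow> 'o"
  Idt :: "'o \<Rightarrow> 'a"
  Comp :: "'a \<Rightarrow> 'a \<Rightarrow> 'a"  (infixl "\<cdot>\<index>" 70)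

definition Hom :: "('o, 'a) cat \<Rightarrow> 'o \<Rightarrow> 'o \<Rightarrow> 'a set" where
  "Hom C x y = {f \<in> Arr C. Dom C f = x \<and> Cod C f = y}"

locale category =
  fixes C :: "('o, 'a) cat" (structure)
  assumes Dom_closed: "f \<in> Arr C \<Longrightarrow> Dom C f \<in> Obj C"
    and Cod_closed: "f \<in> Arr C \<Longrightarrow> Cod C f \<in> Obj C"
    and Idt_Hom: "x \<in> Obj C \<Longrightarrow> Idt C x \<in> Hom C x x"
    and Comp_Hom: "f \<in> Hom C x y \<Longrightarrow> g \<in> Hom C y z \<Longrightarrow> g \<cdot> f \<in> Hom C x z"
    and Comp_Idt: "f \<in> Hom C x y \<Longrightarrow> f \<cdot> Idt C x = f"
    and Idt_Comp: "f \<in> Hom C x y \<Longrightarrow> Idt C y \<cdot> f = f"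
    and Comp_assoc: "f \<in> Hom C w x \<Longrightarrow> g \<in> Hom C x y \<Longrightarrow> h \<in> Hom C y z \<Longrightarrow>
      (h \<cdot> g) \<cdot> f = h \<cdot> (g \<cdot> f)"

text \<open>The values of the two maps outside the source category are irrelevant; equality of functors
  always means agreement on its objects and arrows.\<close>

record ('o, 'a, 'p, 'b) func =
  omap :: "'o \<Rightarrow> 'p"
  amap :: "'a \<Rightarrow> 'b"

locale is_functor = source: category C + target: category D
  for C :: "('o, 'a) cat" and D :: "('p, 'b) cat" +
  fixes F :: "('o, 'a, 'p, 'b) func"
  assumes omap_closed: "x \<in> Obj C \<Longrightarrow> omap F x \<in> Obj D"
    and amap_Hom: "f \<in> Hom C x y \<Longrightarrow> amap F f \<in> Hom D (omap F x) (omap F y)"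
    and amap_Idt: "x \<in> Obj C \<Longrightarrow> amap F (Idt C x) = Idt D (omap F x)"
    and amap_Comp: "f \<in> Hom C x y \<Longrightarrow> g \<in> Hom C y z \<Longrightarrow>
      amap F (g \<cdot>\<^bsub>C\<^esub> f) = amap F g \<cdot>\<^bsub>D\<^esub> amap F f"

definition id_func :: "('o, 'a, 'o, 'a) func" where
  "id_func = \<lparr>omap = (\<lambda>x. x), amap = (\<lambda>f. f)\<rparr>"

definition comp_func ::
  "('p, 'b, 'q, 'c) func \<Rightarrow> ('o, 'a, 'p, 'b) func \<Rightarrow> ('o, 'a, 'q, 'c) func" where
  "comp_func G F = \<lparr>omap = omap G \<circ> omap F, amap = amap G \<circ> amap F\<rparr>"

definition func_eq ::
  "('o, 'a) cat \<Rightarrow> ('o, 'a, 'p, 'b) func \<Rightarrow> ('o, 'a, 'p, 'b) func \<Rightarrow> bool" where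
  "func_eq C F G \<longleftrightarrow> (\<forall>x\<in>Obj C. omap F x = omap G x) \<and> (\<forall>f\<in>Arr C. amap F f = amap G f)"

definition cat_iso :: "('o, 'a) cat \<Rightarrow> ('p, 'b) cat \<Rightarrow> ('o, 'a, 'p, 'b) func \<Rightarrow> bool" where
  "cat_iso C D F \<longleftrightarrow> is_functor C D F \<and>
     bij_betw (omap F) (Obj C) (Obj D) \<and> bij_betw (amap F) (Arr C) (Arr D)"

definition nat_trans ::
  "('o, 'a) cat \<Rightarrow> ('p, 'b) cat \<Rightarrow> ('o, 'a, 'p, 'b) func \<Rightarrow> ('o, 'a, 'p, 'b) func
    \<Rightarrow> ('o \<Rightarrow> 'b) \<Rightarrow> bool" where
  "nat_trans C D F G \<tau> \<longleftrightarrow> is_functor C D F \<and> is_functor C D G \<and>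
     (\<forall>x\<in>Obj C. \<tau> x \<in> Hom D (omap F x) (omap G x)) \<and>
     (\<forall>f\<in>Arr C. amap G f \<cdot>\<^bsub>D\<^esub> \<tau> (Dom C f) = \<tau> (Cod C f) \<cdot>\<^bsub>D\<^esub> amap F f)"

definition op_cat :: "('o, 'a) cat \<Rightarrow> ('o, 'a) cat" where
  "op_cat C = \<lparr>Obj = Obj C, Arr = Arr C, Dom = Cod C, Cod = Dom C, Idt = Idt C,
     Comp = (\<lambda>g f. f \<cdot>\<^bsub>C\<^esub> g)\<rparr>"

definition prod_cat :: "('o, 'a) cat \<Rightarrow> ('p, 'b) cat \<Rightarrow> ('o \<times> 'p, 'a \<times> 'b) cat" where
  "prod_cat C D = \<lparr>Obj = Obj C \<times> Obj D, Arr = Arr C \<times> Arr D,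
     Dom = map_prod (Dom C) (Dom D), Cod = map_prod (Cod C) (Cod D),
     Idt = map_prod (Idt C) (Idt D),
     Comp = (\<lambda>(g, g') (f, f'). (g \<cdot>\<^bsub>C\<^esub> f, g' \<cdot>\<^bsub>D\<^esub> f'))\<rparr>"


section \<open>Adjunctions and mates\<close>

text \<open>\<open>transp c d\<close> is the bijection from arrows \<open>ladj c \<rightarrow> d\<close> to arrows \<open>c \<rightarrow> radj d\<close>.\<close>

record ('o, 'a, 'p, 'b) adj =
  ladj :: "('o, 'a, 'p, 'b) func"
  radj :: "('p, 'b, 'o, 'a) func"
  transp :: "'o \<Rightarrow> 'p \<Rightarrow> 'b \<Rightarrow> 'a"

definition adjunction ::
  "('o, 'a) cat \<Rightarrow> ('p, 'b) cat \<Rightarrow> ('o, 'a, 'p, 'b) adj \<Rightarrow> bool" where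
  "adjunction C D A \<longleftrightarrow> is_functor C D (ladj A) \<and> is_functor D C (radj A) \<and>
     (\<forall>c\<in>Obj C. \<forall>d\<in>Obj D.
        bij_betw (transp A c d) (Hom D (omap (ladj A) c) d) (Hom C c (omap (radj A) d))) \<and>
     (\<forall>a\<in>Arr C. \<forall>b\<in>Arr D. \<forall>h\<in>Hom D (omap (ladj A) (Cod C a)) (Dom D b).
        transp A (Dom C a) (Cod D b) (b \<cdot>\<^bsub>D\<^esub> h \<cdot>\<^bsub>D\<^esub> amap (ladj A) a)
          = amap (radj A) b \<cdot>\<^bsub>C\<^esub> transp A (Cod C a) (Dom D b) h \<cdot>\<^bsub>C\<^esub> a)"

definition adj_unit :: "('p, 'b) cat \<Rightarrow> ('o, 'a, 'p, 'b) adj \<Rightarrow> 'o \<Rightarrow> 'a" where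
  "adj_unit D A c = transp A c (omap (ladj A) c) (Idt D (omap (ladj A) c))"

definition adj_counit ::
  "('o, 'a) cat \<Rightarrow> ('p, 'b) cat \<Rightarrow> ('o, 'a, 'p, 'b) adj \<Rightarrow> 'p \<Rightarrow> 'b" where
  "adj_counit C D A d =
     the_inv_into (Hom D (omap (ladj A) (omap (radj A) d)) d) (transp A (omap (radj A) d) d)
       (Idt C (omap (radj A) d))"

definition comp_adj ::
  "('p, 'b, 'q, 'c) adj \<Rightarrow> ('o, 'a, 'p, 'b) adj \<Rightarrow> ('o, 'a, 'q, 'c) adj" where
  "comp_adj A' A =
     \<lparr>ladj = comp_func (ladj A') (ladj A), radj = comp_func (radj A) (radj A'),
      transp = (\<lambda>c d h. transp A c (omap (radj A') d) (transp A' (omap (ladj A) c) d h))\<rparr>"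

text \<open>For \<open>A = (T \<stileturn> S)\<close> between \<open>C\<close> and \<open>D\<close>, \<open>A' = (T' \<stileturn> S')\<close> between \<open>C'\<close> and \<open>D'\<close>, and functors
  \<open>H : C \<rightarrow> C'\<close>, \<open>G : D \<rightarrow> D'\<close>.\<close>

definition mates ::
  "('o, 'a) cat \<Rightarrow> ('p, 'b) cat \<Rightarrow> ('o, 'a, 'p, 'b) adj
    \<Rightarrow> ('o1, 'a1) cat \<Rightarrow> ('p1, 'b1) cat \<Rightarrow> ('o1, 'a1, 'p1, 'b1) adj
    \<Rightarrow> ('o, 'a, 'o1, 'a1) func \<Rightarrow> ('p, 'b, 'p1, 'b1) func
    \<Rightarrow> ('o \<Rightarrow> 'b1) \<Rightarrow> ('p \<Rightarrow> 'a1) \<Rightarrow> bool" where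
  "mates C D A C' D' A' H G l r \<longleftrightarrow>
     nat_trans C D' (comp_func (ladj A') H) (comp_func G (ladj A)) l \<and>
     nat_trans D C' (comp_func H (radj A)) (comp_func (radj A') G) r \<and>
     (\<forall>d\<in>Obj D. r d =
        amap (radj A') (amap G (adj_counit C D A d))
          \<cdot>\<^bsub>C'\<^esub> amap (radj A') (l (omap (radj A) d))
          \<cdot>\<^bsub>C'\<^esub> adj_unit D' A' (omap H (omap (radj A) d)))"


section \<open>Comonads, monads and distributive laws\<close>

definition comonad ::
  "('o, 'a) cat \<Rightarrow> ('o, 'a, 'o, 'a) func \<Rightarrow> ('o \<Rightarrow> 'a) \<Rightarrow> ('o \<Rightarrow> 'a) \<Rightarrow> bool" where
  "comonad C L \<epsilon> \<delta> \<longleftrightarrow>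
     nat_trans C C L id_func \<epsilon> \<and> nat_trans C C L (comp_func L L) \<delta> \<and>
     (\<forall>x\<in>Obj C. \<epsilon> (omap L x) \<cdot>\<^bsub>C\<^esub> \<delta> x = Idt C (omap L x) \<and>
        amap L (\<epsilon> x) \<cdot>\<^bsub>C\<^esub> \<delta> x = Idt C (omap L x) \<and>
        \<delta> (omap L x) \<cdot>\<^bsub>C\<^esub> \<delta> x = amap L (\<delta> x) \<cdot>\<^bsub>C\<^esub> \<delta> x)"

definition monad ::
  "('o, 'a) cat \<Rightarrow> ('o, 'a, 'o, 'a) func \<Rightarrow> ('o \<Rightarrow> 'a) \<Rightarrow> ('o \<Rightarrow> 'a) \<Rightarrow> bool" where
  "monad C R \<eta> \<mu> \<longleftrightarrow>
     nat_trans C C id_func R \<eta> \<and> nat_trans C C (comp_func R R) R \<mu> \<and>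
     (\<forall>x\<in>Obj C. \<mu> x \<cdot>\<^bsub>C\<^esub> \<eta> (omap R x) = Idt C (omap R x) \<and>
        \<mu> x \<cdot>\<^bsub>C\<^esub> amap R (\<eta> x) = Idt C (omap R x) \<and>
        \<mu> x \<cdot>\<^bsub>C\<^esub> \<mu> (omap R x) = \<mu> x \<cdot>\<^bsub>C\<^esub> amap R (\<mu> x))"

definition coalgebra ::
  "('o, 'a) cat \<Rightarrow> ('o, 'a, 'o, 'a) func \<Rightarrow> ('o \<Rightarrow> 'a) \<Rightarrow> ('o \<Rightarrow> 'a) \<Rightarrow> 'o \<Rightarrow> 'a \<Rightarrow> bool" where
  "coalgebra C L \<epsilon> \<delta> x h \<longleftrightarrow> x \<in> Obj C \<and> h \<in> Hom C x (omap L x) \<and>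
     \<epsilon> x \<cdot>\<^bsub>C\<^esub> h = Idt C x \<and> \<delta> x \<cdot>\<^bsub>C\<^esub> h = amap L h \<cdot>\<^bsub>C\<^esub> h"

definition algebra ::
  "('o, 'a) cat \<Rightarrow> ('o, 'a, 'o, 'a) func \<Rightarrow> ('o \<Rightarrow> 'a) \<Rightarrow> ('o \<Rightarrow> 'a) \<Rightarrow> 'o \<Rightarrow> 'a \<Rightarrow> bool" where
  "algebra C R \<eta> \<mu> x h \<longleftrightarrow> x \<in> Obj C \<and> h \<in> Hom C (omap R x) x \<and>
     h \<cdot>\<^bsub>C\<^esub> \<eta> x = Idt C x \<and> h \<cdot>\<^bsub>C\<^esub> \<mu> x = h \<cdot>\<^bsub>C\<^esub> amap R h"

definition comonad_morphism ::
  "('o, 'a) cat \<Rightarrow> ('o, 'a, 'o, 'a) func \<Rightarrow> ('o \<Rightarrow> 'a) \<Rightarrow> ('o \<Rightarrow> 'a)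
    \<Rightarrow> ('o, 'a, 'o, 'a) func \<Rightarrow> ('o \<Rightarrow> 'a) \<Rightarrow> ('o \<Rightarrow> 'a) \<Rightarrow> ('o \<Rightarrow> 'a) \<Rightarrow> bool" where
  "comonad_morphism C L \<epsilon> \<delta> L' \<epsilon>' \<delta>' \<alpha> \<longleftrightarrow> nat_trans C C L L' \<alpha> \<and>
     (\<forall>x\<in>Obj C. \<epsilon>' x \<cdot>\<^bsub>C\<^esub> \<alpha> x = \<epsilon> x \<and>
        \<delta>' x \<cdot>\<^bsub>C\<^esub> \<alpha> x = \<alpha> (omap L' x) \<cdot>\<^bsub>C\<^esub> amap L (\<alpha> x) \<cdot>\<^bsub>C\<^esub> \<delta> x)"

definition monad_morphism ::
  "('o, 'a) cat \<Rightarrow> ('o, 'a, 'o, 'a) func \<Rightarrow> ('o \<Rightarrow> 'a) \<Rightarrow> ('o \<Rightarrow> 'a)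
    \<Rightarrow> ('o, 'a, 'o, 'a) func \<Rightarrow> ('o \<Rightarrow> 'a) \<Rightarrow> ('o \<Rightarrow> 'a) \<Rightarrow> ('o \<Rightarrow> 'a) \<Rightarrow> bool" where
  "monad_morphism C R \<eta> \<mu> R' \<eta>' \<mu>' \<alpha> \<longleftrightarrow> nat_trans C C R R' \<alpha> \<and>
     (\<forall>x\<in>Obj C. \<alpha> x \<cdot>\<^bsub>C\<^esub> \<eta> x = \<eta>' x \<and>
        \<alpha> x \<cdot>\<^bsub>C\<^esub> \<mu> x = \<mu>' x \<cdot>\<^bsub>C\<^esub> \<alpha> (omap R' x) \<cdot>\<^bsub>C\<^esub> amap R (\<alpha> x))"

text \<open>A distributive law \<open>L R \<Rightarrow> R L\<close> of a comonad over a monad.\<close>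

definition distributive_law ::
  "('o, 'a) cat \<Rightarrow> ('o, 'a, 'o, 'a) func \<Rightarrow> ('o \<Rightarrow> 'a) \<Rightarrow> ('o \<Rightarrow> 'a)
    \<Rightarrow> ('o, 'a, 'o, 'a) func \<Rightarrow> ('o \<Rightarrow> 'a) \<Rightarrow> ('o \<Rightarrow> 'a) \<Rightarrow> ('o \<Rightarrow> 'a) \<Rightarrow> bool" where
  "distributive_law C L \<epsilon> \<delta> R \<eta> \<mu> \<chi> \<longleftrightarrow>
     nat_trans C C (comp_func L R) (comp_func R L) \<chi> \<and>
     (\<forall>x\<in>Obj C.
        \<chi> x \<cdot>\<^bsub>C\<^esub> amap L (\<eta> x) = \<eta> (omap L x) \<and>
        \<chi> x \<cdot>\<^bsub>C\<^esub> amap L (\<mu> x) = \<mu> (omap L x) \<cdot>\<^bsub>C\<^esub> amap R (\<chi> x) \<cdot>\<^bsub>C\<^esub> \<chi> (omap R x) \<and>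
        amap R (\<epsilon> x) \<cdot>\<^bsub>C\<^esub> \<chi> x = \<epsilon> (omap R x) \<and>
        amap R (\<delta> x) \<cdot>\<^bsub>C\<^esub> \<chi> x = \<chi> (omap L x) \<cdot>\<^bsub>C\<^esub> amap L (\<chi> x) \<cdot>\<^bsub>C\<^esub> \<delta> (omap R x))"


section \<open>The arrow category\<close>

text \<open>The tuple \<open>(f, u, v, g)\<close> is the square \<open>(u, v) : f \<Rightarrow> g\<close>, i.e. \<open>g u = v f\<close>.\<close>

type_synonym 'a sq = "'a \<times> 'a \<times> 'a \<times> 'a"

definition sq_top :: "'a sq \<Rightarrow> 'a" where
  "sq_top = (\<lambda>(f, u, v, g). u)"

definition sq_bot :: "'a sq \<Rightarrow> 'a" where
  "sq_bot = (\<lambda>(f, u, v, g). v)"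

definition arrow_cat :: "('o, 'a) cat \<Rightarrow> ('a, 'a sq) cat" where
  "arrow_cat M =
     \<lparr>Obj = Arr M,
      Arr = {(f, u, v, g). f \<in> Arr M \<and> g \<in> Arr M \<and>
               u \<in> Hom M (Dom M f) (Dom M g) \<and> v \<in> Hom M (Cod M f) (Cod M g) \<and>
               g \<cdot>\<^bsub>M\<^esub> u = v \<cdot>\<^bsub>M\<^esub> f},
      Dom = (\<lambda>(f, u, v, g). f),
      Cod = (\<lambda>(f, u, v, g). g),
      Idt = (\<lambda>f. (f, Idt M (Dom M f), Idt M (Cod M f), f)),
      Comp = (\<lambda>(f', u', v', g') (f, u, v, g). (f, u' \<cdot>\<^bsub>M\<^esub> u, v' \<cdot>\<^bsub>M\<^esub> v, g'))\<rparr>"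

definition arrow_func :: "('o, 'a, 'p, 'b) func \<Rightarrow> ('a, 'a sq, 'b, 'b sq) func" where
  "arrow_func F = \<lparr>omap = amap F,
     amap = (\<lambda>(f, u, v, g). (amap F f, amap F u, amap F v, amap F g))\<rparr>"

text \<open>The category over the arrow category whose objects are arrows \<open>f\<close> equipped with some structure
  \<open>s\<close>, the set of such pairs being \<open>X\<close>, and whose arrows are the squares satisfying \<open>P\<close>.\<close>

definition structured_cat ::
  "('o, 'a) cat \<Rightarrow> ('a \<times> 's) set \<Rightarrow> ('a \<times> 's \<Rightarrow> 'a sq \<Rightarrow> 'a \<times> 's \<Rightarrow> bool)
    \<Rightarrow> ('a \<times> 's, ('a \<times> 's) \<times> 'a sq \<times> ('a \<times> 's)) cat" where
  "structured_cat M X P =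
     \<lparr>Obj = X,
      Arr = {(x, \<sigma>, y). x \<in> X \<and> y \<in> X \<and> \<sigma> \<in> Hom (arrow_cat M) (fst x) (fst y) \<and> P x \<sigma> y},
      Dom = (\<lambda>(x, \<sigma>, y). x),
      Cod = (\<lambda>(x, \<sigma>, y). y),
      Idt = (\<lambda>x. (x, Idt (arrow_cat M) (fst x), x)),
      Comp = (\<lambda>(y', \<tau>, z) (x, \<sigma>, y). (x, \<tau> \<cdot>\<^bsub>arrow_cat M\<^esub> \<sigma>, z))\<rparr>"

definition forget ::
  "('a \<times> 's, ('a \<times> 's) \<times> 'a sq \<times> ('a \<times> 's), 'a, 'a sq) func" where
  "forget = \<lparr>omap = fst, amap = (\<lambda>(x, \<sigma>, y). \<sigma>)\<rparr>"


section \<open>Algebraic weak factorization systems\<close>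

text \<open>\<open>mid\<close> is the middle-object functor \<open>E\<close>, and \<open>lft f\<close>, \<open>rgt f\<close>, \<open>comult f\<close>, \<open>mult f\<close> are
  \<open>Lf : dom f \<rightarrow> Ef\<close>, \<open>Rf : Ef \<rightarrow> cod f\<close>, \<open>\<delta>\<^sub>f : Ef \<rightarrow> ELf\<close> and \<open>\<mu>\<^sub>f : ERf \<rightarrow> Ef\<close>.\<close>

record ('o, 'a) awfs_data =
  mid :: "('a, 'a sq, 'o, 'a) func"
  lft :: "'a \<Rightarrow> 'a"
  rgt :: "'a \<Rightarrow> 'a"
  comult :: "'a \<Rightarrow> 'a"
  mult :: "'a \<Rightarrow> 'a"

definition functorial_factorization :: "('o, 'a) cat \<Rightarrow> ('o, 'a) awfs_data \<Rightarrow> bool" where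
  "functorial_factorization M W \<longleftrightarrow> is_functor (arrow_cat M) M (mid W) \<and>
     (\<forall>f\<in>Arr M. lft W f \<in> Hom M (Dom M f) (omap (mid W) f) \<and>
        rgt W f \<in> Hom M (omap (mid W) f) (Cod M f) \<and> rgt W f \<cdot>\<^bsub>M\<^esub> lft W f = f) \<and>
     (\<forall>(f, u, v, g)\<in>Arr (arrow_cat M).
        amap (mid W) (f, u, v, g) \<cdot>\<^bsub>M\<^esub> lft W f = lft W g \<cdot>\<^bsub>M\<^esub> u \<and>
        rgt W g \<cdot>\<^bsub>M\<^esub> amap (mid W) (f, u, v, g) = v \<cdot>\<^bsub>M\<^esub> rgt W f)"

definition Lfun :: "('o, 'a) awfs_data \<Rightarrow> ('a, 'a sq, 'a, 'a sq) func" where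
  "Lfun W = \<lparr>omap = lft W,
     amap = (\<lambda>(f, u, v, g). (lft W f, u, amap (mid W) (f, u, v, g), lft W g))\<rparr>"

definition Rfun :: "('o, 'a) awfs_data \<Rightarrow> ('a, 'a sq, 'a, 'a sq) func" where
  "Rfun W = \<lparr>omap = rgt W,
     amap = (\<lambda>(f, u, v, g). (rgt W f, amap (mid W) (f, u, v, g), v, rgt W g))\<rparr>"

definition eps :: "('o, 'a) cat \<Rightarrow> ('o, 'a) awfs_data \<Rightarrow> 'a \<Rightarrow> 'a sq" where
  "eps M W f = (lft W f, Idt M (Dom M f), rgt W f, f)"

definition eta :: "('o, 'a) cat \<Rightarrow> ('o, 'a) awfs_data \<Rightarrow> 'a \<Rightarrow> 'a sq" where
  "eta M W f = (f, lft W f, Idt M (Cod M f), rgt W f)"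

definition delta :: "('o, 'a) cat \<Rightarrow> ('o, 'a) awfs_data \<Rightarrow> 'a \<Rightarrow> 'a sq" where
  "delta M W f = (lft W f, Idt M (Dom M f), comult W f, lft W (lft W f))"

definition mu :: "('o, 'a) cat \<Rightarrow> ('o, 'a) awfs_data \<Rightarrow> 'a \<Rightarrow> 'a sq" where
  "mu M W f = (rgt W (rgt W f), mult W f, Idt M (Cod M f), rgt W f)"

definition dlaw :: "('o, 'a) awfs_data \<Rightarrow> 'a \<Rightarrow> 'a sq" where
  "dlaw W f = (lft W (rgt W f), comult W f, mult W f, rgt W (lft W f))"

definition awfs :: "('o, 'a) cat \<Rightarrow> ('o, 'a) awfs_data \<Rightarrow> bool" where
  "awfs M W \<longleftrightarrow> category M \<and> functorial_factorization M W \<and>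
     comonad (arrow_cat M) (Lfun W) (eps M W) (delta M W) \<and>
     monad (arrow_cat M) (Rfun W) (eta M W) (mu M W) \<and>
     distributive_law (arrow_cat M) (Lfun W) (eps M W) (delta M W)
       (Rfun W) (eta M W) (mu M W) (dlaw W)"

definition coalg_sq :: "('o, 'a) cat \<Rightarrow> ('o, 'a) awfs_data \<Rightarrow> 'a \<times> 'a \<Rightarrow> 'a sq" where
  "coalg_sq M W = (\<lambda>(j, s). (j, Idt M (Dom M j), s, lft W j))"

definition alg_sq :: "('o, 'a) cat \<Rightarrow> ('o, 'a) awfs_data \<Rightarrow> 'a \<times> 'a \<Rightarrow> 'a sq" where
  "alg_sq M W = (\<lambda>(f, r). (rgt W f, r, Idt M (Cod M f), f))"

type_synonym 'a str_arr = "('a \<times> 'a) \<times> 'a sq \<times> ('a \<times> 'a)"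

definition coalg_cat ::
  "('o, 'a) cat \<Rightarrow> ('o, 'a) awfs_data \<Rightarrow> ('a \<times> 'a, 'a str_arr) cat" where
  "coalg_cat M W = structured_cat M
     {x. coalgebra (arrow_cat M) (Lfun W) (eps M W) (delta M W) (fst x) (coalg_sq M W x)}
     (\<lambda>x \<sigma> y. amap (Lfun W) \<sigma> \<cdot>\<^bsub>arrow_cat M\<^esub> coalg_sq M W x
        = coalg_sq M W y \<cdot>\<^bsub>arrow_cat M\<^esub> \<sigma>)"

definition alg_cat ::
  "('o, 'a) cat \<Rightarrow> ('o, 'a) awfs_data \<Rightarrow> ('a \<times> 'a, 'a str_arr) cat" where
  "alg_cat M W = structured_cat M
     {x. algebra (arrow_cat M) (Rfun W) (eta M W) (mu M W) (fst x) (alg_sq M W x)}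
     (\<lambda>x \<sigma> y. alg_sq M W y \<cdot>\<^bsub>arrow_cat M\<^esub> amap (Rfun W) \<sigma>
        = \<sigma> \<cdot>\<^bsub>arrow_cat M\<^esub> alg_sq M W x)"

definition awfs_morphism ::
  "('o, 'a) cat \<Rightarrow> ('o, 'a) awfs_data \<Rightarrow> ('o, 'a) awfs_data \<Rightarrow> ('a \<Rightarrow> 'a) \<Rightarrow> bool" where
  "awfs_morphism M W W' \<xi> \<longleftrightarrow> nat_trans (arrow_cat M) M (mid W) (mid W') \<xi> \<and>
     comonad_morphism (arrow_cat M) (Lfun W) (eps M W) (delta M W)
       (Lfun W') (eps M W') (delta M W')
       (\<lambda>f. (lft W f, Idt M (Dom M f), \<xi> f, lft W' f)) \<and>
     monad_morphism (arrow_cat M) (Rfun W) (eta M W) (mu M W)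
       (Rfun W') (eta M W') (mu M W')
       (\<lambda>f. (rgt W f, \<xi> f, Idt M (Cod M f), rgt W' f))"

definition coalg_map ::
  "('o, 'a) cat \<Rightarrow> ('a \<Rightarrow> 'a) \<Rightarrow> ('a \<times> 'a, 'a str_arr, 'a \<times> 'a, 'a str_arr) func" where
  "coalg_map M \<xi> =
     (let F = (\<lambda>(j, s). (j, \<xi> j \<cdot>\<^bsub>M\<^esub> s))
      in \<lparr>omap = F, amap = (\<lambda>(x, \<sigma>, y). (F x, \<sigma>, F y))\<rparr>)"


section \<open>Generation by a category of arrows\<close>

definition solution :: "('o, 'a) cat \<Rightarrow> 'a sq \<Rightarrow> 'a \<Rightarrow> bool" where
  "solution M = (\<lambda>(j, u, v, f) w.
     w \<in> Hom M (Cod M j) (Dom M f) \<and> w \<cdot>\<^bsub>M\<^esub> j = u \<and> f \<cdot>\<^bsub>M\<^esub> w = v)"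

definition problems ::
  "('o, 'a) cat \<Rightarrow> ('x, 'y) cat \<Rightarrow> ('x, 'y, 'a, 'a sq) func \<Rightarrow> 'a \<Rightarrow> ('x \<times> 'a sq) set" where
  "problems M J U f = (SIGMA j : Obj J. Hom (arrow_cat M) (omap U j) f)"

text \<open>A choice \<open>\<phi>\<close> of solutions is an extensional function, so that distinct HOL functions are
  distinct choices.\<close>

definition lifting_cat ::
  "('o, 'a) cat \<Rightarrow> ('x, 'y) cat \<Rightarrow> ('x, 'y, 'a, 'a sq) func
    \<Rightarrow> ('a \<times> ('x \<times> 'a sq \<Rightarrow> 'a), ('a \<times> ('x \<times> 'a sq \<Rightarrow> 'a)) \<times> 'a sq \<times> ('a \<times> ('x \<times> 'a sq \<Rightarrow> 'a))) cat"
  where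
  "lifting_cat M J U = structured_cat M
     {(f, \<phi>). f \<in> Arr M \<and> \<phi> \<in> extensional (problems M J U f) \<and>
        (\<forall>(j, \<sigma>) \<in> problems M J U f. solution M \<sigma> (\<phi> (j, \<sigma>))) \<and>
        (\<forall>x\<in>Arr J. \<forall>\<sigma>\<in>Hom (arrow_cat M) (omap U (Cod J x)) f.
           \<phi> (Dom J x, \<sigma> \<cdot>\<^bsub>arrow_cat M\<^esub> amap U x)
             = \<phi> (Cod J x, \<sigma>) \<cdot>\<^bsub>M\<^esub> sq_bot (amap U x))}
     (\<lambda>(f, \<phi>) \<sigma> (g, \<psi>). \<forall>(j, \<tau>) \<in> problems M J U f.
        \<psi> (j, \<sigma> \<cdot>\<^bsub>arrow_cat M\<^esub> \<tau>) = sq_top \<sigma> \<cdot>\<^bsub>M\<^esub> \<phi> (j, \<tau>))"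

text \<open>The functor from algebras to \<open>lifting_cat\<close> given by the canonical solutions \<open>r \<cdot> E(u, v) \<cdot> s\<close>,
  where \<open>s\<close> is the coalgebra structure on the image of \<open>j\<close>.\<close>

definition canonical_lifts ::
  "('o, 'a) cat \<Rightarrow> ('x, 'y) cat \<Rightarrow> ('x, 'y, 'a, 'a sq) func \<Rightarrow> ('o, 'a) awfs_data
    \<Rightarrow> ('x, 'y, 'a \<times> 'a, 'a str_arr) func
    \<Rightarrow> ('a \<times> 'a, 'a str_arr, 'a \<times> ('x \<times> 'a sq \<Rightarrow> 'a),
        ('a \<times> ('x \<times> 'a sq \<Rightarrow> 'a)) \<times> 'a sq \<times> ('a \<times> ('x \<times> 'a sq \<Rightarrow> 'a))) func" where
  "canonical_lifts M J U W u =
     (let F = (\<lambda>(f, r). (f, \<lambda>(j, \<sigma>) \<in> problems M J U f.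
                 r \<cdot>\<^bsub>M\<^esub> amap (mid W) \<sigma> \<cdot>\<^bsub>M\<^esub> snd (omap u j)))
      in \<lparr>omap = F, amap = (\<lambda>(x, \<sigma>, y). (F x, \<sigma>, F y))\<rparr>)"

text \<open>\<open>W\<close> is the awfs generated by \<open>U : J \<rightarrow> M\<^sup>2\<close>, with unit functor \<open>u\<close>.\<close>

definition generated_awfs ::
  "('o, 'a) cat \<Rightarrow> ('x, 'y) cat \<Rightarrow> ('x, 'y, 'a, 'a sq) func \<Rightarrow> ('o, 'a) awfs_data
    \<Rightarrow> ('x, 'y, 'a \<times> 'a, 'a str_arr) func \<Rightarrow> bool" where
  "generated_awfs M J U W u \<longleftrightarrow>
     awfs M W \<and> is_functor J (arrow_cat M) U \<and>
     is_functor J (coalg_cat M W) u \<and> func_eq J (comp_func forget u) U \<and>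
     (\<forall>(W' :: ('o, 'a) awfs_data) \<Phi>.
        awfs M W' \<and> is_functor J (coalg_cat M W') \<Phi> \<and> func_eq J (comp_func forget \<Phi>) U \<longrightarrow>
        (\<exists>!\<xi>. \<xi> \<in> extensional (Arr M) \<and> awfs_morphism M W W' \<xi> \<and>
              func_eq J \<Phi> (comp_func (coalg_map M \<xi>) u))) \<and>
     cat_iso (alg_cat M W) (lifting_cat M J U) (canonical_lifts M J U W u)"


section \<open>Pushouts and pullbacks\<close>

definition is_pushout :: "('o, 'a) cat \<Rightarrow> 'a \<Rightarrow> 'a \<Rightarrow> 'a \<times> 'a \<Rightarrow> bool" where
  "is_pushout C f g = (\<lambda>(p, q).
     p \<in> Hom C (Cod C f) (Cod C p) \<and> q \<in> Hom C (Cod C g) (Cod C p) \<and> p \<cdot>\<^bsub>C\<^esub> f = q \<cdot>\<^bsub>C\<^esub> g \<and>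
     (\<forall>z x y. x \<in> Hom C (Cod C f) z \<and> y \<in> Hom C (Cod C g) z \<and> x \<cdot>\<^bsub>C\<^esub> f = y \<cdot>\<^bsub>C\<^esub> g \<longrightarrow>
        (\<exists>!h. h \<in> Hom C (Cod C p) z \<and> h \<cdot>\<^bsub>C\<^esub> p = x \<and> h \<cdot>\<^bsub>C\<^esub> q = y)))"

definition is_pullback :: "('o, 'a) cat \<Rightarrow> 'a \<Rightarrow> 'a \<Rightarrow> 'a \<times> 'a \<Rightarrow> bool" where
  "is_pullback C f g = (\<lambda>(p, q).
     p \<in> Hom C (Dom C p) (Dom C f) \<and> q \<in> Hom C (Dom C p) (Dom C g) \<and> f \<cdot>\<^bsub>C\<^esub> p = g \<cdot>\<^bsub>C\<^esub> q \<and>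
     (\<forall>z x y. x \<in> Hom C z (Dom C f) \<and> y \<in> Hom C z (Dom C g) \<and> f \<cdot>\<^bsub>C\<^esub> x = g \<cdot>\<^bsub>C\<^esub> y \<longrightarrow>
        (\<exists>!h. h \<in> Hom C z (Dom C p) \<and> p \<cdot>\<^bsub>C\<^esub> h = x \<and> q \<cdot>\<^bsub>C\<^esub> h = y)))"

definition pushout_choice :: "('o, 'a) cat \<Rightarrow> ('a \<Rightarrow> 'a \<Rightarrow> 'a \<times> 'a) \<Rightarrow> bool" where
  "pushout_choice C po \<longleftrightarrow>
     (\<forall>f\<in>Arr C. \<forall>g\<in>Arr C. Dom C f = Dom C g \<longrightarrow> is_pushout C f g (po f g))"

definition pullback_choice :: "('o, 'a) cat \<Rightarrow> ('a \<Rightarrow> 'a \<Rightarrow> 'a \<times> 'a) \<Rightarrow> bool" where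
  "pullback_choice C pb \<longleftrightarrow>
     (\<forall>f\<in>Arr C. \<forall>g\<in>Arr C. Cod C f = Cod C g \<longrightarrow> is_pullback C f g (pb f g))"

definition has_pullbacks :: "('o, 'a) cat \<Rightarrow> bool" where
  "has_pullbacks C \<longleftrightarrow>
     (\<forall>f\<in>Arr C. \<forall>g\<in>Arr C. Cod C f = Cod C g \<longrightarrow> (\<exists>c. is_pullback C f g c))"

definition copair :: "('o, 'a) cat \<Rightarrow> 'a \<times> 'a \<Rightarrow> 'a \<Rightarrow> 'a \<Rightarrow> 'a" where
  "copair C = (\<lambda>(p, q) x y.
     THE h. h \<in> Hom C (Cod C p) (Cod C x) \<and> h \<cdot>\<^bsub>C\<^esub> p = x \<and> h \<cdot>\<^bsub>C\<^esub> q = y)"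

definition pair :: "('o, 'a) cat \<Rightarrow> 'a \<times> 'a \<Rightarrow> 'a \<Rightarrow> 'a \<Rightarrow> 'a" where
  "pair C = (\<lambda>(p, q) x y.
     THE h. h \<in> Hom C (Dom C x) (Dom C p) \<and> p \<cdot>\<^bsub>C\<^esub> h = x \<and> q \<cdot>\<^bsub>C\<^esub> h = y)"


section \<open>Two-variable adjunctions\<close>

text \<open>\<open>tphi k m n\<close> and \<open>tpsi k m n\<close> are the bijections from \<open>N(k \<otimes> m, n)\<close> to \<open>M(m, hom(k, n))\<close>
  and to \<open>K(k, hom\<^sub>r(m, n))\<close>; the isomorphism between the latter two is their composite.\<close>

record ('ok, 'ak, 'om, 'am, 'on, 'an) tva =
  tens :: "('ok \<times> 'om, 'ak \<times> 'am, 'on, 'an) func"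
  ihom :: "('ok \<times> 'on, 'ak \<times> 'an, 'om, 'am) func"
  rhom :: "('om \<times> 'on, 'am \<times> 'an, 'ok, 'ak) func"
  tphi :: "'ok \<Rightarrow> 'om \<Rightarrow> 'on \<Rightarrow> 'an \<Rightarrow> 'am"
  tpsi :: "'ok \<Rightarrow> 'om \<Rightarrow> 'on \<Rightarrow> 'an \<Rightarrow> 'ak"

definition two_var_adjunction ::
  "('ok, 'ak) cat \<Rightarrow> ('om, 'am) cat \<Rightarrow> ('on, 'an) cat
    \<Rightarrow> ('ok, 'ak, 'om, 'am, 'on, 'an) tva \<Rightarrow> bool" where
  "two_var_adjunction K M N V \<longleftrightarrow>
     category K \<and> category M \<and> category N \<and>
     is_functor (prod_cat K M) N (tens V) \<and>
     is_functor (prod_cat (op_cat K) N) M (ihom V) \<and>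
     is_functor (prod_cat (op_cat M) N) K (rhom V) \<and>
     (\<forall>k\<in>Obj K. \<forall>m\<in>Obj M. \<forall>n\<in>Obj N.
        bij_betw (tphi V k m n) (Hom N (omap (tens V) (k, m)) n) (Hom M m (omap (ihom V) (k, n))) \<and>
        bij_betw (tpsi V k m n) (Hom N (omap (tens V) (k, m)) n) (Hom K k (omap (rhom V) (m, n)))) \<and>
     (\<forall>a\<in>Arr K. \<forall>b\<in>Arr M. \<forall>c\<in>Arr N.
        \<forall>h\<in>Hom N (omap (tens V) (Cod K a, Cod M b)) (Dom N c).
        tphi V (Dom K a) (Dom M b) (Cod N c) (c \<cdot>\<^bsub>N\<^esub> h \<cdot>\<^bsub>N\<^esub> amap (tens V) (a, b))
          = amap (ihom V) (a, c) \<cdot>\<^bsub>M\<^esub> tphi V (Cod K a) (Cod M b) (Dom N c) h \<cdot>\<^bsub>M\<^esub> b \<and>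
        tpsi V (Dom K a) (Dom M b) (Cod N c) (c \<cdot>\<^bsub>N\<^esub> h \<cdot>\<^bsub>N\<^esub> amap (tens V) (a, b))
          = amap (rhom V) (b, c) \<cdot>\<^bsub>K\<^esub> tpsi V (Cod K a) (Cod M b) (Dom N c) h \<cdot>\<^bsub>K\<^esub> a)"

definition tva_swap ::
  "('ok, 'ak, 'om, 'am, 'on, 'an) tva \<Rightarrow> ('om, 'am, 'ok, 'ak, 'on, 'an) tva" where
  "tva_swap V =
     \<lparr>tens = \<lparr>omap = omap (tens V) \<circ> prod.swap, amap = amap (tens V) \<circ> prod.swap\<rparr>,
      ihom = rhom V, rhom = ihom V,
      tphi = (\<lambda>m k n. tpsi V k m n), tpsi = (\<lambda>m k n. tphi V k m n)\<rparr>"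

text \<open>In the following, \<open>i : A \<rightarrow> B\<close> is an arrow of \<open>K\<close>; \<open>po\<close> and \<open>pb\<close> choose pushouts in \<open>N\<close> and
  pullbacks in \<open>M\<close>. For \<open>j : I \<rightarrow> J\<close>, \<open>ptens_cocone\<close> is the chosen pushout of
  \<open>A \<otimes> J \<leftarrow> A \<otimes> I \<rightarrow> B \<otimes> I\<close>; for \<open>f : X \<rightarrow> Y\<close>, \<open>phom_cone\<close> is the chosen pullback of
  \<open>hom(B, Y) \<rightarrow> hom(A, Y) \<leftarrow> hom(A, X)\<close>.\<close>

definition ptens_cocone ::
  "('ok, 'ak) cat \<Rightarrow> ('om, 'am) cat \<Rightarrow> ('ok, 'ak, 'om, 'am, 'on, 'an) tva
    \<Rightarrow> ('an \<Rightarrow> 'an \<Rightarrow> 'an \<times> 'an) \<Rightarrow> 'ak \<Rightarrow> 'am \<Rightarrow> 'an \<times> 'an" where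
  "ptens_cocone K M V po i j =
     po (amap (tens V) (Idt K (Dom K i), j)) (amap (tens V) (i, Idt M (Dom M j)))"

definition ptens ::
  "('ok, 'ak) cat \<Rightarrow> ('om, 'am) cat \<Rightarrow> ('on, 'an) cat \<Rightarrow> ('ok, 'ak, 'om, 'am, 'on, 'an) tva
    \<Rightarrow> ('an \<Rightarrow> 'an \<Rightarrow> 'an \<times> 'an) \<Rightarrow> 'ak \<Rightarrow> 'am \<Rightarrow> 'an" where
  "ptens K M N V po i j = copair N (ptens_cocone K M V po i j)
     (amap (tens V) (i, Idt M (Cod M j))) (amap (tens V) (Idt K (Cod K i), j))"

definition ptens_func ::
  "('ok, 'ak) cat \<Rightarrow> ('om, 'am) cat \<Rightarrow> ('on, 'an) cat \<Rightarrow> ('ok, 'ak, 'om, 'am, 'on, 'an) tva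
    \<Rightarrow> ('an \<Rightarrow> 'an \<Rightarrow> 'an \<times> 'an) \<Rightarrow> 'ak \<Rightarrow> ('am, 'am sq, 'an, 'an sq) func" where
  "ptens_func K M N V po i =
     \<lparr>omap = ptens K M N V po i,
      amap = (\<lambda>(j, u, v, k).
        (ptens K M N V po i j,
         copair N (ptens_cocone K M V po i j)
           (fst (ptens_cocone K M V po i k) \<cdot>\<^bsub>N\<^esub> amap (tens V) (Idt K (Dom K i), v))
           (snd (ptens_cocone K M V po i k) \<cdot>\<^bsub>N\<^esub> amap (tens V) (Idt K (Cod K i), u)),
         amap (tens V) (Idt K (Cod K i), v),
         ptens K M N V po i k))\<rparr>"

definition phom_cone ::
  "('ok, 'ak) cat \<Rightarrow> ('on, 'an) cat \<Rightarrow> ('ok, 'ak, 'om, 'am, 'on, 'an) tva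
    \<Rightarrow> ('am \<Rightarrow> 'am \<Rightarrow> 'am \<times> 'am) \<Rightarrow> 'ak \<Rightarrow> 'an \<Rightarrow> 'am \<times> 'am" where
  "phom_cone K N V pb i f =
     pb (amap (ihom V) (i, Idt N (Cod N f))) (amap (ihom V) (Idt K (Dom K i), f))"

definition phom ::
  "('ok, 'ak) cat \<Rightarrow> ('om, 'am) cat \<Rightarrow> ('on, 'an) cat \<Rightarrow> ('ok, 'ak, 'om, 'am, 'on, 'an) tva
    \<Rightarrow> ('am \<Rightarrow> 'am \<Rightarrow> 'am \<times> 'am) \<Rightarrow> 'ak \<Rightarrow> 'an \<Rightarrow> 'am" where
  "phom K M N V pb i f = pair M (phom_cone K N V pb i f)
     (amap (ihom V) (Idt K (Cod K i), f)) (amap (ihom V) (i, Idt N (Dom N f)))"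

definition phom_func ::
  "('ok, 'ak) cat \<Rightarrow> ('om, 'am) cat \<Rightarrow> ('on, 'an) cat \<Rightarrow> ('ok, 'ak, 'om, 'am, 'on, 'an) tva
    \<Rightarrow> ('am \<Rightarrow> 'am \<Rightarrow> 'am \<times> 'am) \<Rightarrow> 'ak \<Rightarrow> ('an, 'an sq, 'am, 'am sq) func" where
  "phom_func K M N V pb i =
     \<lparr>omap = phom K M N V pb i,
      amap = (\<lambda>(f, u, v, g).
        (phom K M N V pb i f,
         amap (ihom V) (Idt K (Cod K i), u),
         pair M (phom_cone K N V pb i g)
           (amap (ihom V) (Idt K (Cod K i), v) \<cdot>\<^bsub>M\<^esub> fst (phom_cone K N V pb i f))
           (amap (ihom V) (Idt K (Dom K i), u) \<cdot>\<^bsub>M\<^esub> snd (phom_cone K N V pb i f)),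
         phom K M N V pb i g))\<rparr>"


section \<open>The adjunctions under consideration\<close>

text \<open>Each of the forms below describes a pair: an adjunction \<open>G \<stileturn> H\<close> between the arrow categories
  and the adjunction \<open>T \<stileturn> S\<close> between \<open>M\<close> and \<open>N\<close> with \<open>cod \<circ> G = T \<circ> cod\<close>, \<open>dom \<circ> H = S \<circ> dom\<close>
  over which the structure maps of an adjunction of awfs live.\<close>

definition arrow_adj ::
  "('o, 'a) cat \<Rightarrow> ('p, 'b) cat \<Rightarrow> ('o, 'a, 'p, 'b) adj \<Rightarrow> ('a, 'a sq, 'b, 'b sq) adj" where
  "arrow_adj M N A =
     \<lparr>ladj = arrow_func (ladj A), radj = arrow_func (radj A),
      transp = (\<lambda>j f (_, u, v, _).
        (j, transp A (Dom M j) (Dom N f) u, transp A (Cod M j) (Cod N f) v, amap (radj A) f))\<rparr>"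

text \<open>The adjunction \<open>k \<otimes> - \<stileturn> hom(k, -)\<close>.\<close>

definition tens_adj ::
  "('ok, 'ak) cat \<Rightarrow> ('ok, 'ak, 'om, 'am, 'on, 'an) tva \<Rightarrow> 'ok \<Rightarrow> ('om, 'am, 'on, 'an) adj" where
  "tens_adj K V k =
     \<lparr>ladj = \<lparr>omap = (\<lambda>m. omap (tens V) (k, m)), amap = (\<lambda>b. amap (tens V) (Idt K k, b))\<rparr>,
      radj = \<lparr>omap = (\<lambda>n. omap (ihom V) (k, n)), amap = (\<lambda>c. amap (ihom V) (Idt K k, c))\<rparr>,
      transp = tphi V k\<rparr>"

text \<open>A square \<open>(u, v)\<close> from the pushout-product of \<open>i\<close> and \<open>j\<close> to \<open>f\<close> corresponds to the square
  from \<open>j\<close> to the pullback-hom whose top is the transpose of the restriction of \<open>u\<close> to \<open>B \<otimes> I\<close>, and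
  whose bottom is induced by the transposes of \<open>v\<close> and of the restriction of \<open>u\<close> to \<open>A \<otimes> J\<close>.\<close>

definition ptens_adj ::
  "('ok, 'ak) cat \<Rightarrow> ('om, 'am) cat \<Rightarrow> ('on, 'an) cat \<Rightarrow> ('ok, 'ak, 'om, 'am, 'on, 'an) tva
    \<Rightarrow> ('an \<Rightarrow> 'an \<Rightarrow> 'an \<times> 'an) \<Rightarrow> ('am \<Rightarrow> 'am \<Rightarrow> 'am \<times> 'am) \<Rightarrow> 'ak
    \<Rightarrow> ('am, 'am sq, 'an, 'an sq) adj" where
  "ptens_adj K M N V po pb i =
     \<lparr>ladj = ptens_func K M N V po i, radj = phom_func K M N V pb i,
      transp = (\<lambda>j f (_, u, v, _).
        (j,
         tphi V (Cod K i) (Dom M j) (Dom N f) (u \<cdot>\<^bsub>N\<^esub> snd (ptens_cocone K M V po i j)),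
         pair M (phom_cone K N V pb i f)
           (tphi V (Cod K i) (Cod M j) (Cod N f) v)
           (tphi V (Dom K i) (Cod M j) (Dom N f) (u \<cdot>\<^bsub>N\<^esub> fst (ptens_cocone K M V po i j))),
         phom K M N V pb i f))\<rparr>"

definition arrow_form ::
  "('o, 'a) cat \<Rightarrow> ('p, 'b) cat
    \<Rightarrow> ('a, 'a sq, 'b, 'b sq) adj \<Rightarrow> ('o, 'a, 'p, 'b) adj \<Rightarrow> bool" where
  "arrow_form M N A2 A \<longleftrightarrow> adjunction M N A \<and> A2 = arrow_adj M N A"

text \<open>The two alternatives have \<open>i\<close> in the first and in the second variable of the given two-variable
  adjunction.\<close>

definition ptens_form ::
  "('ok, 'ak) cat \<Rightarrow> ('o, 'a) cat \<Rightarrow> ('p, 'b) cat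
    \<Rightarrow> ('a, 'a sq, 'b, 'b sq) adj \<Rightarrow> ('o, 'a, 'p, 'b) adj \<Rightarrow> bool" where
  "ptens_form K M N A2 A \<longleftrightarrow>
     (\<exists>i po pb. i \<in> Arr K \<and> has_pullbacks K \<and> pullback_choice M pb \<and> pushout_choice N po \<and>
       ((\<exists>V. two_var_adjunction K M N V \<and>
             A2 = ptens_adj K M N V po pb i \<and> A = tens_adj K V (Cod K i)) \<or>
        (\<exists>V. two_var_adjunction M K N V \<and>
             A2 = ptens_adj K M N (tva_swap V) po pb i \<and> A = tens_adj K (tva_swap V) (Cod K i))))"

definition composite_form ::
  "('ok, 'ak) cat \<Rightarrow> ('o, 'a) cat \<Rightarrow> ('q, 'c) cat \<Rightarrow> ('p, 'b) cat
    \<Rightarrow> ('a, 'a sq, 'b, 'b sq) adj \<Rightarrow> ('o, 'a, 'p, 'b) adj \<Rightarrow> bool" where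
  "composite_form K M P N A2 A \<longleftrightarrow>
     (\<exists>B2 B C2 C.
        (arrow_form M P B2 B \<and> ptens_form K P N C2 C \<or>
         ptens_form K M P B2 B \<and> arrow_form P N C2 C) \<and>
        A2 = comp_adj C2 B2 \<and> A = comp_adj C B)"


section \<open>Adjunctions of awfs\<close>

definition lift_coalg ::
  "('p, 'b) cat \<Rightarrow> ('a, 'a sq, 'b, 'b sq) adj \<Rightarrow> ('o, 'a, 'p, 'b) adj \<Rightarrow> ('a \<Rightarrow> 'b)
    \<Rightarrow> ('a \<times> 'a, 'a str_arr, 'b \<times> 'b, 'b str_arr) func" where
  "lift_coalg N A2 A l =
     (let F = (\<lambda>(j, t). (omap (ladj A2) j, l j \<cdot>\<^bsub>N\<^esub> amap (ladj A) t))
      in \<lparr>omap = F, amap = (\<lambda>(x, \<sigma>, y). (F x, amap (ladj A2) \<sigma>, F y))\<rparr>)"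

definition lift_alg ::
  "('o, 'a) cat \<Rightarrow> ('a, 'a sq, 'b, 'b sq) adj \<Rightarrow> ('o, 'a, 'p, 'b) adj \<Rightarrow> ('b \<Rightarrow> 'a)
    \<Rightarrow> ('b \<times> 'b, 'b str_arr, 'a \<times> 'a, 'a str_arr) func" where
  "lift_alg M A2 A r =
     (let F = (\<lambda>(f, t). (omap (radj A2) f, amap (radj A) t \<cdot>\<^bsub>M\<^esub> r f))
      in \<lparr>omap = F, amap = (\<lambda>(x, \<sigma>, y). (F x, amap (radj A2) \<sigma>, F y))\<rparr>)"

text \<open>Here \<open>l\<close> has components \<open>T(Qj) \<rightarrow> E(Gj)\<close> and \<open>r\<close> has components \<open>Q(Hf) \<rightarrow> S(Ef)\<close>, where
  \<open>A2 = (G \<stileturn> H)\<close>, \<open>A = (T \<stileturn> S)\<close>, and \<open>Q\<close>, \<open>E\<close> are the middle-object functors of \<open>W\<close>, \<open>W'\<close>.\<close>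

definition awfs_adjunction ::
  "('o, 'a) cat \<Rightarrow> ('o, 'a) awfs_data \<Rightarrow> ('p, 'b) cat \<Rightarrow> ('p, 'b) awfs_data
    \<Rightarrow> ('a, 'a sq, 'b, 'b sq) adj \<Rightarrow> ('o, 'a, 'p, 'b) adj \<Rightarrow> ('a \<Rightarrow> 'b) \<Rightarrow> ('b \<Rightarrow> 'a) \<Rightarrow> bool" where
  "awfs_adjunction M W N W' A2 A l r \<longleftrightarrow>
     mates (arrow_cat M) (arrow_cat N) A2 M N A (mid W) (mid W') l r \<and>
     is_functor (coalg_cat M W) (coalg_cat N W') (lift_coalg N A2 A l) \<and>
     is_functor (alg_cat N W') (alg_cat M W) (lift_alg M A2 A r)"

end

theory Submission
  imports Defs
begin

text \<open>
  Write \<open>G \<stileturn> H\<close> for the adjunction between the arrow categories and \<open>T \<stileturn> S\<close> for the one between the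
  base categories. The three forms of \<open>G \<stileturn> H\<close> enter only through one property, \<open>lifting_adj\<close>: the
  solutions of a lifting problem \<open>G j \<Rightarrow> f\<close> correspond under \<open>T \<stileturn> S\<close> to the solutions of its
  transpose \<open>j \<Rightarrow> H f\<close>.

  The adjunction of awfs is constructed on the side of algebras. Let \<open>f\<close> carry an algebra structure for
  the awfs on \<open>N\<close>. The coalgebras \<open>\<Phi> x\<close> give canonical solutions to all lifting problems
  \<open>G (U x) \<Rightarrow> f\<close>, and their transposes form a choice of solutions of the generating arrows against
  \<open>H f\<close>. Since the awfs on \<open>M\<close> is generated by \<open>J\<close>, this choice is the same thing as an algebra
  structure \<open>\<alpha>\<close> on \<open>H f\<close>. In this way \<open>H\<close> lifts to algebras. Evaluating the lift at free algebras gives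
  the transformation \<open>\<rho>\<close>, and \<open>lam\<close> is its mate. Uniqueness holds because any adjunction of awfs
  that induces \<open>\<Phi>\<close> induces the same solutions against the generating arrows, hence the same lift of \<open>H\<close>
  to algebras.

  The main point is that \<open>lam\<close> carries coalgebras to coalgebras. The comultiplication of an awfs is
  determined by the composition of its algebras (\<open>comult_alg_map\<close>), so it suffices to show that a
  structure induced by \<open>lam\<close> solves a lifting problem against a composite \<open>g \<cdot> f\<close> of algebras in two
  steps, first against \<open>g\<close> and then against \<open>f\<close>. This is clear for the given coalgebras \<open>\<Phi> x\<close>, but not
  for the structures induced from arbitrary coalgebras on \<open>M\<close>. The transposed two-step solutions form,
  however, a lifting operation on \<open>H (g \<cdot> f)\<close> that is natural in coalgebra maps and compatible with
  composition of coalgebras (\<open>two_step_comp\<close>), and such operations are algebra structures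
  (\<open>lifting_operation_alg\<close>). Hence there are two algebra structures on \<open>H (g \<cdot> f)\<close>, with the same solutions
  against the generating arrows. They are equal, and so the two-step property holds for all coalgebras
  (\<open>transpose_two_step\<close>).
\<close>

section \<open>Categories, functors and squares\<close>

context category
begin

lemma comp_arr [simp]:
  assumes "f \<in> Arr C" "g \<in> Arr C" "Cod C f = Dom C g"
  shows "g \<cdot> f \<in> Arr C" "Dom C (g \<cdot> f) = Dom C f" "Cod C (g \<cdot> f) = Cod C g"
  using Comp_Hom[of f "Dom C f" "Dom C g" g "Cod C g"] assms by (auto simp: Hom_def)

lemma idt_arr [simp]:
  assumes "x \<in> Obj C"
  shows "Idt C x \<in> Arr C" "Dom C (Idt C x) = x" "Cod C (Idt C x) = x"
  using Idt_Hom[OF assms] by (auto simp: Hom_def)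

lemma obj_simps [simp]: "f \<in> Arr C \<Longrightarrow> Dom C f \<in> Obj C" "f \<in> Arr C \<Longrightarrow> Cod C f \<in> Obj C"
  by (auto simp: Dom_closed Cod_closed)

lemma comp_idt [simp]: "f \<in> Arr C \<Longrightarrow> Dom C f = x \<Longrightarrow> f \<cdot> Idt C x = f"
  using Comp_Idt[of f x "Cod C f"] by (simp add: Hom_def)

lemma idt_comp [simp]: "f \<in> Arr C \<Longrightarrow> Cod C f = y \<Longrightarrow> Idt C y \<cdot> f = f"
  using Idt_Comp[of f "Dom C f" y] by (simp add: Hom_def)

lemma assoc:
  assumes "f \<in> Arr C" "g \<in> Arr C" "h \<in> Arr C" "Cod C f = Dom C g" "Cod C g = Dom C h"
  shows "(h \<cdot> g) \<cdot> f = h \<cdot> (g \<cdot> f)"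
  using Comp_assoc[of f "Dom C f" "Dom C g" g "Dom C h" h "Cod C h"] assms by (simp add: Hom_def)

text \<open>An equation between composites, in the form in which it rewrites right-nested composites.\<close>

lemma comp_ext:
  assumes "g \<cdot> f = k" "f \<in> Arr C" "g \<in> Arr C" "Cod C f = Dom C g" "x \<in> Arr C" "Cod C x = Dom C f"
  shows "g \<cdot> (f \<cdot> x) = k \<cdot> x"
  using assms(1) assoc[OF assms(5,2,3,6,4)] by simp

end

context is_functor
begin

lemma amap_arr [simp]:
  assumes "f \<in> Arr C"
  shows "amap F f \<in> Arr D" "Dom D (amap F f) = omap F (Dom C f)" "Cod D (amap F f) = omap F (Cod C f)"
  using amap_Hom[of f "Dom C f" "Cod C f"] assms by (auto simp: Hom_def)

lemma omap_obj [simp]: "x \<in> Obj C \<Longrightarrow> omap F x \<in> Obj D"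
  by (rule omap_closed)

lemma amap_idt [simp]: "x \<in> Obj C \<Longrightarrow> amap F (Idt C x) = Idt D (omap F x)"
  by (rule amap_Idt)

lemma amap_comp:
  assumes "f \<in> Arr C" "g \<in> Arr C" "Cod C f = Dom C g"
  shows "amap F (g \<cdot>\<^bsub>C\<^esub> f) = amap F g \<cdot>\<^bsub>D\<^esub> amap F f"
  using amap_Comp[of f "Dom C f" "Dom C g" g "Cod C g"] assms by (simp add: Hom_def)

end

lemma is_functorI:
  assumes "category C" "category D"
    and "\<And>x. x \<in> Obj C \<Longrightarrow> omap F x \<in> Obj D"
    and "\<And>f. f \<in> Arr C \<Longrightarrow> amap F f \<in> Hom D (omap F (Dom C f)) (omap F (Cod C f))"
    and "\<And>x. x \<in> Obj C \<Longrightarrow> amap F (Idt C x) = Idt D (omap F x)"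
    and "\<And>f g. f \<in> Arr C \<Longrightarrow> g \<in> Arr C \<Longrightarrow> Cod C f = Dom C g \<Longrightarrow>
           amap F (g \<cdot>\<^bsub>C\<^esub> f) = amap F g \<cdot>\<^bsub>D\<^esub> amap F f"
  shows "is_functor C D F"
  using assms unfolding is_functor_def is_functor_axioms_def Hom_def by auto

text \<open>The square \<open>(u, v) : f \<Rightarrow> g\<close>, with its typing spelled out for rewriting.\<close>

definition square :: "('o, 'a) cat \<Rightarrow> 'a \<Rightarrow> 'a \<Rightarrow> 'a \<Rightarrow> 'a \<Rightarrow> bool" where
  "square M f u v g \<longleftrightarrow> f \<in> Arr M \<and> g \<in> Arr M \<and> u \<in> Arr M \<and> v \<in> Arr M \<and>
     Dom M u = Dom M f \<and> Cod M u = Dom M g \<and> Dom M v = Cod M f \<and> Cod M v = Cod M g \<and>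
     g \<cdot>\<^bsub>M\<^esub> u = v \<cdot>\<^bsub>M\<^esub> f"

lemma arrow_sel [simp]:
  "Obj (arrow_cat M) = Arr M"
  "Dom (arrow_cat M) (f, u, v, g) = f"
  "Cod (arrow_cat M) (f, u, v, g) = g"
  "Idt (arrow_cat M) f = (f, Idt M (Dom M f), Idt M (Cod M f), f)"
  "(f', u', v', g') \<cdot>\<^bsub>arrow_cat M\<^esub> (f, u, v, g) = (f, u' \<cdot>\<^bsub>M\<^esub> u, v' \<cdot>\<^bsub>M\<^esub> v, g')"
  by (simp_all add: arrow_cat_def)

lemma arrow_Arr: "(f, u, v, g) \<in> Arr (arrow_cat M) \<longleftrightarrow> square M f u v g"
  by (auto simp: arrow_cat_def square_def Hom_def)

lemma sq_sel [simp]: "sq_top (f, u, v, g) = u" "sq_bot (f, u, v, g) = v"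
  by (simp_all add: sq_top_def sq_bot_def)

lemma arrow_HomE:
  assumes "\<sigma> \<in> Hom (arrow_cat M) f g"
  obtains u v where "\<sigma> = (f, u, v, g)" "square M f u v g"
  using assms by (cases \<sigma>) (auto simp: Hom_def arrow_Arr)

lemma arrow_HomI: "square M f u v g \<Longrightarrow> (f, u, v, g) \<in> Hom (arrow_cat M) f g"
  by (simp add: Hom_def arrow_Arr)

lemma arrow_Hom_iff: "(f, u, v, g) \<in> Hom (arrow_cat M) f g \<longleftrightarrow> square M f u v g"
  by (simp add: Hom_def arrow_Arr)

context category
begin

lemma square_comp:
  assumes "square C f u v g" "square C g u' v' h"
  shows "square C f (u' \<cdot> u) (v' \<cdot> v) h"
proof -
  have "h \<cdot> (u' \<cdot> u) = (h \<cdot> u') \<cdot> u"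
    using assms by (intro assoc[symmetric]) (simp_all add: square_def)
  also have "\<dots> = (v' \<cdot> g) \<cdot> u" using assms by (simp add: square_def)
  also have "\<dots> = v' \<cdot> (g \<cdot> u)" using assms by (intro assoc) (simp_all add: square_def)
  also have "\<dots> = (v' \<cdot> v) \<cdot> f" using assms by (simp add: square_def assoc)
  finally show ?thesis using assms by (simp add: square_def)
qed

lemma arrow_category: "category (arrow_cat C)"
proof
  fix \<sigma> assume "\<sigma> \<in> Arr (arrow_cat C)"
  then show "Dom (arrow_cat C) \<sigma> \<in> Obj (arrow_cat C)" "Cod (arrow_cat C) \<sigma> \<in> Obj (arrow_cat C)"
    by (cases \<sigma>; simp add: arrow_Arr square_def)+
next
  fix f assume "f \<in> Obj (arrow_cat C)"
  then show "Idt (arrow_cat C) f \<in> Hom (arrow_cat C) f f"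
    by (simp add: Hom_def arrow_Arr square_def)
next
  fix \<sigma> \<tau> f g h assume "\<sigma> \<in> Hom (arrow_cat C) f g" "\<tau> \<in> Hom (arrow_cat C) g h"
  then show "\<tau> \<cdot>\<^bsub>arrow_cat C\<^esub> \<sigma> \<in> Hom (arrow_cat C) f h"
    by (auto elim!: arrow_HomE intro!: arrow_HomI intro: square_comp)
next
  fix \<sigma> f g assume "\<sigma> \<in> Hom (arrow_cat C) f g"
  then show "\<sigma> \<cdot>\<^bsub>arrow_cat C\<^esub> Idt (arrow_cat C) f = \<sigma>" "Idt (arrow_cat C) g \<cdot>\<^bsub>arrow_cat C\<^esub> \<sigma> = \<sigma>"
    by (auto elim!: arrow_HomE simp: square_def)
next
  fix \<sigma> \<tau> \<rho> f g h k
  assume "\<sigma> \<in> Hom (arrow_cat C) f g" "\<tau> \<in> Hom (arrow_cat C) g h" "\<rho> \<in> Hom (arrow_cat C) h k"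
  then show "(\<rho> \<cdot>\<^bsub>arrow_cat C\<^esub> \<tau>) \<cdot>\<^bsub>arrow_cat C\<^esub> \<sigma> = \<rho> \<cdot>\<^bsub>arrow_cat C\<^esub> (\<tau> \<cdot>\<^bsub>arrow_cat C\<^esub> \<sigma>)"
    by (auto elim!: arrow_HomE simp: square_def assoc)
qed

end

section \<open>Coalgebras and algebras of an awfs\<close>

definition is_coalg :: "('o, 'a) cat \<Rightarrow> ('o, 'a) awfs_data \<Rightarrow> 'a \<Rightarrow> 'a \<Rightarrow> bool" where
  "is_coalg M W j t \<longleftrightarrow> (j, t) \<in> Obj (coalg_cat M W)"

definition is_alg :: "('o, 'a) cat \<Rightarrow> ('o, 'a) awfs_data \<Rightarrow> 'a \<Rightarrow> 'a \<Rightarrow> bool" where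
  "is_alg M W f r \<longleftrightarrow> (f, r) \<in> Obj (alg_cat M W)"

locale awfs_on = category M for M :: "('o, 'a) cat" (structure) +
  fixes W :: "('o, 'a) awfs_data"
  assumes awfs: "awfs M W"
begin

abbreviation Mid where "Mid f u v g \<equiv> amap (mid W) (f, u, v, g)"
abbreviation I where "I \<equiv> Idt M"
abbreviation dm where "dm \<equiv> Dom M"
abbreviation cd where "cd \<equiv> Cod M"
abbreviation ob where "ob \<equiv> omap (mid W)"
abbreviation L where "L \<equiv> lft W"
abbreviation R where "R \<equiv> rgt W"
abbreviation \<delta> where "\<delta> \<equiv> comult W"
abbreviation \<mu> where "\<mu> \<equiv> mult W"

lemma mid_functor: "is_functor (arrow_cat M) M (mid W)"
  using awfs by (simp add: awfs_def functorial_factorization_def)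

lemma factorization [simp]:
  assumes "f \<in> Arr M"
  shows "L f \<in> Arr M" "dm (L f) = dm f" "cd (L f) = ob f"
    "R f \<in> Arr M" "dm (R f) = ob f" "cd (R f) = cd f" "R f \<cdot> L f = f" "ob f \<in> Obj M"
proof -
  have "functorial_factorization M W" using awfs by (simp add: awfs_def)
  then show "L f \<in> Arr M" "dm (L f) = dm f" "cd (L f) = ob f"
    "R f \<in> Arr M" "dm (R f) = ob f" "cd (R f) = cd f" "R f \<cdot> L f = f"
    using assms by (auto simp: functorial_factorization_def Hom_def)
  show "ob f \<in> Obj M" using is_functor.omap_closed[OF mid_functor, of f] assms by simp
qed

lemma Mid_arr [simp]:
  assumes "square M f u v g"
  shows "Mid f u v g \<in> Arr M" "dm (Mid f u v g) = ob f" "cd (Mid f u v g) = ob g"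
  using is_functor.amap_arr[OF mid_functor, of "(f, u, v, g)"] assms by (auto simp: arrow_Arr)

lemma Mid_nat:
  assumes "square M f u v g"
  shows "Mid f u v g \<cdot> L f = L g \<cdot> u" "R g \<cdot> Mid f u v g = v \<cdot> R f"
proof -
  have "\<forall>(f, u, v, g)\<in>Arr (arrow_cat M).
        amap (mid W) (f, u, v, g) \<cdot>\<^bsub>M\<^esub> lft W f = lft W g \<cdot>\<^bsub>M\<^esub> u \<and>
        rgt W g \<cdot>\<^bsub>M\<^esub> amap (mid W) (f, u, v, g) = v \<cdot>\<^bsub>M\<^esub> rgt W f"
    using awfs unfolding awfs_def functorial_factorization_def by blast
  then show "Mid f u v g \<cdot> L f = L g \<cdot> u" "R g \<cdot> Mid f u v g = v \<cdot> R f"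
    using assms[folded arrow_Arr] by auto
qed

lemma Mid_comp:
  assumes "square M f u v g" "square M g u' v' h"
  shows "Mid g u' v' h \<cdot> Mid f u v g = Mid f (u' \<cdot> u) (v' \<cdot> v) h"
  using is_functor.amap_comp[OF mid_functor, of "(f,u,v,g)" "(g,u',v',h)"] assms
  by (simp add: arrow_Arr)

lemma Mid_comp_ext:
  assumes "square M f u v g" "square M g u' v' h" "x \<in> Arr M" "cd x = ob f"
  shows "Mid g u' v' h \<cdot> (Mid f u v g \<cdot> x) = Mid f (u' \<cdot> u) (v' \<cdot> v) h \<cdot> x"
  using comp_ext[OF Mid_comp[OF assms(1,2)], of x] assms by simp

lemma Mid_idt: "f \<in> Arr M \<Longrightarrow> Mid f (I (dm f)) (I (cd f)) f = I (ob f)"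
  using is_functor.amap_idt[OF mid_functor, of f] by simp

lemma comonad_W: "comonad (arrow_cat M) (Lfun W) (eps M W) (delta M W)"
  and monad_W: "monad (arrow_cat M) (Rfun W) (eta M W) (mu M W)"
  and dlaw_W: "distributive_law (arrow_cat M) (Lfun W) (eps M W) (delta M W)
       (Rfun W) (eta M W) (mu M W) (dlaw W)"
  using awfs by (auto simp: awfs_def)

lemma Lfun_sel [simp]: "omap (Lfun W) f = L f" "amap (Lfun W) (f,u,v,g) = (L f, u, Mid f u v g, L g)"
  and Rfun_sel [simp]: "omap (Rfun W) f = R f" "amap (Rfun W) (f,u,v,g) = (R f, Mid f u v g, v, R g)"
  by (simp_all add: Lfun_def Rfun_def)

lemma comult_sq: "f \<in> Arr M \<Longrightarrow> square M (L f) (I (dm f)) (\<delta> f) (L (L f))"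
  using comonad_W by (auto simp: comonad_def nat_trans_def delta_def arrow_Hom_iff comp_func_def)

lemma mult_sq: "f \<in> Arr M \<Longrightarrow> square M (R (R f)) (\<mu> f) (I (cd f)) (R f)"
  using monad_W by (auto simp: monad_def nat_trans_def mu_def arrow_Hom_iff comp_func_def)

lemma comult_arr [simp]:
  assumes "f \<in> Arr M"
  shows "\<delta> f \<in> Arr M" "dm (\<delta> f) = ob f" "cd (\<delta> f) = ob (L f)" "\<delta> f \<cdot> L f = L (L f)"
  using comult_sq[OF assms] assms by (auto simp: square_def)

lemma mult_arr [simp]:
  assumes "f \<in> Arr M"
  shows "\<mu> f \<in> Arr M" "dm (\<mu> f) = ob (R f)" "cd (\<mu> f) = ob f" "R f \<cdot> \<mu> f = R (R f)"
  using mult_sq[OF assms] assms by (auto simp: square_def)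

lemma comult_laws:
  assumes "f \<in> Arr M"
  shows "R (L f) \<cdot> \<delta> f = I (ob f)" "Mid (L f) (I (dm f)) (R f) f \<cdot> \<delta> f = I (ob f)"
    "\<delta> (L f) \<cdot> \<delta> f = Mid (L f) (I (dm f)) (\<delta> f) (L (L f)) \<cdot> \<delta> f"
  using comonad_W assms by (auto simp: comonad_def delta_def eps_def)

lemma mult_laws:
  assumes "f \<in> Arr M"
  shows "\<mu> f \<cdot> L (R f) = I (ob f)" "\<mu> f \<cdot> Mid f (L f) (I (cd f)) (R f) = I (ob f)"
    "\<mu> f \<cdot> \<mu> (R f) = \<mu> f \<cdot> Mid (R (R f)) (\<mu> f) (I (cd f)) (R f)"
  using monad_W assms by (auto simp: monad_def mu_def eta_def)

lemma comult_nat: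
  assumes "square M f u v g"
  shows "\<delta> g \<cdot> Mid f u v g = Mid (L f) u (Mid f u v g) (L g) \<cdot> \<delta> f"
proof -
  have "\<forall>\<sigma>\<in>Arr (arrow_cat M). amap (comp_func (Lfun W) (Lfun W)) \<sigma> \<cdot>\<^bsub>arrow_cat M\<^esub> delta M W (Dom (arrow_cat M) \<sigma>)
     = delta M W (Cod (arrow_cat M) \<sigma>) \<cdot>\<^bsub>arrow_cat M\<^esub> amap (Lfun W) \<sigma>"
    using comonad_W by (simp add: comonad_def nat_trans_def)
  from this[rule_format, of "(f,u,v,g)"] assms show ?thesis
    by (simp add: arrow_Arr delta_def comp_func_def)
qed

lemma mult_nat:
  assumes "square M f u v g"
  shows "Mid f u v g \<cdot> \<mu> f = \<mu> g \<cdot> Mid (R f) (Mid f u v g) v (R g)"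
proof -
  have "\<forall>\<sigma>\<in>Arr (arrow_cat M). amap (Rfun W) \<sigma> \<cdot>\<^bsub>arrow_cat M\<^esub> mu M W (Dom (arrow_cat M) \<sigma>)
     = mu M W (Cod (arrow_cat M) \<sigma>) \<cdot>\<^bsub>arrow_cat M\<^esub> amap (comp_func (Rfun W) (Rfun W)) \<sigma>"
    using monad_W by (simp add: monad_def nat_trans_def)
  from this[rule_format, of "(f,u,v,g)"] assms show ?thesis
    by (simp add: arrow_Arr mu_def comp_func_def)
qed

text \<open>The content of the distributive law: the bottom of its compatibility with \<open>\<delta>\<close>.\<close>

lemma comult_mult:
  assumes "f \<in> Arr M"
  shows "\<delta> f \<cdot> \<mu> f = \<mu> (L f) \<cdot> Mid (L (R f)) (\<delta> f) (\<mu> f) (R (L f)) \<cdot> \<delta> (R f)"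
  using dlaw_W assms by (auto simp: distributive_law_def dlaw_def delta_def)

lemma dlaw_sq: "f \<in> Arr M \<Longrightarrow> square M (L (R f)) (\<delta> f) (\<mu> f) (R (L f))"
  by (auto simp: square_def comult_laws mult_laws)

lemma is_coalg_iff:
  "is_coalg M W j t \<longleftrightarrow> j \<in> Arr M \<and> t \<in> Arr M \<and> dm t = cd j \<and> cd t = ob j \<and> t \<cdot> j = L j \<and>
     R j \<cdot> t = I (cd j) \<and> \<delta> j \<cdot> t = Mid j (I (dm j)) t (L j) \<cdot> t"
  by (auto simp: is_coalg_def coalg_cat_def structured_cat_def coalgebra_def coalg_sq_def
      arrow_Hom_iff square_def eps_def delta_def)

lemma is_alg_iff:
  "is_alg M W f r \<longleftrightarrow> f \<in> Arr M \<and> r \<in> Arr M \<and> dm r = ob f \<and> cd r = dm f \<and> f \<cdot> r = R f \<and>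
     r \<cdot> L f = I (dm f) \<and> r \<cdot> \<mu> f = r \<cdot> Mid (R f) r (I (cd f)) f"
  by (auto simp: is_alg_def alg_cat_def structured_cat_def algebra_def alg_sq_def
      arrow_Hom_iff square_def eta_def mu_def)

definition coalg_map_sq where
  "coalg_map_sq j t \<sigma> k s \<longleftrightarrow> \<sigma> \<in> Hom (arrow_cat M) j k \<and> amap (mid W) \<sigma> \<cdot> t = s \<cdot> sq_bot \<sigma>"

definition alg_map_sq where
  "alg_map_sq f r \<sigma> g s \<longleftrightarrow> \<sigma> \<in> Hom (arrow_cat M) f g \<and> s \<cdot> amap (mid W) \<sigma> = sq_top \<sigma> \<cdot> r"

lemma coalg_Arr_iff:
  "((j, t), \<sigma>, (k, s)) \<in> Arr (coalg_cat M W) \<longleftrightarrow>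
     is_coalg M W j t \<and> is_coalg M W k s \<and> coalg_map_sq j t \<sigma> k s"
  by (cases \<sigma>) (auto simp: is_coalg_def coalg_cat_def structured_cat_def coalg_map_sq_def coalgebra_def
      coalg_sq_def arrow_Hom_iff square_def elim!: arrow_HomE)

lemma alg_Arr_iff:
  "((f, r), \<sigma>, (g, s)) \<in> Arr (alg_cat M W) \<longleftrightarrow>
     is_alg M W f r \<and> is_alg M W g s \<and> alg_map_sq f r \<sigma> g s"
  by (cases \<sigma>) (auto simp: is_alg_def alg_cat_def structured_cat_def alg_map_sq_def algebra_def
      alg_sq_def arrow_Hom_iff square_def elim!: arrow_HomE)

lemma free_alg: "f \<in> Arr M \<Longrightarrow> is_alg M W (R f) (\<mu> f)"
  by (simp add: is_alg_iff mult_laws)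

lemma cofree_coalg: "f \<in> Arr M \<Longrightarrow> is_coalg M W (L f) (\<delta> f)"
  by (simp add: is_coalg_iff comult_laws)

end

section \<open>Composition of coalgebras and of algebras\<close>

context awfs_on
begin

lemma Mid_square [simp]:
  assumes "square M f u v g"
  shows "square M (L f) u (Mid f u v g) (L g)" "square M (R f) (Mid f u v g) v (R g)"
  using Mid_nat[OF assms] Mid_arr[OF assms] assms
  by (simp_all add: square_def[of M "L f"] square_def[of M "R f"]) (simp_all add: square_def)

text \<open>For coalgebras \<open>(j, t)\<close> and \<open>(k, s)\<close> with \<open>k \<cdot> j\<close> defined, the arrow \<open>ext_coalg j t k\<close> is the top of
  a square from \<open>k\<close> to \<open>R (k \<cdot> j)\<close>. The coalgebra structure on \<open>k \<cdot> j\<close> is the canonical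
  solution of this square against the free algebra on \<open>k \<cdot> j\<close>.\<close>

definition ext_coalg where
  "ext_coalg j t k = Mid j (I (dm j)) k (k \<cdot> j) \<cdot> t"

definition comp_coalg where
  "comp_coalg j t k s = \<mu> (k \<cdot> j) \<cdot> (Mid k (ext_coalg j t k) (I (cd k)) (R (k \<cdot> j)) \<cdot> s)"

lemma ext_coalg:
  assumes "is_coalg M W j t" "k \<in> Arr M" "cd j = dm k"
  shows "ext_coalg j t k \<in> Arr M" "dm (ext_coalg j t k) = cd j" "cd (ext_coalg j t k) = ob (k \<cdot> j)"
    "ext_coalg j t k \<cdot> j = L (k \<cdot> j)" "R (k \<cdot> j) \<cdot> ext_coalg j t k = k"
    "square M j (I (dm j)) k (k \<cdot> j)"
    "square M k (ext_coalg j t k) (I (cd k)) (R (k \<cdot> j))"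
proof -
  note [simp] = assms(2,3) assms(1)[unfolded is_coalg_iff]
  show sq [simp]: "square M j (I (dm j)) k (k \<cdot> j)" by (simp add: square_def)
  show a [simp]: "ext_coalg j t k \<in> Arr M" "dm (ext_coalg j t k) = cd j" "cd (ext_coalg j t k) = ob (k \<cdot> j)"
    by (simp_all add: ext_coalg_def)
  show "ext_coalg j t k \<cdot> j = L (k \<cdot> j)"
    by (simp add: ext_coalg_def assoc Mid_nat)
  show b: "R (k \<cdot> j) \<cdot> ext_coalg j t k = k"
    by (simp add: ext_coalg_def comp_ext[OF Mid_nat(2)] assoc)
  show "square M k (ext_coalg j t k) (I (cd k)) (R (k \<cdot> j))"
    by (simp add: square_def b)
qed

text \<open>With \<open>m = k \<cdot> j\<close>, both sides of the coassociativity law become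
  \<open>\<mu> (L m) \<cdot> E(d, x) \<cdot> s\<close> for an arrow \<open>d\<close> with domain \<open>cod j\<close>: the left-hand side by the
  distributive law and coassociativity of \<open>s\<close>, the right-hand side by naturality of \<open>\<mu>\<close>. The two
  values of \<open>d\<close> agree by coassociativity of \<open>t\<close>.\<close>

lemma comp_coalg:
  assumes jt: "is_coalg M W j t" and ks: "is_coalg M W k s" and "cd j = dm k"
  shows "is_coalg M W (k \<cdot> j) (comp_coalg j t k s)"
proof -
  note [simp] = \<open>cd j = dm k\<close> jt[unfolded is_coalg_iff] ks[unfolded is_coalg_iff]
  define m e x where "m = k \<cdot> j" and "e = ext_coalg j t k" and "x = comp_coalg j t k s"
  have m [simp]: "m \<in> Arr M" "dm m = dm j" "cd m = cd k" by (simp_all add: m_def)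
  have e [simp]: "e \<in> Arr M" "dm e = dm k" "cd e = ob m" "e \<cdot> j = L m" "R m \<cdot> e = k"
    and sq [simp]: "square M j (I (dm j)) k m" "square M k e (I (cd k)) (R m)"
    using ext_coalg[OF jt, of k] by (simp_all add: e_def m_def)
  have x_def': "x = \<mu> m \<cdot> (Mid k e (I (cd k)) (R m) \<cdot> s)"
    by (simp add: x_def comp_coalg_def m_def e_def)
  have x [simp]: "x \<in> Arr M" "dm x = cd k" "cd x = ob m" by (simp_all add: x_def')
  have Rx [simp]: "R m \<cdot> x = I (cd k)"
    by (simp add: x_def' comp_ext[OF mult_arr(4)] comp_ext[OF Mid_nat(2)])
  have xk [simp]: "x \<cdot> k = e"
    by (simp add: x_def' assoc Mid_nat comp_ext[OF mult_laws(1)])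
  have xj: "x \<cdot> m = L m"
    by (subst m_def) (simp add: assoc[symmetric])
  have sqx [simp]: "square M m (I (dm j)) x (L m)"
    by (simp add: square_def xj)
  have sqe [simp]: "square M j (I (dm j)) e (L m)"
    by (simp add: square_def)
  have \<delta>e: "\<delta> m \<cdot> e = Mid m (I (dm j)) x (L m) \<cdot> e"
  proof -
    have "\<delta> m \<cdot> e = (\<delta> m \<cdot> Mid j (I (dm j)) k m) \<cdot> t"
      by (simp add: e_def ext_coalg_def m_def[symmetric] assoc)
    also have "\<dots> = Mid (L j) (I (dm j)) (Mid j (I (dm j)) k m) (L m) \<cdot> (\<delta> j \<cdot> t)"
      by (simp only: comult_nat sq) (rule assoc, simp_all)
    also have "\<dots> = Mid (L j) (I (dm j)) (Mid j (I (dm j)) k m) (L m) \<cdot> (Mid j (I (dm j)) t (L j) \<cdot> t)"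
      by simp
    also have "\<dots> = Mid j (I (dm j)) (Mid j (I (dm j)) k m \<cdot> t) (L m) \<cdot> t"
      by (subst Mid_comp_ext) (simp_all add: square_def[of M j _ t])
    also have "\<dots> = Mid j (I (dm j)) (x \<cdot> k) (L m) \<cdot> t"
      by (simp add: e_def ext_coalg_def m_def[symmetric])
    also have "\<dots> = Mid m (I (dm j)) x (L m) \<cdot> (Mid j (I (dm j)) k m \<cdot> t)"
      by (subst Mid_comp_ext) simp_all
    finally show ?thesis by (simp add: e_def ext_coalg_def m_def[symmetric])
  qed
  have "\<delta> m \<cdot> x = (\<delta> m \<cdot> \<mu> m) \<cdot> (Mid k e (I (cd k)) (R m) \<cdot> s)"
    by (simp add: x_def' assoc)
  also have "\<dots> = \<mu> (L m) \<cdot> (Mid (L (R m)) (\<delta> m) (\<mu> m) (R (L m)) \<cdot> (\<delta> (R m) \<cdot> (Mid k e (I (cd k)) (R m) \<cdot> s)))"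
    by (simp add: comult_mult assoc dlaw_sq)
  also have "\<delta> (R m) \<cdot> (Mid k e (I (cd k)) (R m) \<cdot> s)
      = Mid (L k) e (Mid k e (I (cd k)) (R m)) (L (R m)) \<cdot> (Mid k (I (dm k)) s (L k) \<cdot> s)"
    by (subst comp_ext[OF comult_nat]) (simp_all add: assoc square_def Mid_nat)
  also have "\<dots> = Mid k e (Mid k e (I (cd k)) (R m) \<cdot> s) (L (R m)) \<cdot> s"
    by (subst Mid_comp_ext) (simp_all add: square_def Mid_nat)
  also have "Mid (L (R m)) (\<delta> m) (\<mu> m) (R (L m)) \<cdot> \<dots> = Mid k (\<delta> m \<cdot> e) x (R (L m)) \<cdot> s"
    by (subst Mid_comp_ext) (simp_all add: dlaw_sq x_def' square_def assoc Mid_nat comult_laws mult_laws)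
  also have "\<dots> = Mid k (Mid m (I (dm j)) x (L m) \<cdot> e) x (R (L m)) \<cdot> s"
    by (simp add: \<delta>e)
  also have "\<dots> = Mid (R m) (Mid m (I (dm j)) x (L m)) x (R (L m)) \<cdot> (Mid k e (I (cd k)) (R m) \<cdot> s)"
    by (subst Mid_comp_ext) simp_all
  also have "\<mu> (L m) \<cdot> \<dots> = (Mid m (I (dm j)) x (L m) \<cdot> \<mu> m) \<cdot> (Mid k e (I (cd k)) (R m) \<cdot> s)"
    by (simp add: mult_nat assoc)
  also have "\<dots> = Mid m (I (dm j)) x (L m) \<cdot> x"
    by (subst (2) x_def') (rule assoc, simp_all)
  finally show ?thesis
    by (simp add: is_coalg_iff xj m_def[symmetric] x_def[symmetric])
qed

text \<open>The right-hand side of the distributive law \<open>comult_mult\<close> is the composite coalgebra structure on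
  \<open>L (R h) \<cdot> L h\<close> followed by \<open>E(1, \<mu>)\<close>, so that the law says that \<open>\<mu>\<close> is a coalgebra map.\<close>

lemma mult_coalg_map:
  assumes [simp]: "h \<in> Arr M"
  shows "coalg_map_sq (L (R h) \<cdot> L h) (comp_coalg (L h) (\<delta> h) (L (R h)) (\<delta> (R h)))
     (L (R h) \<cdot> L h, I (dm h), \<mu> h, L h) (L h) (\<delta> h)"
proof -
  define m where "m = L (R h) \<cdot> L h"
  define e where "e = ext_coalg (L h) (\<delta> h) (L (R h))"
  have m [simp]: "m \<in> Arr M" "dm m = dm h" "cd m = ob (R h)" by (simp_all add: m_def)
  have e [simp]: "e \<in> Arr M" "dm e = ob h" "cd e = ob m" "R m \<cdot> e = L (R h)"
    and sq [simp]: "square M (L h) (I (dm h)) (L (R h)) m" "square M (L (R h)) e (I (ob (R h))) (R m)"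
    using ext_coalg[OF cofree_coalg, of h "L (R h)"] by (simp_all add: e_def m_def)
  have \<mu>m: "\<mu> h \<cdot> m = L h"
    by (simp add: m_def comp_ext[OF mult_laws(1)])
  have sqm [simp]: "square M m (I (dm h)) (\<mu> h) (L h)" by (simp add: square_def \<mu>m)
  have \<mu>e: "Mid m (I (dm h)) (\<mu> h) (L h) \<cdot> e = \<delta> h"
  proof -
    have "Mid m (I (dm h)) (\<mu> h) (L h) \<cdot> e = Mid (L h) (I (dm h)) (\<mu> h \<cdot> L (R h)) (L h) \<cdot> \<delta> h"
      by (simp add: e_def ext_coalg_def m_def[symmetric] Mid_comp_ext)
    also have "\<dots> = \<delta> h" using Mid_idt[of "L h"] by (simp add: mult_laws)
    finally show ?thesis .
  qed
  have "Mid m (I (dm h)) (\<mu> h) (L h) \<cdot> comp_coalg (L h) (\<delta> h) (L (R h)) (\<delta> (R h))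
    = (Mid m (I (dm h)) (\<mu> h) (L h) \<cdot> \<mu> m) \<cdot> (Mid (L (R h)) e (I (ob (R h))) (R m) \<cdot> \<delta> (R h))"
    by (simp add: comp_coalg_def m_def[symmetric] e_def[symmetric] assoc)
  also have "\<dots> = \<mu> (L h) \<cdot> (Mid (R m) (Mid m (I (dm h)) (\<mu> h) (L h)) (\<mu> h) (R (L h)) \<cdot>
      (Mid (L (R h)) e (I (ob (R h))) (R m) \<cdot> \<delta> (R h)))"
    by (simp add: mult_nat assoc)
  also have "\<dots> = \<mu> (L h) \<cdot> (Mid (L (R h)) (\<delta> h) (\<mu> h) (R (L h)) \<cdot> \<delta> (R h))"
    by (subst Mid_comp_ext) (simp_all add: \<mu>e)
  also have "\<dots> = \<delta> h \<cdot> \<mu> h" by (simp add: comult_mult assoc dlaw_sq)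
  finally show ?thesis
    by (simp add: coalg_map_sq_def arrow_Hom_iff m_def[symmetric])
qed

text \<open>Dually, for algebras \<open>(f, r)\<close> and \<open>(g, s)\<close> with \<open>g \<cdot> f\<close> defined, \<open>ext_alg f g s\<close> is the bottom of a
  square from \<open>L (g \<cdot> f)\<close> to \<open>f\<close>, and the structure on \<open>g \<cdot> f\<close> solves this square for the cofree
  coalgebra on \<open>g \<cdot> f\<close>.\<close>

definition ext_alg where
  "ext_alg f g s = s \<cdot> Mid (g \<cdot> f) f (I (cd g)) g"

definition comp_alg where
  "comp_alg f r g s = r \<cdot> (Mid (L (g \<cdot> f)) (I (dm f)) (ext_alg f g s) f \<cdot> \<delta> (g \<cdot> f))"

lemma ext_alg:
  assumes "is_alg M W g s" "f \<in> Arr M" "cd f = dm g"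
  shows "ext_alg f g s \<in> Arr M" "dm (ext_alg f g s) = ob (g \<cdot> f)" "cd (ext_alg f g s) = cd f"
    "ext_alg f g s \<cdot> L (g \<cdot> f) = f" "g \<cdot> ext_alg f g s = R (g \<cdot> f)"
    "square M (g \<cdot> f) f (I (cd g)) g"
    "square M (L (g \<cdot> f)) (I (dm f)) (ext_alg f g s) f"
proof -
  note [simp] = assms(2,3) assms(1)[unfolded is_alg_iff]
  show sq [simp]: "square M (g \<cdot> f) f (I (cd g)) g" by (simp add: square_def)
  show a [simp]: "ext_alg f g s \<in> Arr M" "dm (ext_alg f g s) = ob (g \<cdot> f)" "cd (ext_alg f g s) = cd f"
    by (simp_all add: ext_alg_def)
  show b: "ext_alg f g s \<cdot> L (g \<cdot> f) = f"
    by (simp add: ext_alg_def assoc Mid_nat comp_ext[of s "L g" "I (dm g)"])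
  show "g \<cdot> ext_alg f g s = R (g \<cdot> f)"
    by (simp add: ext_alg_def comp_ext[of g s "R g"] Mid_nat)
  show "square M (L (g \<cdot> f)) (I (dm f)) (ext_alg f g s) f"
    by (simp add: square_def b)
qed

lemma comp_alg:
  assumes fr: "is_alg M W f r" and gs: "is_alg M W g s" and "cd f = dm g"
  shows "is_alg M W (g \<cdot> f) (comp_alg f r g s)"
proof -
  note [simp] = \<open>cd f = dm g\<close> fr[unfolded is_alg_iff] gs[unfolded is_alg_iff]
  define m e x where "m = g \<cdot> f" and "e = ext_alg f g s" and "x = comp_alg f r g s"
  have m [simp]: "m \<in> Arr M" "dm m = dm f" "cd m = cd g" by (simp_all add: m_def)
  have e [simp]: "e \<in> Arr M" "dm e = ob m" "cd e = dm g" "e \<cdot> L m = f" "g \<cdot> e = R m"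
    and sq [simp]: "square M m f (I (cd g)) g" "square M (L m) (I (dm f)) e f"
    using ext_alg[OF gs, of f] by (simp_all add: e_def m_def)
  have x_def': "x = r \<cdot> (Mid (L m) (I (dm f)) e f \<cdot> \<delta> m)"
    by (simp add: x_def comp_alg_def m_def e_def)
  have x [simp]: "x \<in> Arr M" "dm x = ob m" "cd x = dm f" by (simp_all add: x_def')
  have xL [simp]: "x \<cdot> L m = I (dm f)"
    by (simp add: x_def' assoc Mid_nat)
  have fx [simp]: "f \<cdot> x = e"
    by (simp add: x_def' comp_ext[of f r "R f"] comp_ext[OF Mid_nat(2)] assoc comult_laws)
  have mx: "m \<cdot> x = R m"
    by (subst m_def) (simp add: assoc)
  have sqx [simp]: "square M (R m) x (I (cd g)) m"
    by (simp add: square_def mx)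
  have sqe [simp]: "square M (R m) e (I (cd g)) g"
    by (simp add: square_def)
  have e\<mu>: "e \<cdot> \<mu> m = e \<cdot> Mid (R m) x (I (cd g)) m"
  proof -
    have "e \<cdot> \<mu> m = s \<cdot> (Mid m f (I (cd g)) g \<cdot> \<mu> m)"
      by (simp add: e_def ext_alg_def m_def[symmetric] assoc)
    also have "\<dots> = (s \<cdot> \<mu> g) \<cdot> Mid (R m) (Mid m f (I (cd g)) g) (I (cd g)) (R g)"
      by (simp only: mult_nat sq) (rule assoc[symmetric], simp_all)
    also have "\<dots> = s \<cdot> (Mid (R g) s (I (cd g)) g \<cdot> Mid (R m) (Mid m f (I (cd g)) g) (I (cd g)) (R g))"
      by (subst gs[unfolded is_alg_iff, THEN conjunct2, THEN conjunct2, THEN conjunct2, THEN conjunct2, THEN conjunct2, THEN conjunct2])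
       (rule assoc, simp_all add: square_def[of M "R g"])
    also have "\<dots> = s \<cdot> Mid (R m) (s \<cdot> Mid m f (I (cd g)) g) (I (cd g)) g"
      by (subst Mid_comp) (simp_all add: square_def[of M "R g"])
    also have "\<dots> = s \<cdot> Mid (R m) (f \<cdot> x) (I (cd g)) g"
      by (simp add: e_def ext_alg_def m_def[symmetric])
    also have "\<dots> = s \<cdot> (Mid m f (I (cd g)) g \<cdot> Mid (R m) x (I (cd g)) m)"
      by (subst Mid_comp) simp_all
    finally show ?thesis by (simp add: e_def ext_alg_def m_def[symmetric] assoc)
  qed
  have sqc: "square M (L (R m)) (Mid (L m) (I (dm f)) e f \<cdot> \<delta> m) (e \<cdot> \<mu> m) (R f)"
    using square_comp[OF dlaw_sq Mid_square(2)[OF sq(2)]] by simp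
  have rlaw: "r \<cdot> \<mu> f = r \<cdot> Mid (R f) r (I (cd f)) f"
    using fr by (simp add: is_alg_iff)
  have sqr: "square M (R f) r (I (cd f)) f" by (simp add: square_def)
  have "x \<cdot> \<mu> m = r \<cdot> (Mid (L m) (I (dm f)) e f \<cdot> (\<delta> m \<cdot> \<mu> m))"
    by (simp add: x_def' assoc)
  also have "\<dots> = r \<cdot> ((Mid (L m) (I (dm f)) e f \<cdot> \<mu> (L m)) \<cdot> (Mid (L (R m)) (\<delta> m) (\<mu> m) (R (L m)) \<cdot> \<delta> (R m)))"
    by (simp add: comult_mult assoc dlaw_sq)
  also have "Mid (L m) (I (dm f)) e f \<cdot> \<mu> (L m) = \<mu> f \<cdot> Mid (R (L m)) (Mid (L m) (I (dm f)) e f) e (R f)"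
    by (simp add: mult_nat)
  also have "r \<cdot> ((\<mu> f \<cdot> Mid (R (L m)) (Mid (L m) (I (dm f)) e f) e (R f)) \<cdot> (Mid (L (R m)) (\<delta> m) (\<mu> m) (R (L m)) \<cdot> \<delta> (R m)))
     = r \<cdot> (\<mu> f \<cdot> (Mid (L (R m)) (Mid (L m) (I (dm f)) e f \<cdot> \<delta> m) (e \<cdot> \<mu> m) (R f) \<cdot> \<delta> (R m)))"
    by (simp add: assoc Mid_comp_ext dlaw_sq sqc)
  also have "\<dots> = r \<cdot> (Mid (R f) r (I (cd f)) f \<cdot> (Mid (L (R m)) (Mid (L m) (I (dm f)) e f \<cdot> \<delta> m) (e \<cdot> \<mu> m) (R f) \<cdot> \<delta> (R m)))"
    by (subst comp_ext[OF rlaw]) (simp_all add: assoc sqc sqr[simplified])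
  also have "\<dots> = r \<cdot> (Mid (L (R m)) x (e \<cdot> \<mu> m) f \<cdot> \<delta> (R m))"
    by (subst Mid_comp_ext) (simp_all add: x_def' sqc sqr[simplified])
  also have "\<dots> = r \<cdot> (Mid (L (R m)) x (e \<cdot> Mid (R m) x (I (cd g)) m) f \<cdot> \<delta> (R m))"
    by (simp add: e\<mu>)
  also have "\<dots> = r \<cdot> (Mid (L m) (I (dm f)) e f \<cdot> (Mid (L (R m)) x (Mid (R m) x (I (cd g)) m) (L m) \<cdot> \<delta> (R m)))"
    by (subst Mid_comp_ext) simp_all
  also have "\<dots> = r \<cdot> (Mid (L m) (I (dm f)) e f \<cdot> (\<delta> m \<cdot> Mid (R m) x (I (cd g)) m))"
    by (simp add: comult_nat)
  also have "\<dots> = x \<cdot> Mid (R m) x (I (cd g)) m"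
    by (subst (2) x_def') (simp add: assoc)
  finally show ?thesis
    by (simp add: is_alg_iff mx m_def[symmetric] x_def[symmetric])
qed

text \<open>Dually, the distributive law says that \<open>\<delta>\<close> is an algebra map. As its domain is free on \<open>f\<close>, it is
  the unique algebra map extending \<open>L (L f)\<close>, and so composition of algebras determines the
  comonad.\<close>

lemma comult_alg_map:
  assumes [simp]: "f \<in> Arr M"
  shows "alg_map_sq (R f) (\<mu> f) (R f, \<delta> f, I (cd f), R f \<cdot> R (L f))
     (R f \<cdot> R (L f)) (comp_alg (R (L f)) (\<mu> (L f)) (R f) (\<mu> f))"
proof -
  define m where "m = R f \<cdot> R (L f)"
  define e where "e = ext_alg (R (L f)) (R f) (\<mu> f)"
  have m [simp]: "m \<in> Arr M" "dm m = ob (L f)" "cd m = cd f" by (simp_all add: m_def)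
  have e [simp]: "e \<in> Arr M" "dm e = ob m" "cd e = ob f" "e \<cdot> L m = R (L f)"
    and sq [simp]: "square M m (R (L f)) (I (cd f)) (R f)" "square M (L m) (I (ob (L f))) e (R (L f))"
    using ext_alg[OF free_alg, of f "R (L f)"] by (simp_all add: e_def m_def)
  have \<delta>m: "m \<cdot> \<delta> f = R f"
    by (simp add: m_def assoc comult_laws)
  have sqm [simp]: "square M (R f) (\<delta> f) (I (cd f)) m" by (simp add: square_def \<delta>m)
  have e\<delta>: "e \<cdot> Mid (R f) (\<delta> f) (I (cd f)) m = \<mu> f"
  proof -
    have "e \<cdot> Mid (R f) (\<delta> f) (I (cd f)) m = \<mu> f \<cdot> Mid (R f) (R (L f) \<cdot> \<delta> f) (I (cd f)) (R f)"
      by (simp add: e_def ext_alg_def m_def[symmetric] Mid_comp assoc)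
    also have "\<dots> = \<mu> f" using Mid_idt[of "R f"] by (simp add: comult_laws)
    finally show ?thesis .
  qed
  have "comp_alg (R (L f)) (\<mu> (L f)) (R f) (\<mu> f) \<cdot> Mid (R f) (\<delta> f) (I (cd f)) m
    = \<mu> (L f) \<cdot> (Mid (L m) (I (ob (L f))) e (R (L f)) \<cdot> (\<delta> m \<cdot> Mid (R f) (\<delta> f) (I (cd f)) m))"
    by (simp add: comp_alg_def m_def[symmetric] e_def[symmetric] assoc)
  also have "\<dots> = \<mu> (L f) \<cdot> (Mid (L m) (I (ob (L f))) e (R (L f)) \<cdot>
     (Mid (L (R f)) (\<delta> f) (Mid (R f) (\<delta> f) (I (cd f)) m) (L m) \<cdot> \<delta> (R f)))"
    by (simp add: comult_nat)
  also have "\<dots> = \<mu> (L f) \<cdot> (Mid (L (R f)) (\<delta> f) (\<mu> f) (R (L f)) \<cdot> \<delta> (R f))"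
    by (subst Mid_comp_ext) (simp_all add: e\<delta> dlaw_sq)
  also have "\<dots> = \<delta> f \<cdot> \<mu> f" by (simp add: comult_mult assoc dlaw_sq)
  finally show ?thesis
    by (simp add: alg_map_sq_def arrow_Hom_iff m_def[symmetric])
qed


section \<open>Canonical solutions\<close>

definition canonical where
  "canonical r t \<sigma> = r \<cdot> (amap (mid W) \<sigma> \<cdot> t)"

lemma canonical_solution:
  assumes "is_coalg M W j t" "is_alg M W f r" "square M j u v f"
  shows "solution M (j, u, v, f) (canonical r t (j, u, v, f))"
proof -
  note [simp] = assms(3) assms(1,2)[unfolded is_coalg_iff is_alg_iff]
  have [simp]: "u \<in> Arr M" "v \<in> Arr M" "dm u = dm j" "cd u = dm f" "dm v = cd j" "cd v = cd f"
    using assms(3) by (auto simp: square_def)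
  show ?thesis
    by (simp add: solution_def canonical_def Hom_def assoc Mid_nat comp_ext[of r "L f" "I (dm f)"]
        comp_ext[of f r "R f"] comp_ext[OF Mid_nat(2)])
qed

text \<open>Against an algebra, a composite coalgebra is solved one factor at a time: the associativity law of the
  algebra absorbs the multiplication that occurs in the composite coalgebra structure.\<close>

lemma canonical_comp_coalg:
  assumes jt: "is_coalg M W j t" and ks: "is_coalg M W k s" and jk: "cd j = dm k"
    and ha: "is_alg M W h a" and sq: "square M (k \<cdot> j) p q h"
  shows "canonical a (comp_coalg j t k s) (k \<cdot> j, p, q, h)
    = canonical a s (k, canonical a t (j, p, q \<cdot> k, h), q, h)"
proof -
  note [simp] = jk jt[unfolded is_coalg_iff] ks[unfolded is_coalg_iff]
  define m e where "m = k \<cdot> j" and "e = ext_coalg j t k"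
  have m [simp]: "m \<in> Arr M" "dm m = dm j" "cd m = cd k" by (simp_all add: m_def)
  have e [simp]: "e \<in> Arr M" "dm e = dm k" "cd e = ob m" "e \<cdot> j = L m" "R m \<cdot> e = k"
    and sqe [simp]: "square M j (I (dm j)) k m" "square M k e (I (cd k)) (R m)"
    using ext_coalg[OF jt, of k] by (simp_all add: e_def m_def)
  have sqm [simp]: "square M m p q h" using sq by (simp add: m_def)
  have pq [simp]: "p \<in> Arr M" "q \<in> Arr M" "dm p = dm j" "cd p = dm h" "dm q = cd k" "cd q = cd h"
    using sqm by (auto simp: square_def)
  note h [simp] = ha[unfolded is_alg_iff, THEN conjunct1] 
  have a [simp]: "a \<in> Arr M" "dm a = ob h" "cd a = dm h" "h \<cdot> a = R h"
    and a_law: "a \<cdot> \<mu> h = a \<cdot> Mid (R h) a (I (cd h)) h"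
    using ha by (auto simp: is_alg_iff)
  have sqa [simp]: "square M (R h) a (I (cd h)) h" by (simp add: square_def)
  have sqc: "square M k (Mid m p q h \<cdot> e) q (R h)"
    using square_comp[OF sqe(2) Mid_square(2)[OF sqm]] by simp
  have me: "Mid m p q h \<cdot> e = Mid j p (q \<cdot> k) h \<cdot> t"
    by (simp add: e_def ext_coalg_def m_def[symmetric] Mid_comp_ext)
  have "canonical a (comp_coalg j t k s) (m, p, q, h)
      = a \<cdot> (\<mu> h \<cdot> (Mid (R m) (Mid m p q h) q (R h) \<cdot> (Mid k e (I (cd k)) (R m) \<cdot> s)))"
    by (simp add: canonical_def comp_coalg_def m_def[symmetric] e_def[symmetric] comp_ext[OF mult_nat] assoc)
  also have "\<dots> = a \<cdot> (\<mu> h \<cdot> (Mid k (Mid m p q h \<cdot> e) q (R h) \<cdot> s))"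
    by (subst Mid_comp_ext) simp_all
  also have "\<dots> = a \<cdot> (Mid (R h) a (I (cd h)) h \<cdot> (Mid k (Mid m p q h \<cdot> e) q (R h) \<cdot> s))"
    by (subst comp_ext[OF a_law]) (simp_all add: assoc sqc)
  also have "\<dots> = a \<cdot> (Mid k (a \<cdot> (Mid m p q h \<cdot> e)) q h \<cdot> s)"
    by (subst Mid_comp_ext) (simp_all add: sqc)
  finally show ?thesis by (simp add: canonical_def me m_def[symmetric])
qed

text \<open>Dually, a coalgebra is solved against a composite algebra one factor at a time, because its
  coassociativity law absorbs the comultiplication in the composite algebra structure. Together
  with naturality, this is what distinguishes coalgebras among lifting structures.\<close>

lemma canonical_comp_alg:
  assumes jt: "is_coalg M W j t" and fr: "is_alg M W f r" and gs: "is_alg M W g s"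
    and fg: "cd f = dm g" and sq: "square M j u v (g \<cdot> f)"
  shows "canonical (comp_alg f r g s) t (j, u, v, g \<cdot> f)
    = canonical r t (j, u, canonical s t (j, f \<cdot> u, v, g), f)"
proof -
  note [simp] = fg fr[unfolded is_alg_iff] gs[unfolded is_alg_iff]
  define m e where "m = g \<cdot> f" and "e = ext_alg f g s"
  have m [simp]: "m \<in> Arr M" "dm m = dm f" "cd m = cd g" by (simp_all add: m_def)
  have e [simp]: "e \<in> Arr M" "dm e = ob m" "cd e = dm g" "e \<cdot> L m = f" "g \<cdot> e = R m"
    and sqe [simp]: "square M m f (I (cd g)) g" "square M (L m) (I (dm f)) e f"
    using ext_alg[OF gs, of f] by (simp_all add: e_def m_def)
  have sqm [simp]: "square M j u v m" using sq by (simp add: m_def)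
  have uv [simp]: "u \<in> Arr M" "v \<in> Arr M" "dm u = dm j" "cd u = dm f" "dm v = cd j" "cd v = cd g"
    using sqm by (auto simp: square_def)
  have t [simp]: "j \<in> Arr M" "t \<in> Arr M" "dm t = cd j" "cd t = ob j" "t \<cdot> j = L j"
    and t_law: "\<delta> j \<cdot> t = Mid j (I (dm j)) t (L j) \<cdot> t"
    using jt by (auto simp: is_coalg_iff)
  have sqt [simp]: "square M j (I (dm j)) t (L j)" by (simp add: square_def)
  have em: "e \<cdot> (Mid j u v m \<cdot> t) = s \<cdot> (Mid j (f \<cdot> u) v g \<cdot> t)"
    by (simp add: e_def ext_alg_def m_def[symmetric] Mid_comp_ext assoc)
  have sqc: "square M j u (Mid j u v m \<cdot> t) (L m)"
    using square_comp[OF sqt Mid_square(1)[OF sqm]] by simp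
  have "canonical (comp_alg f r g s) t (j, u, v, m)
      = r \<cdot> (Mid (L m) (I (dm f)) e f \<cdot> (Mid (L j) u (Mid j u v m) (L m) \<cdot> (\<delta> j \<cdot> t)))"
    by (simp add: canonical_def comp_alg_def m_def[symmetric] e_def[symmetric] comp_ext[OF comult_nat] assoc)
  also have "\<dots> = r \<cdot> (Mid (L m) (I (dm f)) e f \<cdot> (Mid j u (Mid j u v m \<cdot> t) (L m) \<cdot> t))"
    unfolding t_law by (subst Mid_comp_ext[OF sqt]) simp_all
  also have "\<dots> = r \<cdot> (Mid j u (e \<cdot> (Mid j u v m \<cdot> t)) f \<cdot> t)"
    by (subst Mid_comp_ext) (simp_all add: sqc)
  finally show ?thesis by (simp add: canonical_def em m_def[symmetric])
qed

lemma canonical_coalg_map: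
  assumes jt: "is_coalg M W j t" and ks: "is_coalg M W k s" and \<kappa>: "coalg_map_sq j t \<kappa> k s"
    and ha: "is_alg M W h a" and \<tau>: "\<tau> \<in> Hom (arrow_cat M) k h"
  shows "canonical a t (\<tau> \<cdot>\<^bsub>arrow_cat M\<^esub> \<kappa>) = canonical a s \<tau> \<cdot> sq_bot \<kappa>"
proof -
  note [simp] = jt[unfolded is_coalg_iff] ks[unfolded is_coalg_iff] ha[unfolded is_alg_iff]
  obtain u v where k: "\<kappa> = (j, u, v, k)" "square M j u v k" "Mid j u v k \<cdot> t = s \<cdot> v"
    using \<kappa> unfolding coalg_map_sq_def by (auto elim!: arrow_HomE)
  obtain u' v' where t: "\<tau> = (k, u', v', h)" "square M k u' v' h"
    using \<tau> by (auto elim!: arrow_HomE)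
  have [simp]: "v \<in> Arr M" "dm v = cd j" "cd v = cd k" using k by (auto simp: square_def)
  have "canonical a t (\<tau> \<cdot>\<^bsub>arrow_cat M\<^esub> \<kappa>) = a \<cdot> (Mid k u' v' h \<cdot> (Mid j u v k \<cdot> t))"
    using k(1,2) t by (simp add: canonical_def Mid_comp_ext)
  also have "\<dots> = a \<cdot> (Mid k u' v' h \<cdot> (s \<cdot> v))" by (simp only: k(3))
  finally show ?thesis using t by (simp add: k canonical_def assoc)
qed

text \<open>Algebra structures on \<open>h\<close> are the same as operations solving the lifting problems of all
  coalgebras against \<open>h\<close>, naturally in coalgebra maps and compatibly with composition of coalgebras:
  the structure is the solution for the cofree coalgebra on \<open>h\<close>, and its associativity is
  compatibility with the composite of \<open>L h\<close> and \<open>L (R h)\<close>, on which \<open>\<mu>\<close> is a coalgebra map.\<close>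

lemma lifting_operation_alg:
  assumes h [simp]: "h \<in> Arr M"
    and sol: "\<And>j t \<tau>. is_coalg M W j t \<Longrightarrow> \<tau> \<in> Hom (arrow_cat M) j h \<Longrightarrow> solution M \<tau> (\<theta> j t \<tau>)"
    and nat: "\<And>j t k s \<kappa> \<tau>. is_coalg M W j t \<Longrightarrow> is_coalg M W k s \<Longrightarrow> coalg_map_sq j t \<kappa> k s \<Longrightarrow>
       \<tau> \<in> Hom (arrow_cat M) k h \<Longrightarrow> \<theta> j t (\<tau> \<cdot>\<^bsub>arrow_cat M\<^esub> \<kappa>) = \<theta> k s \<tau> \<cdot> sq_bot \<kappa>"
    and comp: "\<And>j t k s p q. is_coalg M W j t \<Longrightarrow> is_coalg M W k s \<Longrightarrow> cd j = dm k \<Longrightarrow>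
       square M (k \<cdot> j) p q h \<Longrightarrow>
       \<theta> (k \<cdot> j) (comp_coalg j t k s) (k \<cdot> j, p, q, h) = \<theta> k s (k, \<theta> j t (j, p, q \<cdot> k, h), q, h)"
  obtains r where "is_alg M W h r"
    "\<And>j t \<tau>. is_coalg M W j t \<Longrightarrow> \<tau> \<in> Hom (arrow_cat M) j h \<Longrightarrow> \<theta> j t \<tau> = canonical r t \<tau>"
proof -
  define r where "r = \<theta> (L h) (\<delta> h) (L h, I (dm h), R h, h)"
  have sqe [simp]: "square M (L h) (I (dm h)) (R h) h" by (simp add: square_def)
  have r [simp]: "r \<in> Arr M" "dm r = ob h" "cd r = dm h" "h \<cdot> r = R h" "r \<cdot> L h = I (dm h)"
    using sol[OF cofree_coalg arrow_HomI[OF sqe]] by (simp_all add: r_def solution_def Hom_def)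
  \<comment> \<open>A problem \<open>(u, v)\<close> for \<open>(j, t)\<close> factors through the cofree coalgebra on \<open>h\<close> by a coalgebra map.\<close>
  have rep: "\<theta> j t (j, u, v, h) = r \<cdot> (Mid j u v h \<cdot> t)"
    if jt: "is_coalg M W j t" and sq [simp]: "square M j u v h" for j t u v
  proof -
    have t [simp]: "j \<in> Arr M" "t \<in> Arr M" "dm t = cd j" "cd t = ob j" "t \<cdot> j = L j" "R j \<cdot> t = I (cd j)"
      and t_law: "\<delta> j \<cdot> t = Mid j (I (dm j)) t (L j) \<cdot> t"
      using jt by (auto simp: is_coalg_iff)
    have [simp]: "u \<in> Arr M" "v \<in> Arr M" "dm u = dm j" "cd u = dm h" "dm v = cd j" "cd v = cd h"
      using sq by (auto simp: square_def)
    have sqt [simp]: "square M j (I (dm j)) t (L j)" by (simp add: square_def)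
    have sqc: "square M j u (Mid j u v h \<cdot> t) (L h)"
      using square_comp[OF sqt Mid_square(1)[OF sq]] by simp
    have "Mid j u (Mid j u v h \<cdot> t) (L h) \<cdot> t = Mid (L j) u (Mid j u v h) (L h) \<cdot> (\<delta> j \<cdot> t)"
      unfolding t_law by (subst Mid_comp_ext[OF sqt]) simp_all
    also have "\<dots> = \<delta> h \<cdot> (Mid j u v h \<cdot> t)"
      by (simp add: comp_ext[OF comult_nat] assoc)
    finally have "coalg_map_sq j t (j, u, Mid j u v h \<cdot> t, L h) (L h) (\<delta> h)"
      using sqc by (simp add: coalg_map_sq_def arrow_Hom_iff)
    from nat[OF jt cofree_coalg this arrow_HomI[OF sqe]] show ?thesis
      by (simp add: r_def[symmetric] comp_ext[OF Mid_nat(2)] assoc)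
  qed
  define m where "m = L (R h) \<cdot> L h"
  have m [simp]: "m \<in> Arr M" "dm m = dm h" "cd m = ob (R h)" by (simp_all add: m_def)
  have sqm: "square M (L (R h) \<cdot> L h) (I (dm h)) (R (R h)) h"
    by (simp add: square_def comp_ext[OF factorization(7)])
  have sqr [simp]: "square M (R h) r (I (cd h)) h" by (simp add: square_def)
  have "r \<cdot> \<mu> h = \<theta> m (comp_coalg (L h) (\<delta> h) (L (R h)) (\<delta> (R h))) (m, I (dm h), R (R h), h)"
    using nat[OF comp_coalg cofree_coalg mult_coalg_map[OF h] arrow_HomI[OF sqe]]
    by (simp add: cofree_coalg m_def[symmetric] r_def[symmetric])
  also have "\<dots> = \<theta> (L (R h)) (\<delta> (R h)) (L (R h), \<theta> (L h) (\<delta> h) (L h, I (dm h), R (R h) \<cdot> L (R h), h), R (R h), h)"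
    unfolding m_def by (rule comp) (simp_all add: cofree_coalg sqm)
  also have "\<dots> = r \<cdot> (Mid (L (R h)) r (R (R h)) h \<cdot> \<delta> (R h))"
    by (simp add: r_def[symmetric]) (rule rep, simp_all add: cofree_coalg square_def)
  also have "Mid (L (R h)) r (R (R h)) h = Mid (R h) r (I (cd h)) h \<cdot> Mid (L (R h)) (I (ob h)) (R (R h)) (R h)"
    by (subst Mid_comp) (simp_all add: square_def[of M "L (R h)"])
  also have "r \<cdot> (\<dots> \<cdot> \<delta> (R h)) = r \<cdot> Mid (R h) r (I (cd h)) h"
    using comult_laws(2)[of "R h"] by (simp add: assoc square_def[of M "L (R h)"])
  finally have "is_alg M W h r" by (simp add: is_alg_iff)
  moreover have "\<theta> j t \<tau> = canonical r t \<tau>" if "is_coalg M W j t" "\<tau> \<in> Hom (arrow_cat M) j h" for j t \<tau>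
    using that(2) rep[OF that(1)] by (auto elim!: arrow_HomE simp: canonical_def)
  ultimately show ?thesis by (rule that)
qed

end

section \<open>Adjunctions and their transposes\<close>

locale adj_on =
  fixes C :: "('o, 'a) cat" and D :: "('p, 'b) cat" and A :: "('o, 'a, 'p, 'b) adj"
  assumes adj: "adjunction C D A"
begin

sublocale F: is_functor C D "ladj A" using adj by (simp add: adjunction_def)
sublocale R: is_functor D C "radj A" using adj by (simp add: adjunction_def)

definition itransp where
  "itransp c d = the_inv_into (Hom D (omap (ladj A) c) d) (transp A c d)"

lemma transp_bij:
  "c \<in> Obj C \<Longrightarrow> d \<in> Obj D \<Longrightarrow>
     bij_betw (transp A c d) (Hom D (omap (ladj A) c) d) (Hom C c (omap (radj A) d))"
  using adj by (simp add: adjunction_def)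

lemma transp_arr [simp]:
  assumes "h \<in> Arr D" "Dom D h = omap (ladj A) c" "Cod D h = d" "c \<in> Obj C"
  shows "transp A c d h \<in> Arr C" "Dom C (transp A c d h) = c"
    "Cod C (transp A c d h) = omap (radj A) d"
proof -
  have "h \<in> Hom D (omap (ladj A) c) d" "d \<in> Obj D" using assms by (auto simp: Hom_def)
  then have "transp A c d h \<in> Hom C c (omap (radj A) d)"
    using bij_betwE[OF transp_bij[of c d]] assms by blast
  then show "transp A c d h \<in> Arr C" "Dom C (transp A c d h) = c"
    "Cod C (transp A c d h) = omap (radj A) d" by (auto simp: Hom_def)
qed

lemma itransp_arr [simp]:
  assumes "k \<in> Arr C" "Dom C k = c" "Cod C k = omap (radj A) d" "d \<in> Obj D"
  shows "itransp c d k \<in> Arr D" "Dom D (itransp c d k) = omap (ladj A) c" "Cod D (itransp c d k) = d"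
    "transp A c d (itransp c d k) = k"
proof -
  have c: "k \<in> Hom C c (omap (radj A) d)" "c \<in> Obj C" using assms by (auto simp: Hom_def)
  note b = transp_bij[OF c(2) assms(4)]
  have "itransp c d k \<in> Hom D (omap (ladj A) c) d"
    unfolding itransp_def using b c by (intro the_inv_into_into) (auto simp: bij_betw_def)
  then show "itransp c d k \<in> Arr D" "Dom D (itransp c d k) = omap (ladj A) c" "Cod D (itransp c d k) = d"
    by (auto simp: Hom_def)
  show "transp A c d (itransp c d k) = k"
    unfolding itransp_def using b c by (intro f_the_inv_into_f) (auto simp: bij_betw_def)
qed

lemma itransp_transp [simp]:
  assumes "h \<in> Arr D" "Dom D h = omap (ladj A) c" "Cod D h = d" "c \<in> Obj C"
  shows "itransp c d (transp A c d h) = h"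
proof -
  have "h \<in> Hom D (omap (ladj A) c) d" "d \<in> Obj D" using assms by (auto simp: Hom_def)
  then show ?thesis unfolding itransp_def
    using transp_bij[of c d] assms(4) by (intro the_inv_into_f_f) (auto simp: bij_betw_def)
qed

lemma transp_eqD:
  assumes "transp A c d h = transp A c d k" "h \<in> Arr D" "Dom D h = omap (ladj A) c" "Cod D h = d"
    "k \<in> Arr D" "Dom D k = omap (ladj A) c" "Cod D k = d" "c \<in> Obj C"
  shows "h = k"
  using itransp_transp[of h c d] itransp_transp[of k c d] assms by metis

lemma transp_nat:
  assumes "a \<in> Arr C" "b \<in> Arr D" "h \<in> Arr D" "Dom D h = omap (ladj A) (Cod C a)" "Cod D h = Dom D b"
  shows "transp A (Dom C a) (Cod D b) (b \<cdot>\<^bsub>D\<^esub> h \<cdot>\<^bsub>D\<^esub> amap (ladj A) a)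
          = amap (radj A) b \<cdot>\<^bsub>C\<^esub> transp A (Cod C a) (Dom D b) h \<cdot>\<^bsub>C\<^esub> a"
  using adj assms by (simp add: adjunction_def Hom_def)

lemma transp_nat_left:
  assumes "a \<in> Arr C" "h \<in> Arr D" "Dom D h = omap (ladj A) (Cod C a)" "Cod D h = d" "Dom C a = c'"
    "Cod C a = c"
  shows "transp A c' d (h \<cdot>\<^bsub>D\<^esub> amap (ladj A) a) = transp A c d h \<cdot>\<^bsub>C\<^esub> a"
proof -
  have "d \<in> Obj D" "c \<in> Obj C" using assms by auto
  then show ?thesis
    using transp_nat[OF assms(1) F.target.idt_arr(1)[of d], of h] assms by simp
qed

lemma transp_nat_right:
  assumes "b \<in> Arr D" "h \<in> Arr D" "Dom D h = omap (ladj A) c" "c \<in> Obj C" "Cod D h = Dom D b"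
    "Cod D b = d'" "Dom D b = d"
  shows "transp A c d' (b \<cdot>\<^bsub>D\<^esub> h) = amap (radj A) b \<cdot>\<^bsub>C\<^esub> transp A c d h"
  using transp_nat[OF F.source.idt_arr(1)[of c], of b h] assms by simp

lemma itransp_nat_left:
  assumes "a \<in> Arr C" "k \<in> Arr C" "Cod C a = Dom C k" "Cod C k = omap (radj A) d" "d \<in> Obj D"
    "Dom C a = c'" "Dom C k = c"
  shows "itransp c' d (k \<cdot>\<^bsub>C\<^esub> a) = itransp c d k \<cdot>\<^bsub>D\<^esub> amap (ladj A) a"
proof -
  have "c' \<in> Obj C" using assms by auto
  then show ?thesis
    by (intro transp_eqD[of c' d]) (use assms in \<open>simp_all add: transp_nat_left[of _ _ _ _ c]\<close>)
qed

lemma itransp_nat_right: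
  assumes "b \<in> Arr D" "k \<in> Arr C" "Dom C k = c" "Cod C k = omap (radj A) (Dom D b)"
    "Cod D b = d'" "Dom D b = d"
  shows "itransp c d' (amap (radj A) b \<cdot>\<^bsub>C\<^esub> k) = b \<cdot>\<^bsub>D\<^esub> itransp c d k"
proof -
  have "c \<in> Obj C" "d \<in> Obj D" "d' \<in> Obj D" using assms by auto
  then show ?thesis
    by (intro transp_eqD[of c d']) (use assms in \<open>simp_all add: transp_nat_right[of _ _ _ _ d]\<close>)
qed

lemma unit_arr [simp]:
  assumes "c \<in> Obj C"
  shows "adj_unit D A c \<in> Arr C" "Dom C (adj_unit D A c) = c"
    "Cod C (adj_unit D A c) = omap (radj A) (omap (ladj A) c)"
  using assms by (simp_all add: adj_unit_def)

lemma transp_unit: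
  assumes "h \<in> Arr D" "Dom D h = omap (ladj A) c" "Cod D h = d" "c \<in> Obj C"
  shows "transp A c d h = amap (radj A) h \<cdot>\<^bsub>C\<^esub> adj_unit D A c"
  using transp_nat_right[of h "Idt D (omap (ladj A) c)" c d "omap (ladj A) c"] assms
  by (simp add: adj_unit_def)

lemma transp_amap:
  assumes "a \<in> Arr C" "Dom C a = c" "Cod C a = c'"
  shows "transp A c (omap (ladj A) c') (amap (ladj A) a) = adj_unit D A c' \<cdot>\<^bsub>C\<^esub> a"
  using transp_nat_left[of a "Idt D (omap (ladj A) c')" "omap (ladj A) c'" c c'] assms
  by (auto simp: adj_unit_def)

lemma counit_def': "adj_counit C D A d = itransp (omap (radj A) d) d (Idt C (omap (radj A) d))"
  by (simp add: adj_counit_def itransp_def)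

lemma counit_arr [simp]:
  assumes "d \<in> Obj D"
  shows "adj_counit C D A d \<in> Arr D" "Dom D (adj_counit C D A d) = omap (ladj A) (omap (radj A) d)"
    "Cod D (adj_counit C D A d) = d"
  using assms by (simp_all add: counit_def')

lemma triangle_radj:
  assumes "d \<in> Obj D"
  shows "amap (radj A) (adj_counit C D A d) \<cdot>\<^bsub>C\<^esub> adj_unit D A (omap (radj A) d) = Idt C (omap (radj A) d)"
  using transp_unit[of "adj_counit C D A d" "omap (radj A) d" d] assms by (simp add: counit_def')

end

section \<open>Elements of the arrow category\<close>

lemma (in category) arrow_elem:
  assumes "\<sigma> \<in> Arr (arrow_cat C)"
  shows "sq_top \<sigma> \<in> Arr C" "sq_bot \<sigma> \<in> Arr C"
    "Dom (arrow_cat C) \<sigma> \<in> Arr C" "Cod (arrow_cat C) \<sigma> \<in> Arr C"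
    "Dom C (sq_top \<sigma>) = Dom C (Dom (arrow_cat C) \<sigma>)" "Cod C (sq_top \<sigma>) = Dom C (Cod (arrow_cat C) \<sigma>)"
    "Dom C (sq_bot \<sigma>) = Cod C (Dom (arrow_cat C) \<sigma>)" "Cod C (sq_bot \<sigma>) = Cod C (Cod (arrow_cat C) \<sigma>)"
  by (insert assms, cases \<sigma>; auto simp: arrow_Arr square_def)+

lemma sq_comp [simp]:
  "sq_top (\<tau> \<cdot>\<^bsub>arrow_cat C\<^esub> \<sigma>) = sq_top \<tau> \<cdot>\<^bsub>C\<^esub> sq_top \<sigma>"
  "sq_bot (\<tau> \<cdot>\<^bsub>arrow_cat C\<^esub> \<sigma>) = sq_bot \<tau> \<cdot>\<^bsub>C\<^esub> sq_bot \<sigma>"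
  by (cases \<tau>; cases \<sigma>; simp)+

lemma sq_conv: "\<sigma> = (Dom (arrow_cat C) \<sigma>, sq_top \<sigma>, sq_bot \<sigma>, Cod (arrow_cat C) \<sigma>)"
  by (cases \<sigma>) simp

section \<open>The category of algebras\<close>

lemma structured_category:
  assumes "category M"
    and obj: "\<And>x. x \<in> X \<Longrightarrow> fst x \<in> Arr M"
    and idt: "\<And>x. x \<in> X \<Longrightarrow> Q x (Idt (arrow_cat M) (fst x)) x"
    and comp: "\<And>x y z \<sigma> \<tau>. x \<in> X \<Longrightarrow> y \<in> X \<Longrightarrow> z \<in> X \<Longrightarrow> \<sigma> \<in> Hom (arrow_cat M) (fst x) (fst y) \<Longrightarrow>
      \<tau> \<in> Hom (arrow_cat M) (fst y) (fst z) \<Longrightarrow> Q x \<sigma> y \<Longrightarrow> Q y \<tau> z \<Longrightarrow> Q x (\<tau> \<cdot>\<^bsub>arrow_cat M\<^esub> \<sigma>) z"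
  shows "category (structured_cat M X Q)"
proof -
  interpret A: category "arrow_cat M" using category.arrow_category[OF assms(1)] .
  have fst_obj: "fst x \<in> Obj (arrow_cat M)" if "x \<in> X" for x using obj[OF that] by simp
  let ?S = "structured_cat M X Q"
  have Hom_iff: "z \<in> Hom ?S x y \<longleftrightarrow> x \<in> X \<and> y \<in> X \<and>
      (\<exists>\<sigma>. z = (x, \<sigma>, y) \<and> \<sigma> \<in> Hom (arrow_cat M) (fst x) (fst y) \<and> Q x \<sigma> y)" for x y z
    by (cases z) (auto simp: Hom_def structured_cat_def)
  have sel: "Obj ?S = X" "Idt ?S x = (x, Idt (arrow_cat M) (fst x), x)"
    "(y', \<tau>, z) \<cdot>\<^bsub>?S\<^esub> (x, \<sigma>, y) = (x, \<tau> \<cdot>\<^bsub>arrow_cat M\<^esub> \<sigma>, z)" for x y y' z \<sigma> \<tau>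
    by (simp_all add: structured_cat_def)
  show ?thesis
  proof
    fix z assume "z \<in> Arr ?S"
    then show "Dom ?S z \<in> Obj ?S" "Cod ?S z \<in> Obj ?S"
      by (cases z; simp add: structured_cat_def)+
  next
    fix x assume "x \<in> Obj ?S"
    then show "Idt ?S x \<in> Hom ?S x x"
      using A.Idt_Hom[OF fst_obj, of x] idt[of x] by (simp only: Hom_iff sel) blast
  next
    fix x y z a b assume "a \<in> Hom ?S x y" "b \<in> Hom ?S y z"
    then obtain \<sigma> \<tau> where s: "a = (x, \<sigma>, y)" "\<sigma> \<in> Hom (arrow_cat M) (fst x) (fst y)" "Q x \<sigma> y"
        "b = (y, \<tau>, z)" "\<tau> \<in> Hom (arrow_cat M) (fst y) (fst z)" "Q y \<tau> z" "x \<in> X" "y \<in> X" "z \<in> X"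
      by (auto simp only: Hom_iff)
    then show "b \<cdot>\<^bsub>?S\<^esub> a \<in> Hom ?S x z"
      using comp[of x y z \<sigma> \<tau>] A.Comp_Hom[OF s(2,5)] by (simp only: Hom_iff sel) blast
  next
    fix x y a assume "a \<in> Hom ?S x y"
    then obtain \<sigma> where "a = (x, \<sigma>, y)" "\<sigma> \<in> Hom (arrow_cat M) (fst x) (fst y)"
      by (auto simp only: Hom_iff)
    then show "a \<cdot>\<^bsub>?S\<^esub> Idt ?S x = a" "Idt ?S y \<cdot>\<^bsub>?S\<^esub> a = a"
      by (simp_all only: sel A.Comp_Idt A.Idt_Comp)
  next
    fix w x y z a b c assume "a \<in> Hom ?S w x" "b \<in> Hom ?S x y" "c \<in> Hom ?S y z"
    then obtain \<sigma> \<tau> \<rho> where "a = (w, \<sigma>, x)" "\<sigma> \<in> Hom (arrow_cat M) (fst w) (fst x)"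
       "b = (x, \<tau>, y)" "\<tau> \<in> Hom (arrow_cat M) (fst x) (fst y)"
       "c = (y, \<rho>, z)" "\<rho> \<in> Hom (arrow_cat M) (fst y) (fst z)"
      by (auto simp only: Hom_iff)
    then show "(c \<cdot>\<^bsub>?S\<^esub> b) \<cdot>\<^bsub>?S\<^esub> a = c \<cdot>\<^bsub>?S\<^esub> (b \<cdot>\<^bsub>?S\<^esub> a)"
      by (simp only: sel A.Comp_assoc)
  qed
qed

context awfs_on
begin

lemma Rfun_functor: "is_functor (arrow_cat M) (arrow_cat M) (Rfun W)"
  using monad_W by (simp add: monad_def nat_trans_def)

lemma alg_map_idt: "is_alg M W f r \<Longrightarrow> alg_map_sq f r (Idt (arrow_cat M) f) f r"
  using Mid_idt[of f] by (auto simp: alg_map_sq_def is_alg_iff arrow_Hom_iff square_def)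

lemma alg_map_comp:
  assumes "is_alg M W f r" "is_alg M W g s" "is_alg M W h t"
    and "alg_map_sq f r \<sigma> g s" "alg_map_sq g s \<tau> h t"
  shows "alg_map_sq f r (\<tau> \<cdot>\<^bsub>arrow_cat M\<^esub> \<sigma>) h t"
proof -
  obtain u v where s: "\<sigma> = (f, u, v, g)" "square M f u v g" "s \<cdot> Mid f u v g = u \<cdot> r"
    using assms(4) unfolding alg_map_sq_def by (auto elim!: arrow_HomE)
  obtain u' v' where t: "\<tau> = (g, u', v', h)" "square M g u' v' h" "t \<cdot> Mid g u' v' h = u' \<cdot> s"
    using assms(5) unfolding alg_map_sq_def by (auto elim!: arrow_HomE)
  note [simp] = assms(1-3)[unfolded is_alg_iff] s(1,2) t(1,2)
  have [simp]: "u \<in> Arr M" "dm u = dm f" "cd u = dm g" "u' \<in> Arr M" "dm u' = dm g" "cd u' = dm h"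
    using s(2) t(2) by (auto simp: square_def)
  have "t \<cdot> Mid f (u' \<cdot> u) (v' \<cdot> v) h = t \<cdot> (Mid g u' v' h \<cdot> Mid f u v g)"
    by (simp add: Mid_comp)
  also have "\<dots> = (u' \<cdot> s) \<cdot> Mid f u v g"
    by (simp add: t(3)[symmetric] assoc)
  also have "\<dots> = u' \<cdot> (u \<cdot> r)" by (simp add: assoc s(3))
  finally show ?thesis using square_comp[OF s(2) t(2)]
    by (simp add: alg_map_sq_def arrow_Hom_iff assoc)
qed

lemma alg_map_sq_iff:
  assumes "is_alg M W f r" "is_alg M W g s" "\<sigma> \<in> Hom (arrow_cat M) f g"
  shows "alg_sq M W (g, s) \<cdot>\<^bsub>arrow_cat M\<^esub> amap (Rfun W) \<sigma> = \<sigma> \<cdot>\<^bsub>arrow_cat M\<^esub> alg_sq M W (f, r)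
    \<longleftrightarrow> alg_map_sq f r \<sigma> g s"
proof -
  obtain u v where s: "\<sigma> = (f, u, v, g)" "square M f u v g"
    using assms(3) by (rule arrow_HomE)
  have "v \<in> Arr M" "dm v = cd f" "cd v = cd g" using s(2) by (auto simp: square_def)
  then show ?thesis using s(2) by (simp add: s(1) alg_map_sq_def alg_sq_def arrow_Hom_iff)
qed

lemma alg_category: "category (alg_cat M W)"
proof -
  let ?X = "{x. algebra (arrow_cat M) (Rfun W) (eta M W) (mu M W) (fst x) (alg_sq M W x)}"
  let ?P = "\<lambda>x \<sigma> y. alg_sq M W y \<cdot>\<^bsub>arrow_cat M\<^esub> amap (Rfun W) \<sigma> = \<sigma> \<cdot>\<^bsub>arrow_cat M\<^esub> alg_sq M W x"
  have X: "x \<in> ?X \<Longrightarrow> is_alg M W (fst x) (snd x)" for x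
    by (simp add: is_alg_def alg_cat_def structured_cat_def)
  have P: "?P x \<sigma> y \<longleftrightarrow> alg_map_sq (fst x) (snd x) \<sigma> (fst y) (snd y)"
    if p: "x \<in> ?X" "y \<in> ?X" "\<sigma> \<in> Hom (arrow_cat M) (fst x) (fst y)" for x y \<sigma>
    using alg_map_sq_iff[OF X[OF p(1)] X[OF p(2)] p(3)] by (simp only: prod.collapse)
  interpret A: category "arrow_cat M" by (rule arrow_category)
  show ?thesis unfolding alg_cat_def
  proof (rule structured_category[OF category_axioms])
    fix x assume x: "x \<in> ?X"
    then show f: "fst x \<in> Arr M" using X[OF x] by (simp only: is_alg_iff)
    have "Idt (arrow_cat M) (fst x) \<in> Hom (arrow_cat M) (fst x) (fst x)"
      using A.Idt_Hom[of "fst x"] f by (simp only: arrow_sel)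
    from P[OF x x this] alg_map_idt[OF X[OF x]] show "?P x (Idt (arrow_cat M) (fst x)) x" by iprover
  next
    fix x y z \<sigma> \<tau>
    assume xyz: "x \<in> ?X" "y \<in> ?X" "z \<in> ?X"
      and st: "\<sigma> \<in> Hom (arrow_cat M) (fst x) (fst y)" "\<tau> \<in> Hom (arrow_cat M) (fst y) (fst z)"
      and PQ: "?P x \<sigma> y" "?P y \<tau> z"
    from alg_map_comp[OF X[OF xyz(1)] X[OF xyz(2)] X[OF xyz(3)] P[OF xyz(1,2) st(1), THEN iffD1, OF PQ(1)]
        P[OF xyz(2,3) st(2), THEN iffD1, OF PQ(2)]]
    show "?P x (\<tau> \<cdot>\<^bsub>arrow_cat M\<^esub> \<sigma>) z"
      by (rule P[OF xyz(1,3) A.Comp_Hom[OF st], THEN iffD2])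
  qed
qed

lemma canonical_alg_map:
  assumes jt: "is_coalg M W j t" and f: "is_alg M W f r" and g: "is_alg M W g s"
    and \<sigma>: "alg_map_sq f r \<sigma> g s" and \<tau>: "\<tau> \<in> Hom (arrow_cat M) j f"
  shows "canonical s t (\<sigma> \<cdot>\<^bsub>arrow_cat M\<^esub> \<tau>) = sq_top \<sigma> \<cdot> canonical r t \<tau>"
proof -
  note [simp] = jt[unfolded is_coalg_iff] f[unfolded is_alg_iff] g[unfolded is_alg_iff]
  obtain u v where k: "\<sigma> = (f, u, v, g)" "square M f u v g" "s \<cdot> Mid f u v g = u \<cdot> r"
    using \<sigma> unfolding alg_map_sq_def by (auto elim!: arrow_HomE)
  obtain u' v' where t: "\<tau> = (j, u', v', f)" "square M j u' v' f"
    using \<tau> by (auto elim!: arrow_HomE)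
  have [simp]: "u \<in> Arr M" "dm u = dm f" "cd u = dm g" using k by (auto simp: square_def)
  have "canonical s t (\<sigma> \<cdot>\<^bsub>arrow_cat M\<^esub> \<tau>) = (s \<cdot> Mid f u v g) \<cdot> (Mid j u' v' f \<cdot> t)"
    using k(1,2) t by (simp add: canonical_def Mid_comp_ext assoc)
  then show ?thesis using t by (simp add: k canonical_def assoc)
qed

end

section \<open>Algebras of a generated awfs\<close>

locale generated = awfs_on M W for M :: "('o, 'a) cat" (structure) and W +
  fixes J :: "('x, 'y) cat" and U :: "('x, 'y, 'a, 'a sq) func"
    and \<upsilon> :: "('x, 'y, 'a \<times> 'a, 'a str_arr) func"
  assumes gen: "generated_awfs M J U W \<upsilon>"
begin

abbreviation st where "st x \<equiv> snd (omap \<upsilon> x)"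

lemma iso: "cat_iso (alg_cat M W) (lifting_cat M J U) (canonical_lifts M J U W \<upsilon>)"
  using gen by (simp add: generated_awfs_def)

sublocale U: is_functor J "arrow_cat M" U
  using gen by (simp add: generated_awfs_def)

lemma unit_over: "func_eq J (comp_func forget \<upsilon>) U"
  using gen by (simp add: generated_awfs_def)

lemma unit_functor: "is_functor J (coalg_cat M W) \<upsilon>"
  using gen by (simp add: generated_awfs_def)

lemma unit_obj:
  assumes "x \<in> Obj J"
  shows "omap \<upsilon> x = (omap U x, st x)" "is_coalg M W (omap U x) (st x)" "omap U x \<in> Arr M"
proof -
  have "fst (omap \<upsilon> x) = omap U x"
    using unit_over assms by (auto simp: func_eq_def comp_func_def forget_def)
  then show *: "omap \<upsilon> x = (omap U x, st x)" by (metis prod.collapse)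
  have "omap \<upsilon> x \<in> Obj (coalg_cat M W)"
    using is_functor.omap_obj[OF unit_functor assms] .
  then show "is_coalg M W (omap U x) (st x)" by (simp only: is_coalg_def *[symmetric])
  show "omap U x \<in> Arr M" using U.omap_obj[OF assms] by simp
qed

lemma canonical_lifts_obj:
  assumes "is_alg M W h a"
  shows "omap (canonical_lifts M J U W \<upsilon>) (h, a)
     = (h, \<lambda>(x, \<tau>) \<in> problems M J U h. canonical a (st x) \<tau>)"
proof -
  have "a \<cdot> amap (mid W) \<tau> \<cdot> st x = canonical a (st x) \<tau>" if "(x, \<tau>) \<in> problems M J U h" for x \<tau>
  proof -
    have x: "x \<in> Obj J" and t: "\<tau> \<in> Hom (arrow_cat M) (omap U x) h"
      using that by (auto simp: problems_def)
    show ?thesis using assms t unit_obj(2)[OF x]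
      by (auto elim!: arrow_HomE simp: canonical_def is_alg_iff is_coalg_iff assoc)
  qed
  then have "(\<lambda>(x, \<tau>) \<in> problems M J U h. a \<cdot> amap (mid W) \<tau> \<cdot> st x)
      = (\<lambda>(x, \<tau>) \<in> problems M J U h. canonical a (st x) \<tau>)"
    by (intro restrict_ext) auto
  then show ?thesis by (simp add: canonical_lifts_def Let_def)
qed

text \<open>The next three lemmas express the isomorphism between algebras and compatible choices of solutions
  against the generating arrows: existence and uniqueness of structures, and fullness on arrows.\<close>

lemma lift_alg_ex:
  assumes "(h, \<phi>) \<in> Obj (lifting_cat M J U)"
  obtains a where "is_alg M W h a"
    "\<And>x \<tau>. x \<in> Obj J \<Longrightarrow> \<tau> \<in> Hom (arrow_cat M) (omap U x) h \<Longrightarrow> canonical a (st x) \<tau> = \<phi> (x, \<tau>)"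
proof -
  have "omap (canonical_lifts M J U W \<upsilon>) ` Obj (alg_cat M W) = Obj (lifting_cat M J U)"
    using iso by (simp add: cat_iso_def bij_betw_def)
  then have "(h, \<phi>) \<in> omap (canonical_lifts M J U W \<upsilon>) ` Obj (alg_cat M W)" using assms by simp
  then obtain y where y: "(h, \<phi>) = omap (canonical_lifts M J U W \<upsilon>) y" "y \<in> Obj (alg_cat M W)"
    by (rule imageE)
  obtain h' a where ha: "y = (h', a)" by (cases y)
  have a: "is_alg M W h' a" using y by (simp add: ha is_alg_def)
  have "h' = h" and \<phi>: "\<phi> = (\<lambda>(x, \<tau>) \<in> problems M J U h. canonical a (st x) \<tau>)"
    using y(1) unfolding ha canonical_lifts_obj[OF a] by (simp_all only: prod.inject)
  show ?thesis
  proof (rule that[of a])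
    show "is_alg M W h a" using a \<open>h' = h\<close> by simp
    fix x \<tau> assume "x \<in> Obj J" "\<tau> \<in> Hom (arrow_cat M) (omap U x) h"
    then show "canonical a (st x) \<tau> = \<phi> (x, \<tau>)" by (simp add: \<phi> problems_def)
  qed
qed

lemma alg_unique:
  assumes "is_alg M W h a" "is_alg M W h b"
    and "\<And>x \<tau>. x \<in> Obj J \<Longrightarrow> \<tau> \<in> Hom (arrow_cat M) (omap U x) h \<Longrightarrow>
      canonical a (st x) \<tau> = canonical b (st x) \<tau>"
  shows "a = b"
proof -
  have "(\<lambda>(x, \<tau>) \<in> problems M J U h. canonical a (st x) \<tau>)
      = (\<lambda>(x, \<tau>) \<in> problems M J U h. canonical b (st x) \<tau>)"
  proof (rule restrict_ext)
    fix z assume "z \<in> problems M J U h"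
    then have "fst z \<in> Obj J" "snd z \<in> Hom (arrow_cat M) (omap U (fst z)) h"
      by (auto simp: problems_def)
    then show "(case z of (x, \<tau>) \<Rightarrow> canonical a (st x) \<tau>) = (case z of (x, \<tau>) \<Rightarrow> canonical b (st x) \<tau>)"
      by (simp add: split_beta assms(3))
  qed
  then have "omap (canonical_lifts M J U W \<upsilon>) (h, a) = omap (canonical_lifts M J U W \<upsilon>) (h, b)"
    by (simp only: canonical_lifts_obj[OF assms(1)] canonical_lifts_obj[OF assms(2)])
  moreover have "inj_on (omap (canonical_lifts M J U W \<upsilon>)) (Obj (alg_cat M W))"
    using iso by (simp add: cat_iso_def bij_betw_def)
  ultimately have "(h, a) = (h, b)"
    using inj_onD assms(1,2) unfolding is_alg_def by fastforce
  then show ?thesis by simp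
qed

lemma alg_map_of_lifts:
  assumes ha: "is_alg M W h a" and kb: "is_alg M W k b" and \<sigma>: "\<sigma> \<in> Hom (arrow_cat M) h k"
    and lifts: "\<And>x \<tau>. x \<in> Obj J \<Longrightarrow> \<tau> \<in> Hom (arrow_cat M) (omap U x) h \<Longrightarrow>
      canonical b (st x) (\<sigma> \<cdot>\<^bsub>arrow_cat M\<^esub> \<tau>) = sq_top \<sigma> \<cdot> canonical a (st x) \<tau>"
  shows "alg_map_sq h a \<sigma> k b"
proof -
  let ?F = "canonical_lifts M J U W \<upsilon>"
  interpret F: is_functor "alg_cat M W" "lifting_cat M J U" ?F
    using iso by (simp add: cat_iso_def)
  have obj: "omap ?F (h, a) \<in> Obj (lifting_cat M J U)" "omap ?F (k, b) \<in> Obj (lifting_cat M J U)"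
    by (fact F.omap_obj[OF ha[unfolded is_alg_def]] F.omap_obj[OF kb[unfolded is_alg_def]])+
  define \<phi> \<psi> where "\<phi> = (\<lambda>(x, \<tau>) \<in> problems M J U h. canonical a (st x) \<tau>)"
    and "\<psi> = (\<lambda>(x, \<tau>) \<in> problems M J U k. canonical b (st x) \<tau>)"
  have F: "omap ?F (h, a) = (h, \<phi>)" "omap ?F (k, b) = (k, \<psi>)"
    by (simp_all only: canonical_lifts_obj[OF ha] canonical_lifts_obj[OF kb] \<phi>_def \<psi>_def)
  have "\<psi> (x, \<sigma> \<cdot>\<^bsub>arrow_cat M\<^esub> \<tau>) = sq_top \<sigma> \<cdot> \<phi> (x, \<tau>)" if "(x, \<tau>) \<in> problems M J U h" for x \<tau>
  proof -
    have x: "x \<in> Obj J" and t: "\<tau> \<in> Hom (arrow_cat M) (omap U x) h"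
      using that by (auto simp: problems_def)
    have "(x, \<sigma> \<cdot>\<^bsub>arrow_cat M\<^esub> \<tau>) \<in> problems M J U k"
      using x U.target.Comp_Hom[OF t \<sigma>] by (simp add: problems_def)
    then show ?thesis using that by (simp add: \<phi>_def \<psi>_def lifts[OF x t])
  qed
  then have "((h, \<phi>), \<sigma>, (k, \<psi>)) \<in> Arr (lifting_cat M J U)"
    using obj \<sigma> unfolding F by (simp add: lifting_cat_def structured_cat_def split_beta)
  moreover have "amap ?F ` Arr (alg_cat M W) = Arr (lifting_cat M J U)"
    using iso by (simp add: cat_iso_def bij_betw_def)
  ultimately have "((h, \<phi>), \<sigma>, (k, \<psi>)) \<in> amap ?F ` Arr (alg_cat M W)" by simp
  then obtain z where z: "((h, \<phi>), \<sigma>, (k, \<psi>)) = amap ?F z" "z \<in> Arr (alg_cat M W)"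
    by (rule imageE)
  obtain h' a' \<sigma>' k' b' where z_def: "z = ((h', a'), \<sigma>', (k', b'))"
    by (metis surj_pair)
  have algs: "is_alg M W h' a'" "is_alg M W k' b'" "alg_map_sq h' a' \<sigma>' k' b'"
    using z(2) by (simp_all add: z_def alg_Arr_iff)
  have "amap ?F z = (omap ?F (h', a'), \<sigma>', omap ?F (k', b'))"
    by (simp add: z_def canonical_lifts_def Let_def)
  then have eq: "omap ?F (h', a') = omap ?F (h, a)" "omap ?F (k', b') = omap ?F (k, b)" "\<sigma>' = \<sigma>"
    using z(1) unfolding F by (simp_all only: prod.inject)
  have inj: "inj_on (omap ?F) (Obj (alg_cat M W))"
    using iso by (simp add: cat_iso_def bij_betw_def)
  have "(h', a') = (h, a)" "(k', b') = (k, b)"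
    using inj_onD[OF inj eq(1)] inj_onD[OF inj eq(2)] ha kb algs(1,2) unfolding is_alg_def by iprover+
  then show ?thesis using algs eq(3) by simp
qed

end

section \<open>Adjunctions that transport lifting problems\<close>

text \<open>Let \<open>G \<stileturn> H\<close> be \<open>A2\<close> and \<open>T \<stileturn> S\<close> be \<open>A\<close>. The last clause says that transposition along \<open>T \<stileturn> S\<close>
  matches the solutions of a lifting problem \<open>\<sigma> : G j \<Rightarrow> f\<close> with those of its transpose
  \<open>j \<Rightarrow> H f\<close> along \<open>G \<stileturn> H\<close>; the clauses before it make this well-typed and natural. All three
  forms of adjunction have this property, and the universal property is proved from it alone.\<close>

definition lifting_adj ::
  "('o, 'a) cat \<Rightarrow> ('p, 'b) cat \<Rightarrow> ('a, 'a sq, 'b, 'b sq) adj \<Rightarrow> ('o, 'a, 'p, 'b) adj \<Rightarrow> bool" where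
  "lifting_adj M N A2 A \<longleftrightarrow> adjunction (arrow_cat M) (arrow_cat N) A2 \<and> adjunction M N A \<and>
     (\<forall>j\<in>Arr M. Cod N (omap (ladj A2) j) = omap (ladj A) (Cod M j)) \<and>
     (\<forall>\<sigma>\<in>Arr (arrow_cat M). sq_bot (amap (ladj A2) \<sigma>) = amap (ladj A) (sq_bot \<sigma>)) \<and>
     (\<forall>f\<in>Arr N. Dom M (omap (radj A2) f) = omap (radj A) (Dom N f)) \<and>
     (\<forall>\<sigma>\<in>Arr (arrow_cat N). sq_top (amap (radj A2) \<sigma>) = amap (radj A) (sq_top \<sigma>)) \<and>
     (\<forall>j\<in>Arr M. \<forall>f\<in>Arr N. \<forall>\<sigma>\<in>Hom (arrow_cat N) (omap (ladj A2) j) f.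
        \<forall>w\<in>Hom N (omap (ladj A) (Cod M j)) (Dom N f).
        solution N \<sigma> w \<longleftrightarrow> solution M (transp A2 j f \<sigma>) (transp A (Cod M j) (Dom N f) w))"

locale lifting_adjunction = MW: generated M W J U \<upsilon> + NW: awfs_on N W'
  for M :: "('o, 'a) cat" and W and J :: "('x, 'y) cat" and U and \<upsilon>
    and N :: "('p, 'b) cat" and W' +
  fixes A2 :: "('a, 'a sq, 'b, 'b sq) adj" and A :: "('o, 'a, 'p, 'b) adj"
    and \<Phi> :: "('x, 'y, 'b \<times> 'b, 'b str_arr) func"
  assumes lifting_adj: "lifting_adj M N A2 A"
    and \<Phi>_functor: "is_functor J (coalg_cat N W') \<Phi>"
    and \<Phi>_over: "func_eq J (comp_func forget \<Phi>) (comp_func (ladj A2) U)"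
begin

sublocale aM: category "arrow_cat M" by (rule MW.arrow_category)
sublocale aN: category "arrow_cat N" by (rule NW.arrow_category)
sublocale A2: adj_on "arrow_cat M" "arrow_cat N" A2
  using lifting_adj by (unfold_locales) (simp add: lifting_adj_def)
sublocale A: adj_on M N A
  using lifting_adj by (unfold_locales) (simp add: lifting_adj_def)
sublocale Q: is_functor "arrow_cat M" M "mid W" by (rule MW.mid_functor)
sublocale E: is_functor "arrow_cat N" N "mid W'" by (rule NW.mid_functor)

abbreviation compM (infixr "\<bullet>" 70) where "g \<bullet> f \<equiv> g \<cdot>\<^bsub>M\<^esub> f"
abbreviation compN (infixr "\<star>" 70) where "g \<star> f \<equiv> g \<cdot>\<^bsub>N\<^esub> f"
abbreviation compaM (infixr "\<odot>" 70) where "g \<odot> f \<equiv> g \<cdot>\<^bsub>arrow_cat M\<^esub> f"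
abbreviation compaN (infixr "\<otimes>" 70) where "g \<otimes> f \<equiv> g \<cdot>\<^bsub>arrow_cat N\<^esub> f"
abbreviation G where "G \<equiv> omap (ladj A2)"
abbreviation G1 where "G1 \<equiv> amap (ladj A2)"
abbreviation H where "H \<equiv> omap (radj A2)"
abbreviation H1 where "H1 \<equiv> amap (radj A2)"
abbreviation T where "T \<equiv> omap (ladj A)"
abbreviation T1 where "T1 \<equiv> amap (ladj A)"
abbreviation S where "S \<equiv> omap (radj A)"
abbreviation S1 where "S1 \<equiv> amap (radj A)"
abbreviation Q0 where "Q0 \<equiv> omap (mid W)"
abbreviation Q1 where "Q1 \<equiv> amap (mid W)"
abbreviation E0 where "E0 \<equiv> omap (mid W')"
abbreviation E1 where "E1 \<equiv> amap (mid W')"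
abbreviation tr where "tr \<equiv> transp A2"
abbreviation tri where "tri \<equiv> A2.itransp"
abbreviation ta where "ta \<equiv> transp A"
abbreviation dM where "dM \<equiv> Dom M"
abbreviation cM where "cM \<equiv> Cod M"
abbreviation dN where "dN \<equiv> Dom N"
abbreviation cN where "cN \<equiv> Cod N"
abbreviation st' where "st' x \<equiv> snd (omap \<Phi> x)"

lemma G_arr [simp]: "j \<in> Arr M \<Longrightarrow> G j \<in> Arr N" "j \<in> Arr M \<Longrightarrow> cN (G j) = T (cM j)"
  using lifting_adj A2.F.omap_obj[of j] by (simp_all add: lifting_adj_def)

lemma H_arr [simp]: "f \<in> Arr N \<Longrightarrow> H f \<in> Arr M" "f \<in> Arr N \<Longrightarrow> dM (H f) = S (dN f)"
  using lifting_adj A2.R.omap_obj[of f] by (simp_all add: lifting_adj_def)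

lemma G1_bot [simp]: "\<sigma> \<in> Arr (arrow_cat M) \<Longrightarrow> sq_bot (G1 \<sigma>) = T1 (sq_bot \<sigma>)"
  using lifting_adj by (simp add: lifting_adj_def)

lemma H1_top [simp]: "\<sigma> \<in> Arr (arrow_cat N) \<Longrightarrow> sq_top (H1 \<sigma>) = S1 (sq_top \<sigma>)"
  using lifting_adj by (simp add: lifting_adj_def)

lemma solution_transp:
  assumes "j \<in> Arr M" "f \<in> Arr N" "\<sigma> \<in> Hom (arrow_cat N) (G j) f" "w \<in> Hom N (T (cM j)) (dN f)"
  shows "solution N \<sigma> w \<longleftrightarrow> solution M (tr j f \<sigma>) (ta (cM j) (dN f) w)"
  using lifting_adj assms unfolding lifting_adj_def by blast

lemma tr_Hom: "\<sigma> \<in> Hom (arrow_cat N) (G j) f \<Longrightarrow> j \<in> Arr M \<Longrightarrow> tr j f \<sigma> \<in> Hom (arrow_cat M) j (H f)"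
  by (simp add: Hom_def)

lemma tri_Hom: "\<tau> \<in> Hom (arrow_cat M) j (H f) \<Longrightarrow> f \<in> Arr N \<Longrightarrow> tri j f \<tau> \<in> Hom (arrow_cat N) (G j) f"
  by (simp add: Hom_def)

lemma \<Phi>_obj:
  assumes "x \<in> Obj J"
  shows "omap \<Phi> x = (G (omap U x), st' x)" "is_coalg N W' (G (omap U x)) (st' x)"
proof -
  have "fst (omap \<Phi> x) = G (omap U x)"
    using \<Phi>_over assms by (auto simp: func_eq_def comp_func_def forget_def)
  then show *: "omap \<Phi> x = (G (omap U x), st' x)" by (metis prod.collapse)
  have "omap \<Phi> x \<in> Obj (coalg_cat N W')"
    using is_functor.omap_obj[OF \<Phi>_functor assms] .
  then show "is_coalg N W' (G (omap U x)) (st' x)" by (simp only: is_coalg_def *[symmetric])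
qed

lemma \<Phi>_arr:
  assumes "y \<in> Arr J"
  shows "amap \<Phi> y = (omap \<Phi> (Dom J y), G1 (amap U y), omap \<Phi> (Cod J y))"
    "NW.coalg_map_sq (G (omap U (Dom J y))) (st' (Dom J y)) (G1 (amap U y))
        (G (omap U (Cod J y))) (st' (Cod J y))"
proof -
  interpret P: is_functor J "coalg_cat N W'" \<Phi> by (rule \<Phi>_functor)
  have d: "Dom J y \<in> Obj J" "Cod J y \<in> Obj J" using assms by auto
  obtain a \<sigma> b where y: "amap \<Phi> y = (a, \<sigma>, b)" by (metis surj_pair)
  have "a = omap \<Phi> (Dom J y)" "b = omap \<Phi> (Cod J y)"
    using P.amap_arr(2,3)[OF assms] by (auto simp: y coalg_cat_def structured_cat_def)
  moreover have "\<sigma> = G1 (amap U y)"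
    using \<Phi>_over assms by (auto simp: func_eq_def comp_func_def forget_def y)
  ultimately show e: "amap \<Phi> y = (omap \<Phi> (Dom J y), G1 (amap U y), omap \<Phi> (Cod J y))"
    using y by simp
  show "NW.coalg_map_sq (G (omap U (Dom J y))) (st' (Dom J y)) (G1 (amap U y))
        (G (omap U (Cod J y))) (st' (Cod J y))"
  proof -
    have "((G (omap U (Dom J y)), st' (Dom J y)), G1 (amap U y), (G (omap U (Cod J y)), st' (Cod J y)))
        \<in> Arr (coalg_cat N W')"
      by (simp only: \<Phi>_obj(1)[OF d(1), symmetric] \<Phi>_obj(1)[OF d(2), symmetric] e[symmetric]
          P.amap_arr(1)[OF assms])
    then show ?thesis by (simp only: NW.coalg_Arr_iff)
  qed
qed

subsection \<open>Lifting the right adjoint to algebras\<close>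

definition lifts where
  "lifts f r = (\<lambda>(x, \<tau>) \<in> problems M J U (H f).
     ta (cM (omap U x)) (dN f) (NW.canonical r (st' x) (tri (omap U x) f \<tau>)))"

lemma NW_canonical_Hom:
  assumes "is_coalg N W' j t" "is_alg N W' f r" "\<sigma> \<in> Hom (arrow_cat N) j f"
  shows "NW.canonical r t \<sigma> \<in> Hom N (cN j) (dN f)" "solution N \<sigma> (NW.canonical r t \<sigma>)"
  using assms NW.canonical_solution[OF assms(1,2)]
  by (auto elim!: arrow_HomE simp: solution_def)

lemma MW_canonical_solution:
  assumes "is_coalg M W j t" "is_alg M W f r" "\<sigma> \<in> Hom (arrow_cat M) j f"
  shows "solution M \<sigma> (MW.canonical r t \<sigma>)"
  using assms MW.canonical_solution[OF assms(1,2)] by (auto elim!: arrow_HomE)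

text \<open>The transposes of the canonical solutions of the coalgebras \<open>\<Phi> x\<close> against \<open>(f, r)\<close> are compatible
  with the arrows of \<open>J\<close> because \<open>\<Phi>\<close> sends those to coalgebra maps.\<close>

lemma lifts_obj:
  assumes fr: "is_alg N W' f r"
  shows "(H f, lifts f r) \<in> Obj (lifting_cat M J U)"
proof -
  have f [simp]: "f \<in> Arr N" using fr by (simp add: NW.is_alg_iff)
  have sol: "solution M \<tau> (lifts f r (x, \<tau>))"
    if p: "(x, \<tau>) \<in> problems M J U (H f)" for x \<tau>
  proof -
    have x: "x \<in> Obj J" and t: "\<tau> \<in> Hom (arrow_cat M) (omap U x) (H f)"
      using p by (auto simp: problems_def)
    note [simp] = MW.unit_obj(3)[OF x]
    note s = tri_Hom[OF t f]
    note w = NW_canonical_Hom[OF \<Phi>_obj(2)[OF x] fr s]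
    have "solution M (tr (omap U x) f (tri (omap U x) f \<tau>)) (lifts f r (x, \<tau>))"
      using w p solution_transp[OF _ f s] by (simp add: lifts_def)
    then show ?thesis using t by (simp add: Hom_def)
  qed
  have comp: "lifts f r (Dom J y, \<tau> \<odot> amap U y) = lifts f r (Cod J y, \<tau>) \<bullet> sq_bot (amap U y)"
    if y: "y \<in> Arr J" and t: "\<tau> \<in> Hom (arrow_cat M) (omap U (Cod J y)) (H f)" for y \<tau>
  proof -
    have d: "Dom J y \<in> Obj J" "Cod J y \<in> Obj J" using y by auto
    note [simp] = MW.unit_obj(3)[OF d(1)] MW.unit_obj(3)[OF d(2)] y
    have uy: "amap U y \<in> Arr (arrow_cat M)" by simp
    note [simp] = MW.arrow_elem[OF uy]
    have t': "\<tau> \<odot> amap U y \<in> Hom (arrow_cat M) (omap U (Dom J y)) (H f)"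
      using t by (simp add: Hom_def)
    note s = tri_Hom[OF t f]
    note w = NW_canonical_Hom(1)[OF \<Phi>_obj(2)[OF d(2)] fr s]
    have "tri (omap U (Dom J y)) f (\<tau> \<odot> amap U y) = tri (omap U (Cod J y)) f \<tau> \<otimes> G1 (amap U y)"
      using t by (intro A2.itransp_nat_left) (auto simp: Hom_def)
    then have "NW.canonical r (st' (Dom J y)) (tri (omap U (Dom J y)) f (\<tau> \<odot> amap U y))
      = NW.canonical r (st' (Cod J y)) (tri (omap U (Cod J y)) f \<tau>) \<star> T1 (sq_bot (amap U y))"
      using NW.canonical_coalg_map[OF \<Phi>_obj(2)[OF d(1)] \<Phi>_obj(2)[OF d(2)] \<Phi>_arr(2)[OF y] fr s]
      by simp
    then show ?thesis
      using t t' d w by (simp add: lifts_def problems_def A.transp_nat_left[of _ _ _ _ "cM (omap U (Cod J y))"] Hom_def)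
  qed
  have "lifts f r \<in> extensional (problems M J U (H f))" by (simp add: lifts_def)
  then show ?thesis using sol comp
    by (auto simp: lifting_cat_def structured_cat_def)
qed

text \<open>The algebra structure on \<open>H f\<close> that corresponds to these transposed solutions.\<close>

definition \<alpha> where
  "\<alpha> f r = (THE a. is_alg M W (H f) a \<and> (\<forall>x\<in>Obj J. \<forall>\<tau>\<in>Hom (arrow_cat M) (omap U x) (H f).
     MW.canonical a (MW.st x) \<tau> = ta (cM (omap U x)) (dN f) (NW.canonical r (st' x) (tri (omap U x) f \<tau>))))"

lemma \<alpha>_eqI:
  assumes "is_alg M W (H f) a"
    and "\<And>x \<tau>. x \<in> Obj J \<Longrightarrow> \<tau> \<in> Hom (arrow_cat M) (omap U x) (H f) \<Longrightarrow>
     MW.canonical a (MW.st x) \<tau> = ta (cM (omap U x)) (dN f) (NW.canonical r (st' x) (tri (omap U x) f \<tau>))"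
  shows "\<alpha> f r = a"
  unfolding \<alpha>_def using assms by (intro the_equality) (auto intro: MW.alg_unique)

lemma \<alpha>:
  assumes fr: "is_alg N W' f r"
  shows "is_alg M W (H f) (\<alpha> f r)"
    "\<And>x \<tau>. x \<in> Obj J \<Longrightarrow> \<tau> \<in> Hom (arrow_cat M) (omap U x) (H f) \<Longrightarrow>
     MW.canonical (\<alpha> f r) (MW.st x) \<tau> = ta (cM (omap U x)) (dN f) (NW.canonical r (st' x) (tri (omap U x) f \<tau>))"
proof -
  obtain a where a: "is_alg M W (H f) a"
    "\<And>x \<tau>. x \<in> Obj J \<Longrightarrow> \<tau> \<in> Hom (arrow_cat M) (omap U x) (H f) \<Longrightarrow>
     MW.canonical a (MW.st x) \<tau> = ta (cM (omap U x)) (dN f) (NW.canonical r (st' x) (tri (omap U x) f \<tau>))"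
    using MW.lift_alg_ex[OF lifts_obj[OF fr]] by (auto simp: lifts_def problems_def)
  have "\<alpha> f r = a" by (rule \<alpha>_eqI[OF a])
  then show "is_alg M W (H f) (\<alpha> f r)"
    "\<And>x \<tau>. x \<in> Obj J \<Longrightarrow> \<tau> \<in> Hom (arrow_cat M) (omap U x) (H f) \<Longrightarrow>
     MW.canonical (\<alpha> f r) (MW.st x) \<tau> = ta (cM (omap U x)) (dN f) (NW.canonical r (st' x) (tri (omap U x) f \<tau>))"
    using a by auto
qed

text \<open>Together with \<open>\<alpha>\<close> this lifts \<open>H\<close> to a functor between categories of algebras.\<close>

lemma \<alpha>_map:
  assumes fr: "is_alg N W' f r" and gs: "is_alg N W' g s" and \<sigma>: "NW.alg_map_sq f r \<sigma> g s"
  shows "MW.alg_map_sq (H f) (\<alpha> f r) (H1 \<sigma>) (H g) (\<alpha> g s)"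
proof (rule MW.alg_map_of_lifts[OF \<alpha>(1)[OF fr] \<alpha>(1)[OF gs]])
  have [simp]: "f \<in> Arr N" "g \<in> Arr N" using fr gs by (simp_all add: NW.is_alg_iff)
  have sH: "\<sigma> \<in> Hom (arrow_cat N) f g" using \<sigma> by (simp add: NW.alg_map_sq_def)
  then have sA [simp]: "\<sigma> \<in> Arr (arrow_cat N)" "Dom (arrow_cat N) \<sigma> = f" "Cod (arrow_cat N) \<sigma> = g"
    by (auto simp: Hom_def)
  note [simp] = NW.arrow_elem[OF sA(1)]
  show H\<sigma>: "H1 \<sigma> \<in> Hom (arrow_cat M) (H f) (H g)" by (simp add: Hom_def)
  fix x \<tau> assume x: "x \<in> Obj J" and t: "\<tau> \<in> Hom (arrow_cat M) (omap U x) (H f)"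
  note [simp] = MW.unit_obj(3)[OF x]
  note s = tri_Hom[OF t]
  have w: "NW.canonical r (st' x) (tri (omap U x) f \<tau>) \<in> Hom N (T (cM (omap U x))) (dN f)"
    using NW_canonical_Hom(1)[OF \<Phi>_obj(2)[OF x] fr s] by simp
  have "tri (omap U x) g (H1 \<sigma> \<odot> \<tau>) = \<sigma> \<otimes> tri (omap U x) f \<tau>"
    using t by (intro A2.itransp_nat_right) (auto simp: Hom_def)
  then have "MW.canonical (\<alpha> g s) (MW.st x) (H1 \<sigma> \<odot> \<tau>)
     = ta (cM (omap U x)) (dN g) (sq_top \<sigma> \<star> NW.canonical r (st' x) (tri (omap U x) f \<tau>))"
    using \<alpha>(2)[OF gs x MW.U.target.Comp_Hom[OF t H\<sigma>]] NW.canonical_alg_map[OF \<Phi>_obj(2)[OF x] fr gs \<sigma> s] by simp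
  also have "\<dots> = S1 (sq_top \<sigma>) \<bullet> ta (cM (omap U x)) (dN f) (NW.canonical r (st' x) (tri (omap U x) f \<tau>))"
    using w by (intro A.transp_nat_right) (auto simp: Hom_def)
  finally show "MW.canonical (\<alpha> g s) (MW.st x) (H1 \<sigma> \<odot> \<tau>)
      = sq_top (H1 \<sigma>) \<bullet> MW.canonical (\<alpha> f r) (MW.st x) \<tau>"
    by (simp add: \<alpha>(2)[OF fr x t])
qed

subsection \<open>The structure maps and their mates\<close>

lemma eta_Hom: "f \<in> Arr N \<Longrightarrow> eta N W' f \<in> Hom (arrow_cat N) f (NW.R f)"
  by (simp add: eta_def arrow_Hom_iff square_def)

lemma eta_arr [simp]:
  assumes "f \<in> Arr N"
  shows "eta N W' f \<in> Arr (arrow_cat N)" "Dom (arrow_cat N) (eta N W' f) = f"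
    "Cod (arrow_cat N) (eta N W' f) = NW.R f"
  using eta_Hom[OF assms] by (auto simp: Hom_def)

text \<open>A lift of \<open>H\<close> to algebras is determined by its values on free algebras, since every algebra is a
  quotient of a free one. The component \<open>\<rho> f\<close> extends \<open>H\<close> applied to the unit \<open>f \<Rightarrow> R f\<close> along the
  structure on \<open>H (R f)\<close>, and \<open>\<rho>_alg\<close> recovers the lift from it. Like its mate \<open>lam\<close> below it is made
  extensional, so that it is unique as a HOL function.\<close>

definition \<rho> where
  "\<rho> = (\<lambda>f\<in>Arr N. \<alpha> (NW.R f) (NW.\<mu> f) \<bullet> Q1 (H1 (eta N W' f)))"

lemma \<alpha>_arr [simp]:
  assumes "is_alg N W' f r"
  shows "\<alpha> f r \<in> Arr M" "dM (\<alpha> f r) = Q0 (H f)" "cM (\<alpha> f r) = S (dN f)"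
  using \<alpha>(1)[OF assms] assms by (auto simp: MW.is_alg_iff NW.is_alg_iff)

lemma \<rho>_arr [simp]:
  assumes f: "f \<in> Arr N"
  shows "\<rho> f \<in> Arr M" "dM (\<rho> f) = Q0 (H f)" "cM (\<rho> f) = S (E0 f)"
  using \<alpha>_arr[OF NW.free_alg[OF f]] f by (simp_all add: \<rho>_def)

lemma \<alpha>_mapD:
  assumes fr: "is_alg N W' f r" and gs: "is_alg N W' g s" and \<sigma>: "NW.alg_map_sq f r \<sigma> g s"
  shows "\<alpha> g s \<bullet> Q1 (H1 \<sigma>) = S1 (sq_top \<sigma>) \<bullet> \<alpha> f r"
proof -
  have "\<sigma> \<in> Arr (arrow_cat N)" using \<sigma> by (simp add: NW.alg_map_sq_def Hom_def)
  then show ?thesis using \<alpha>_map[OF assms] by (simp add: MW.alg_map_sq_def)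
qed

lemma \<rho>_alg:
  assumes fr: "is_alg N W' f r"
  shows "S1 r \<bullet> \<rho> f = \<alpha> f r"
proof -
  note [simp] = fr[unfolded NW.is_alg_iff]
  let ?\<sigma> = "(NW.R f, r, NW.I (cN f), f)"
  have m: "NW.alg_map_sq (NW.R f) (NW.\<mu> f) ?\<sigma> f r"
    by (simp add: NW.alg_map_sq_def arrow_Hom_iff square_def)
  have sA [simp]: "?\<sigma> \<in> Arr (arrow_cat N)" using m by (simp add: NW.alg_map_sq_def Hom_def)
  have "?\<sigma> \<otimes> eta N W' f = Idt (arrow_cat N) f"
    by (simp add: eta_def)
  then have "H1 ?\<sigma> \<odot> H1 (eta N W' f) = Idt (arrow_cat M) (H f)"
    using A2.R.amap_comp[of "eta N W' f" ?\<sigma>] A2.R.amap_idt[of f] by simp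
  then have 1: "Q1 (H1 ?\<sigma>) \<bullet> Q1 (H1 (eta N W' f)) = Idt M (Q0 (H f))"
    using Q.amap_comp[of "H1 (eta N W' f)" "H1 ?\<sigma>"] Q.amap_idt[of "H f"] by simp
  have "S1 r \<bullet> \<rho> f = (S1 r \<bullet> \<alpha> (NW.R f) (NW.\<mu> f)) \<bullet> Q1 (H1 (eta N W' f))"
    by (simp add: \<rho>_def MW.assoc NW.free_alg)
  also have "\<dots> = \<alpha> f r \<bullet> (Q1 (H1 ?\<sigma>) \<bullet> Q1 (H1 (eta N W' f)))"
    using \<alpha>_mapD[OF NW.free_alg fr m] by (simp add: MW.assoc[symmetric] fr)
  finally show ?thesis by (simp add: 1 fr)
qed

lemma eta_nat:
  "\<sigma> \<in> Arr (arrow_cat N) \<Longrightarrow>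
    amap (Rfun W') \<sigma> \<otimes> eta N W' (Dom (arrow_cat N) \<sigma>) = eta N W' (Cod (arrow_cat N) \<sigma>) \<otimes> \<sigma>"
  using NW.monad_W by (simp add: monad_def nat_trans_def id_func_def)

lemma Rfun_alg_map:
  assumes "\<sigma> \<in> Hom (arrow_cat N) f g"
  shows "NW.alg_map_sq (NW.R f) (NW.\<mu> f) (amap (Rfun W') \<sigma>) (NW.R g) (NW.\<mu> g)"
  using assms by (auto elim!: arrow_HomE simp: NW.alg_map_sq_def arrow_Hom_iff NW.mult_nat)

lemma \<rho>_nat:
  assumes \<sigma>: "\<sigma> \<in> Arr (arrow_cat N)" "Dom (arrow_cat N) \<sigma> = f" "Cod (arrow_cat N) \<sigma> = g"
  shows "S1 (E1 \<sigma>) \<bullet> \<rho> f = \<rho> g \<bullet> Q1 (H1 \<sigma>)"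
proof -
  interpret R: is_functor "arrow_cat N" "arrow_cat N" "Rfun W'" by (rule NW.Rfun_functor)
  have fg [simp]: "f \<in> Arr N" "g \<in> Arr N" using NW.arrow_elem[OF \<sigma>(1)] \<sigma>(2,3) by auto
  note [simp] = \<sigma>
  have s: "\<sigma> \<in> Hom (arrow_cat N) f g" using \<sigma> by (simp add: Hom_def)
  note m = Rfun_alg_map[OF s]
  have RA [simp]: "amap (Rfun W') \<sigma> \<in> Arr (arrow_cat N)" "Dom (arrow_cat N) (amap (Rfun W') \<sigma>) = NW.R f"
    "Cod (arrow_cat N) (amap (Rfun W') \<sigma>) = NW.R g"
    using m by (auto simp: NW.alg_map_sq_def Hom_def)
  have top: "sq_top (amap (Rfun W') \<sigma>) = E1 \<sigma>"
    by (cases \<sigma>) simp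
  have "S1 (E1 \<sigma>) \<bullet> \<rho> f = (S1 (E1 \<sigma>) \<bullet> \<alpha> (NW.R f) (NW.\<mu> f)) \<bullet> Q1 (H1 (eta N W' f))"
    by (simp add: \<rho>_def MW.assoc NW.free_alg)
  also have "\<dots> = \<alpha> (NW.R g) (NW.\<mu> g) \<bullet> (Q1 (H1 (amap (Rfun W') \<sigma>)) \<bullet> Q1 (H1 (eta N W' f)))"
    using \<alpha>_mapD[OF NW.free_alg NW.free_alg m] by (simp add: MW.assoc[symmetric] NW.free_alg top)
  also have "Q1 (H1 (amap (Rfun W') \<sigma>)) \<bullet> Q1 (H1 (eta N W' f)) = Q1 (H1 (eta N W' g)) \<bullet> Q1 (H1 \<sigma>)"
    using eta_nat[OF \<sigma>(1)] by (simp add: Q.amap_comp[symmetric] A2.R.amap_comp[symmetric])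
  finally show ?thesis by (simp add: \<rho>_def MW.assoc NW.free_alg)
qed

abbreviation unit2 where "unit2 \<equiv> adj_unit (arrow_cat N) A2"

text \<open>The mate of \<open>\<rho>\<close>.\<close>

definition lam where
  "lam = (\<lambda>j\<in>Arr M. A.itransp (Q0 j) (E0 (G j)) (\<rho> (G j) \<bullet> Q1 (unit2 j)))"

lemma lam_arr [simp]:
  assumes "j \<in> Arr M"
  shows "lam j \<in> Arr N" "dN (lam j) = T (Q0 j)" "cN (lam j) = E0 (G j)"
    "ta (Q0 j) (E0 (G j)) (lam j) = \<rho> (G j) \<bullet> Q1 (unit2 j)"
  using assms by (simp_all add: lam_def)

text \<open>The mate relation, transported from units and counits to arbitrary lifting problems. It turns
  statements about \<open>lam\<close> into statements about \<open>\<rho>\<close>, hence about algebras.\<close>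

lemma \<rho>_tr:
  assumes s: "\<sigma> \<in> Hom (arrow_cat N) (G j) f" and j [simp]: "j \<in> Arr M"
  shows "\<rho> f \<bullet> Q1 (tr j f \<sigma>) = ta (Q0 j) (E0 f) (E1 \<sigma> \<star> lam j)"
proof -
  have s' [simp]: "\<sigma> \<in> Arr (arrow_cat N)" "Dom (arrow_cat N) \<sigma> = G j" "Cod (arrow_cat N) \<sigma> = f"
    using s by (auto simp: Hom_def)
  have f [simp]: "f \<in> Arr N" using NW.arrow_elem(4)[OF s'(1)] by simp
  have "\<rho> f \<bullet> Q1 (tr j f \<sigma>) = \<rho> f \<bullet> (Q1 (H1 \<sigma>) \<bullet> Q1 (unit2 j))"
    by (simp add: A2.transp_unit Q.amap_comp)
  also have "\<dots> = (S1 (E1 \<sigma>) \<bullet> \<rho> (G j)) \<bullet> Q1 (unit2 j)"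
    by (simp add: \<rho>_nat MW.assoc)
  also have "\<dots> = S1 (E1 \<sigma>) \<bullet> ta (Q0 j) (E0 (G j)) (lam j)"
    by (simp add: MW.assoc)
  also have "\<dots> = ta (Q0 j) (E0 f) (E1 \<sigma> \<star> lam j)"
    by (subst A.transp_nat_right[of _ _ _ _ "E0 (G j)"]) simp_all
  finally show ?thesis .
qed

lemma lam_nat:
  assumes k: "\<kappa> \<in> Arr (arrow_cat M)" "Dom (arrow_cat M) \<kappa> = j" "Cod (arrow_cat M) \<kappa> = k"
  shows "lam k \<star> T1 (Q1 \<kappa>) = E1 (G1 \<kappa>) \<star> lam j"
proof -
  note [simp] = k
  have [simp]: "j \<in> Arr M" "k \<in> Arr M" using MW.arrow_elem[OF k(1)] k(2,3) by auto
  have "ta (Q0 j) (E0 (G k)) (lam k \<star> T1 (Q1 \<kappa>)) = ta (Q0 k) (E0 (G k)) (lam k) \<bullet> Q1 \<kappa>"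
    by (subst A.transp_nat_left[of _ _ _ _ "Q0 k"]) simp_all
  also have "\<dots> = \<rho> (G k) \<bullet> Q1 (unit2 k \<odot> \<kappa>)"
    by (simp add: MW.assoc Q.amap_comp)
  also have "unit2 k \<odot> \<kappa> = tr j (G k) (G1 \<kappa>)"
    by (simp add: A2.transp_amap)
  also have "\<rho> (G k) \<bullet> Q1 (tr j (G k) (G1 \<kappa>)) = ta (Q0 j) (E0 (G k)) (E1 (G1 \<kappa>) \<star> lam j)"
    by (rule \<rho>_tr) (simp_all add: Hom_def)
  finally show ?thesis by (rule A.transp_eqD) simp_all
qed

text \<open>Solving \<open>\<sigma> : G j \<Rightarrow> f\<close> with the structure \<open>lam j \<star> T1 t\<close> amounts to solving the transposed problem
  with \<open>t\<close> and \<open>\<alpha> f r\<close>. In particular \<open>lam j \<star> T1 t\<close> yields solutions before it is known to be a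
  coalgebra structure.\<close>

lemma transpose_canonical:
  assumes j: "is_coalg M W j t" and fr: "is_alg N W' f r" and s: "\<sigma> \<in> Hom (arrow_cat N) (G j) f"
  shows "ta (cM j) (dN f) (NW.canonical r (lam j \<star> T1 t) \<sigma>) = MW.canonical (\<alpha> f r) t (tr j f \<sigma>)"
    "NW.canonical r (lam j \<star> T1 t) \<sigma> \<in> Hom N (T (cM j)) (dN f)"
    "solution N \<sigma> (NW.canonical r (lam j \<star> T1 t) \<sigma>)"
proof -
  note [simp] = j[unfolded MW.is_coalg_iff] fr[unfolded NW.is_alg_iff]
  have s' [simp]: "\<sigma> \<in> Arr (arrow_cat N)" "Dom (arrow_cat N) \<sigma> = G j" "Cod (arrow_cat N) \<sigma> = f"
    using s by (auto simp: Hom_def)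
  have "ta (cM j) (dN f) (NW.canonical r (lam j \<star> T1 t) \<sigma>)
     = ta (cM j) (dN f) (r \<star> ((E1 \<sigma> \<star> lam j) \<star> T1 t))"
    by (simp add: NW.canonical_def NW.assoc)
  also have "\<dots> = S1 r \<bullet> (ta (Q0 j) (E0 f) (E1 \<sigma> \<star> lam j) \<bullet> t)"
    by (subst A.transp_nat_right, simp_all, subst A.transp_nat_left[of _ _ _ _ "Q0 j"], simp_all)
  also have "\<dots> = (S1 r \<bullet> \<rho> f) \<bullet> (Q1 (tr j f \<sigma>) \<bullet> t)"
    by (simp add: \<rho>_tr[OF s, symmetric] MW.assoc)
  finally show 1: "ta (cM j) (dN f) (NW.canonical r (lam j \<star> T1 t) \<sigma>) = MW.canonical (\<alpha> f r) t (tr j f \<sigma>)"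
    by (simp add: \<rho>_alg[OF fr] MW.canonical_def)
  show 2: "NW.canonical r (lam j \<star> T1 t) \<sigma> \<in> Hom N (T (cM j)) (dN f)"
    by (simp add: NW.canonical_def Hom_def)
  show "solution N \<sigma> (NW.canonical r (lam j \<star> T1 t) \<sigma>)"
    using MW_canonical_solution[OF j \<alpha>(1)[OF fr] tr_Hom[OF s]]
    by (simp add: solution_transp[OF _ _ s 2] 1)
qed

end

lemma (in awfs_on) canonical_eta:
  assumes [simp]: "f \<in> Arr M" "z \<in> Arr M" "cd z = ob f"
  shows "canonical (\<mu> f) z (eta M W f) = z"
  by (simp add: canonical_def eta_def comp_ext[OF mult_laws(2)] square_def)

context lifting_adjunction
begin

subsection \<open>Solutions against composite algebras\<close>

text \<open>What \<open>lam j \<star> T1 t\<close> needs in order to be a coalgebra structure is that it solves problems against a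
  composite algebra in two steps, first against \<open>g\<close> and then against \<open>f\<close>.\<close>

abbreviation ell where "ell j t r \<sigma> \<equiv> NW.canonical r (lam j \<star> T1 t) \<sigma>"

definition two_step where
  "two_step j t f r g s u v = ell j t r (G j, u, ell j t s (G j, f \<star> u, v, g), f)"

lemma ell_nat:
  assumes j: "is_coalg M W j t" and k: "is_coalg M W k s" and \<kappa>: "MW.coalg_map_sq j t \<kappa> k s"
    and fr: "is_alg N W' f r" and s: "\<sigma> \<in> Hom (arrow_cat N) (G k) f"
  shows "ell j t r (\<sigma> \<otimes> G1 \<kappa>) = ell k s r \<sigma> \<star> T1 (sq_bot \<kappa>)"
proof -
  have kH: "\<kappa> \<in> Hom (arrow_cat M) j k" using \<kappa> by (simp add: MW.coalg_map_sq_def)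
  then have kA [simp]: "\<kappa> \<in> Arr (arrow_cat M)" "Dom (arrow_cat M) \<kappa> = j" "Cod (arrow_cat M) \<kappa> = k"
    by (auto simp: Hom_def)
  note [simp] = MW.arrow_elem[OF kA(1), simplified kA(2,3)]
  have f [simp]: "f \<in> Arr N" using fr by (simp add: NW.is_alg_iff)
  have sA [simp]: "\<sigma> \<in> Arr (arrow_cat N)" "Dom (arrow_cat N) \<sigma> = G k" "Cod (arrow_cat N) \<sigma> = f"
    using s by (auto simp: Hom_def)
  have s': "\<sigma> \<otimes> G1 \<kappa> \<in> Hom (arrow_cat N) (G j) f" by (simp add: Hom_def)
  have tr: "tr j f (\<sigma> \<otimes> G1 \<kappa>) = tr k f \<sigma> \<odot> \<kappa>"
    by (rule A2.transp_nat_left) simp_all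
  note c = transpose_canonical[OF j fr s'] and d = transpose_canonical[OF k fr s]
  have dH: "ell k s r \<sigma> \<in> Arr N" "dN (ell k s r \<sigma>) = T (cM k)" "cN (ell k s r \<sigma>) = dN f"
    using d(2) by (auto simp: Hom_def)
  have "ta (cM j) (dN f) (ell j t r (\<sigma> \<otimes> G1 \<kappa>)) = MW.canonical (\<alpha> f r) s (tr k f \<sigma>) \<bullet> sq_bot \<kappa>"
    unfolding c(1) tr by (rule MW.canonical_coalg_map[OF j k \<kappa> \<alpha>(1)[OF fr] tr_Hom[OF s]]) simp
  also have "\<dots> = ta (cM j) (dN f) (ell k s r \<sigma> \<star> T1 (sq_bot \<kappa>))"
    unfolding d(1)[symmetric] by (rule A.transp_nat_left[symmetric]) (simp_all add: dH)
  finally show ?thesis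
    by (rule A.transp_eqD) (use c(2) dH in \<open>auto simp: Hom_def\<close>)
qed

lemma two_step_solution:
  assumes j: "is_coalg M W j t" and fr: "is_alg N W' f r" and gs: "is_alg N W' g s"
    and fg: "cN f = dN g" and sq: "square N (G j) u v (g \<star> f)"
  defines "n \<equiv> ell j t s (G j, f \<star> u, v, g)"
  defines "w \<equiv> two_step j t f r g s u v"
  shows "n \<in> Arr N" "dN n = T (cM j)" "cN n = dN g" "n \<star> G j = f \<star> u" "g \<star> n = v"
    "w \<in> Arr N" "dN w = T (cM j)" "cN w = dN f" "w \<star> G j = u" "f \<star> w = n"
    "square N (G j) (f \<star> u) v g" "square N (G j) u n f" "solution N (G j, u, v, g \<star> f) w"
proof -
  have [simp]: "j \<in> Arr M" "f \<in> Arr N" "g \<in> Arr N"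
    using j fr gs by (simp_all add: MW.is_coalg_iff NW.is_alg_iff)
  note [simp] = fg
  have uv [simp]: "u \<in> Arr N" "v \<in> Arr N" "dN u = dN (G j)" "cN u = dN f" "dN v = T (cM j)" "cN v = cN g"
    using sq by (auto simp: square_def)
  have gu: "g \<star> f \<star> u = v \<star> G j" using sq by (simp add: square_def NW.assoc)
  show sq1: "square N (G j) (f \<star> u) v g" using gu by (simp add: square_def)
  have "solution N (G j, f \<star> u, v, g) n"
    unfolding n_def by (rule transpose_canonical(3)[OF j gs arrow_HomI[OF sq1]])
  then show n [simp]: "n \<in> Arr N" "dN n = T (cM j)" "cN n = dN g" "n \<star> G j = f \<star> u" "g \<star> n = v"
    by (auto simp: solution_def Hom_def)
  show sq2: "square N (G j) u n f" by (simp add: square_def)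
  have "solution N (G j, u, n, f) w"
    unfolding w_def two_step_def n_def[symmetric] by (rule transpose_canonical(3)[OF j fr arrow_HomI[OF sq2]])
  then show w [simp]: "w \<in> Arr N" "dN w = T (cM j)" "cN w = dN f" "w \<star> G j = u" "f \<star> w = n"
    by (auto simp: solution_def Hom_def)
  show "solution N (G j, u, v, g \<star> f) w"
    by (simp add: solution_def Hom_def NW.assoc)
qed

lemma two_step_nat:
  assumes j: "is_coalg M W j t" and k: "is_coalg M W k q" and \<kappa>: "MW.coalg_map_sq j t \<kappa> k q"
    and fr: "is_alg N W' f r" and gs: "is_alg N W' g s"
    and fg: "cN f = dN g" and sq: "square N (G k) u v (g \<star> f)"
  shows "two_step j t f r g s (u \<star> sq_top (G1 \<kappa>)) (v \<star> T1 (sq_bot \<kappa>)) = two_step k q f r g s u v \<star> T1 (sq_bot \<kappa>)"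
proof -
  have kH: "\<kappa> \<in> Hom (arrow_cat M) j k" using \<kappa> by (simp add: MW.coalg_map_sq_def)
  then have kA [simp]: "\<kappa> \<in> Arr (arrow_cat M)" "Dom (arrow_cat M) \<kappa> = j" "Cod (arrow_cat M) \<kappa> = k"
    by (auto simp: Hom_def)
  have [simp]: "j \<in> Arr M" "k \<in> Arr M" "f \<in> Arr N" "g \<in> Arr N"
    using j k fr gs by (simp_all add: MW.is_coalg_iff NW.is_alg_iff)
  note [simp] = fg
  have uv [simp]: "u \<in> Arr N" "cN u = dN f" "dN u = dN (G k)" using sq by (auto simp: square_def)
  have GA: "G1 \<kappa> \<in> Arr (arrow_cat N)" by simp
  note [simp] = NW.arrow_elem[OF GA]
  have G1: "G1 \<kappa> = (G j, sq_top (G1 \<kappa>), T1 (sq_bot \<kappa>), G k)"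
    using sq_conv[of "G1 \<kappa>" N] by simp
  note S = two_step_solution[OF k fr gs fg sq]
  define n where "n = ell k q s (G k, f \<star> u, v, g)"
  have "ell j t s (G j, f \<star> u \<star> sq_top (G1 \<kappa>), v \<star> T1 (sq_bot \<kappa>), g) = n \<star> T1 (sq_bot \<kappa>)"
    using ell_nat[OF j k \<kappa> gs arrow_HomI[OF S(11)]] by (subst (asm) G1) (simp add: n_def NW.assoc)
  then have "two_step j t f r g s (u \<star> sq_top (G1 \<kappa>)) (v \<star> T1 (sq_bot \<kappa>))
     = ell j t r (G j, u \<star> sq_top (G1 \<kappa>), n \<star> T1 (sq_bot \<kappa>), f)"
    by (simp add: two_step_def)
  also have "\<dots> = ell k q r (G k, u, n, f) \<star> T1 (sq_bot \<kappa>)"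
    using ell_nat[OF j k \<kappa> fr arrow_HomI[OF S(12)]] by (subst (asm) G1) (simp add: n_def)
  finally show ?thesis by (simp add: two_step_def n_def)
qed

text \<open>On the generating coalgebras the structure induced by \<open>lam\<close> is the prescribed one: both solve the
  unit square \<open>G j \<Rightarrow> R (G j)\<close> against the free algebra in the same way, by the defining property of
  \<open>\<alpha>\<close>, and a structure is recovered from that solution.\<close>

lemma lam_unit:
  assumes x: "x \<in> Obj J"
  shows "lam (omap U x) \<star> T1 (MW.st x) = st' x"
proof -
  let ?j = "omap U x"
  note u = MW.unit_obj(2)[OF x] and p = \<Phi>_obj(2)[OF x]
  note [simp] = u[unfolded MW.is_coalg_iff] p[unfolded NW.is_coalg_iff]
  let ?e = "eta N W' (G ?j)"
  have eta: "NW.canonical (NW.\<mu> (G ?j)) z ?e = z" if "z \<in> Arr N" "cN z = E0 (G ?j)" for z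
    using that by (simp add: NW.canonical_eta)
  note e = eta_Hom[of "G ?j"]
  have "ta (cM ?j) (E0 (G ?j)) (lam ?j \<star> T1 (MW.st x)) = MW.canonical (\<alpha> (NW.R (G ?j)) (NW.\<mu> (G ?j))) (MW.st x) (tr ?j (NW.R (G ?j)) ?e)"
    using transpose_canonical(1)[OF u NW.free_alg e] by (simp add: eta)
  also have "\<dots> = ta (cM ?j) (E0 (G ?j)) (st' x)"
    using \<alpha>(2)[OF NW.free_alg x tr_Hom[OF e]] by (simp add: eta)
  finally show ?thesis by (rule A.transp_eqD) simp_all
qed

text \<open>Transposed two-step solutions are compatible with composition of coalgebras \<open>j\<close> and \<open>k\<close>. Each of the
  two steps is a canonical solution against \<open>H g\<close> or \<open>H f\<close>, and is therefore solved one factor of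
  \<open>k \<bullet> j\<close> at a time. What has to be checked is that the problem left over for \<open>k\<close> after solving for
  \<open>j\<close> is the same in both orders. The two squares \<open>\<kappa>1 : j \<Rightarrow> k \<bullet> j\<close> and \<open>\<kappa>2 : k \<bullet> j \<Rightarrow> k\<close> restrict
  problems to the factors, and the squares \<open>(f, 1) : g \<star> f \<Rightarrow> g\<close> and \<open>(1, g) : f \<Rightarrow> g \<star> f\<close> relate
  the two steps.\<close>

lemma two_step_comp:
  assumes j: "is_coalg M W j t" and k: "is_coalg M W k q" and jk: "cM j = dM k"
    and fr: "is_alg N W' f r" and gs: "is_alg N W' g s" and fg: "cN f = dN g"
    and sq: "square M (k \<bullet> j) a b (H (g \<star> f))"
  defines "\<theta> \<equiv> \<lambda>j t \<tau>. ta (cM j) (dN f) (two_step j t f r g s (sq_top (tri j (g \<star> f) \<tau>)) (sq_bot (tri j (g \<star> f) \<tau>)))"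
  shows "\<theta> (k \<bullet> j) (MW.comp_coalg j t k q) (k \<bullet> j, a, b, H (g \<star> f))
     = \<theta> k q (k, \<theta> j t (j, a, b \<bullet> k, H (g \<star> f)), b, H (g \<star> f))"
proof -
  define m x gf where "m = k \<bullet> j" and "x = MW.comp_coalg j t k q" and "gf = g \<star> f"
  have [simp]: "j \<in> Arr M" "k \<in> Arr M" "f \<in> Arr N" "g \<in> Arr N"
    using j k fr gs by (simp_all add: MW.is_coalg_iff NW.is_alg_iff)
  note [simp] = fg jk
  have gf [simp]: "gf \<in> Arr N" "dN gf = dN f" "cN gf = cN g" by (simp_all add: gf_def)
  have m [simp]: "m \<in> Arr M" "dM m = dM j" "cM m = cM k" by (simp_all add: m_def)
  have mx: "is_coalg M W m x" unfolding m_def x_def by (rule MW.comp_coalg[OF j k jk])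
  have ab [simp]: "a \<in> Arr M" "b \<in> Arr M" "dM a = dM j" "cM a = S (dN f)" "dM b = cM k" "cM b = cM (H gf)"
    using sq by (auto simp: square_def m_def[symmetric] gf_def[symmetric])
  have sqm: "square M m a b (H gf)" using sq by (simp add: m_def gf_def)
  \<comment> \<open>These squares restrict problems for the composite to its factors.\<close>
  define \<kappa>1 \<kappa>2 where "\<kappa>1 = (j, MW.I (dM j), k, m)" and "\<kappa>2 = (m, j, MW.I (cM k), k)"
  have k1 [simp]: "\<kappa>1 \<in> Arr (arrow_cat M)" "Dom (arrow_cat M) \<kappa>1 = j" "Cod (arrow_cat M) \<kappa>1 = m" "sq_bot \<kappa>1 = k"
    by (simp_all add: \<kappa>1_def arrow_Arr square_def m_def)
  have k2 [simp]: "\<kappa>2 \<in> Arr (arrow_cat M)" "Dom (arrow_cat M) \<kappa>2 = m" "Cod (arrow_cat M) \<kappa>2 = k" "sq_bot \<kappa>2 = MW.I (cM k)"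
    by (simp_all add: \<kappa>2_def arrow_Arr square_def) (simp add: m_def)
  have G1A: "G1 \<kappa>1 \<in> Arr (arrow_cat N)" "G1 \<kappa>2 \<in> Arr (arrow_cat N)" by simp_all
  note [simp] = NW.arrow_elem[OF G1A(1)] NW.arrow_elem[OF G1A(2)]
  define c d where "c = sq_top (G1 \<kappa>1)" and "d = sq_top (G1 \<kappa>2)"
  have G1k: "G1 \<kappa>1 = (G j, c, T1 k, G m)" "G1 \<kappa>2 = (G m, d, NW.I (T (cM k)), G k)"
    using sq_conv[of "G1 \<kappa>1" N] sq_conv[of "G1 \<kappa>2" N] by (simp_all add: c_def d_def)
  have cd [simp]: "c \<in> Arr N" "dN c = dN (G j)" "cN c = dN (G m)" "d \<in> Arr N" "dN d = dN (G m)" "cN d = dN (G k)"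
    by (simp_all add: c_def d_def)
  define \<tau> where "\<tau> = (m, a, b, H gf)"
  have t [simp]: "\<tau> \<in> Arr (arrow_cat M)" "Dom (arrow_cat M) \<tau> = m" "Cod (arrow_cat M) \<tau> = H gf"
    using sqm by (simp_all add: \<tau>_def arrow_Arr)
  have tH: "\<tau> \<in> Hom (arrow_cat M) m (H gf)" by (simp add: Hom_def)
  obtain u v where uv: "tri m gf \<tau> = (G m, u, v, gf)" "square N (G m) u v gf"
    using tri_Hom[OF tH] by (auto elim!: arrow_HomE)
  have uvA [simp]: "u \<in> Arr N" "dN u = dN (G m)" "cN u = dN f" "v \<in> Arr N" "dN v = T (cM k)" "cN v = cN g"
    using uv(2) by (auto simp: square_def)
  note Sm = two_step_solution[OF mx fr gs fg uv(2)[unfolded gf_def]]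
  define m1 where "m1 = ell m x s (G m, f \<star> u, v, g)"
  \<comment> \<open>Restricting to \<open>j\<close> and solving in two steps gives \<open>n1\<close> and then \<open>w'\<close>, with transpose \<open>w\<close>.\<close>
  have t1: "\<tau> \<odot> \<kappa>1 = (j, a, b \<bullet> k, H gf)" by (simp add: \<tau>_def \<kappa>1_def)
  have "tri j gf (\<tau> \<odot> \<kappa>1) = tri m gf \<tau> \<otimes> G1 \<kappa>1"
    by (rule A2.itransp_nat_left) simp_all
  then have tri1: "tri j gf (j, a, b \<bullet> k, H gf) = (G j, u \<star> c, v \<star> T1 k, gf)"
    by (simp add: t1 uv G1k)
  have sqj: "square N (G j) (u \<star> c) (v \<star> T1 k) (g \<star> f)"
    using aN.comp_arr(1)[OF G1A(1), of "(G m, u, v, gf)"] uv(2) by (simp add: G1k arrow_Arr gf_def)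
  note Sj = two_step_solution[OF j fr gs fg sqj]
  define n1 w' where "n1 = ell j t s (G j, f \<star> u \<star> c, v \<star> T1 k, g)" and "w' = two_step j t f r g s (u \<star> c) (v \<star> T1 k)"
  note Sj' [simp] = Sj[folded n1_def w'_def]
  define w where "w = ta (cM j) (dN f) w'"
  have \<theta>j: "\<theta> j t (j, a, b \<bullet> k, H gf) = w"
    by (simp add: \<theta>_def gf_def[symmetric] tri1 w_def w'_def)
  have w [simp]: "w \<in> Arr M" "dM w = cM j" "cM w = S (dN f)" by (simp_all add: w_def)
  have "solution M (tr j gf (G j, u \<star> c, v \<star> T1 k, gf)) w"
    unfolding w_def using solution_transp[of j gf "(G j, u \<star> c, v \<star> T1 k, gf)" w'] Sj'(13) sqj
    by (simp add: Hom_def arrow_Arr gf_def)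
  also have "tr j gf (G j, u \<star> c, v \<star> T1 k, gf) = (j, a, b \<bullet> k, H gf)"
    unfolding tri1[symmetric] t1[symmetric] by (rule A2.itransp_arr(4)) simp_all
  finally have wsol: "w \<bullet> j = a" "H gf \<bullet> w = b \<bullet> k" by (simp_all add: solution_def)
  \<comment> \<open>The problem \<open>\<tau>'\<close> left over for \<open>k\<close> has \<open>w\<close> as its top. It restricts to \<open>\<tau>\<close> along \<open>\<kappa>2\<close>.\<close>
  define \<tau>' where "\<tau>' = (k, w, b, H gf)"
  have sqk: "square M k w b (H gf)" by (simp add: square_def wsol)
  have t' [simp]: "\<tau>' \<in> Arr (arrow_cat M)" "Dom (arrow_cat M) \<tau>' = k" "Cod (arrow_cat M) \<tau>' = H gf"
    using sqk by (simp_all add: \<tau>'_def arrow_Arr)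
  have t'H: "\<tau>' \<in> Hom (arrow_cat M) k (H gf)" by (simp add: Hom_def)
  obtain u' v' where uv': "tri k gf \<tau>' = (G k, u', v', gf)" "square N (G k) u' v' gf"
    using tri_Hom[OF t'H] by (auto elim!: arrow_HomE)
  have uvA' [simp]: "u' \<in> Arr N" "dN u' = dN (G k)" "cN u' = dN f" "v' \<in> Arr N" "dN v' = T (cM k)" "cN v' = cN g"
    using uv'(2) by (auto simp: square_def)
  have tr': "tr k gf (G k, u', v', gf) = \<tau>'"
    unfolding uv'(1)[symmetric] by (rule A2.itransp_arr(4)) simp_all
  note Sk = two_step_solution[OF k fr gs fg uv'(2)[unfolded gf_def]]
  have "\<tau>' \<odot> \<kappa>2 = \<tau>" by (simp add: \<tau>'_def \<kappa>2_def \<tau>_def wsol)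
  then have "tri m gf \<tau> = tri k gf \<tau>' \<otimes> G1 \<kappa>2"
    using A2.itransp_nat_left[of \<kappa>2 \<tau>' gf m k] by simp
  then have uu': "u = u' \<star> d" "v = v'" by (simp_all add: uv uv' G1k)
  define m1' where "m1' = ell k q s (G k, f \<star> u', v', g)"
  note Sm' [simp] = Sm[folded m1_def] and Sk' [simp] = Sk[folded m1'_def]
  \<comment> \<open>Against \<open>g\<close>, both ways leave the same problem for \<open>k\<close>, whose top is the transpose of \<open>n1\<close>.\<close>
  define p where "p = sq_bot (H1 (gf, f, NW.I (cN g), g)) \<bullet> b"
  have fA [simp]: "(gf, f, NW.I (cN g), g) \<in> Arr (arrow_cat N)"
    by (simp add: arrow_Arr square_def gf_def)
  have HfA: "H1 (gf, f, NW.I (cN g), g) \<in> Arr (arrow_cat M)" by simp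
  note [simp] = MW.arrow_elem[OF HfA, simplified]
  have Hf: "H1 (gf, f, NW.I (cN g), g) = (H gf, S1 f, sq_bot (H1 (gf, f, NW.I (cN g), g)), H g)"
    using sq_conv[of "H1 (gf, f, NW.I (cN g), g)" M] by simp
  have fw: "S1 f \<bullet> w = ta (cM j) (dN g) n1"
    unfolding w_def using A.transp_nat_right[of f w' "cM j" "dN g" "dN f"] by simp
  have trm: "tr m g (G m, f \<star> u, v, g) = (m, S1 f \<bullet> a, p, H g)"
  proof -
    have "tr m g ((gf, f, NW.I (cN g), g) \<otimes> (G m, u, v, gf)) = H1 (gf, f, NW.I (cN g), g) \<odot> tr m gf (G m, u, v, gf)"
      by (rule A2.transp_nat_right) (use uv(2) in \<open>simp_all add: arrow_Arr fA[unfolded arrow_Arr]\<close>)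
    also have "tr m gf (G m, u, v, gf) = \<tau>"
      unfolding uv(1)[symmetric] by (rule A2.itransp_arr(4)) simp_all
    also have "H1 (gf, f, NW.I (cN g), g) \<odot> \<tau> = (m, S1 f \<bullet> a, p, H g)"
      by (subst Hf) (simp add: \<tau>_def p_def)
    finally show ?thesis by simp
  qed
  have trk: "tr k g (G k, f \<star> u', v', g) = (k, ta (cM j) (dN g) n1, p, H g)"
  proof -
    have "tr k g ((gf, f, NW.I (cN g), g) \<otimes> (G k, u', v', gf)) = H1 (gf, f, NW.I (cN g), g) \<odot> tr k gf (G k, u', v', gf)"
      by (rule A2.transp_nat_right) (use uv'(2) in \<open>simp_all add: arrow_Arr fA[unfolded arrow_Arr]\<close>)
    also have "\<dots> = (k, S1 f \<bullet> w, p, H g)"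
      unfolding tr' by (subst Hf) (simp add: \<tau>'_def p_def)
    finally show ?thesis by (simp add: fw)
  qed
  have comp1: "MW.canonical (\<alpha> e z) x (m, a', b', H e) = MW.canonical (\<alpha> e z) q (k, MW.canonical (\<alpha> e z) t (j, a', b' \<bullet> k, H e), b', H e)"
    if "is_alg N W' e z" "square M m a' b' (H e)" for e z a' b'
    using MW.canonical_comp_coalg[OF j k jk \<alpha>(1)[OF that(1)], of a' b'] that(2) by (simp add: m_def x_def)
  have ell1: "MW.canonical (\<alpha> e z) t (j, a', b' \<bullet> k, H e) = ta (cM j) (dN e) (ell j t z (G j, u1 \<star> c, v1 \<star> T1 k, e))"
    if e: "is_alg N W' e z" and sq1: "square N (G m) u1 v1 e" and tr1: "tr m e (G m, u1, v1, e) = (m, a', b', H e)" for e z u1 v1 a' b'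
  proof -
    have s1: "(G m, u1, v1, e) \<in> Arr (arrow_cat N)" using sq1 by (simp add: arrow_Arr)
    have [simp]: "e \<in> Arr N" using e by (simp add: NW.is_alg_iff)
    have s2: "(G j, u1 \<star> c, v1 \<star> T1 k, e) \<in> Hom (arrow_cat N) (G j) e"
      using aN.comp_arr(1)[OF G1A(1) s1] by (simp add: G1k Hom_def)
    have [simp]: "dM a' = dM j" "a' \<in> Arr M"
      using MW.arrow_elem(1,5)[OF A2.transp_arr(1)[OF s1, of m e]] by (simp_all add: tr1)
    have "tr j e (G j, u1 \<star> c, v1 \<star> T1 k, e) = tr m e (G m, u1, v1, e) \<odot> \<kappa>1"
      using A2.transp_nat_left[of \<kappa>1 "(G m, u1, v1, e)" e j m] s1 by (simp add: G1k)
    also have "\<dots> = (j, a', b' \<bullet> k, H e)" by (simp add: tr1 \<kappa>1_def)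
    finally show ?thesis using transpose_canonical(1)[OF j e s2] by simp
  qed
  have sqm1: "square M m (S1 f \<bullet> a) p (H g)"
    using A2.transp_arr(1)[of "(G m, f \<star> u, v, g)" m g] Sm'(11) by (simp add: trm arrow_Arr)
  have "ta (cM k) (dN g) m1 = MW.canonical (\<alpha> g s) x (m, S1 f \<bullet> a, p, H g)"
    unfolding m1_def trm[symmetric] using transpose_canonical(1)[OF mx gs arrow_HomI[OF Sm'(11)]] by simp
  also have "\<dots> = MW.canonical (\<alpha> g s) q (k, ta (cM j) (dN g) n1, p, H g)"
    unfolding comp1[OF gs sqm1] ell1[OF gs Sm'(11) trm] by (simp add: n1_def NW.assoc)
  also have "\<dots> = ta (cM k) (dN g) m1'"
    unfolding m1'_def trk[symmetric] using transpose_canonical(1)[OF k gs arrow_HomI[OF Sk'(11)]] by simp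
  finally have mm': "m1 = m1'" by (rule A.transp_eqD) simp_all
  have "solution M (k, ta (cM j) (dN g) n1, p, H g) (ta (cM k) (dN g) m1')"
    using solution_transp[OF _ _ arrow_HomI[OF Sk'(11)], of m1'] transpose_canonical(3)[OF k gs arrow_HomI[OF Sk'(11)]]
    by (simp add: trk m1'_def[symmetric] Hom_def)
  then have "ta (cM j) (dN g) n1 = ta (cM k) (dN g) m1' \<bullet> k" by (simp add: solution_def)
  also have "\<dots> = ta (cM j) (dN g) (m1' \<star> T1 k)"
    by (rule A.transp_nat_left[symmetric]) simp_all
  finally have n1: "m1' \<star> T1 k = n1"
    by (rule A.transp_eqD[symmetric]) simp_all
  \<comment> \<open>Against \<open>f\<close>, both ways leave the same problem for \<open>k\<close>, whose top is \<open>w\<close>.\<close>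
  have sq3: "square N (G k) u' m1' f" by (rule Sk'(12))
  have s3 [simp]: "(G k, u', m1', f) \<in> Arr (arrow_cat N)" using sq3 by (simp add: arrow_Arr)
  have gA [simp]: "(f, NW.I (dN f), g, gf) \<in> Arr (arrow_cat N)"
    by (simp add: arrow_Arr square_def gf_def)
  define p3 where "p3 = sq_bot (tr k f (G k, u', m1', f))"
  have tr3A: "tr k f (G k, u', m1', f) \<in> Arr (arrow_cat M)" by simp
  note [simp] = MW.arrow_elem[OF tr3A]
  have tr3: "tr k f (G k, u', m1', f) = (k, w, p3, H f)"
  proof -
    have "tr k gf ((f, NW.I (dN f), g, gf) \<otimes> (G k, u', m1', f)) = H1 (f, NW.I (dN f), g, gf) \<odot> tr k f (G k, u', m1', f)"
      by (rule A2.transp_nat_right) simp_all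
    then have "\<tau>' = H1 (f, NW.I (dN f), g, gf) \<odot> tr k f (G k, u', m1', f)"
      using tr' by simp
    then have "sq_top \<tau>' = sq_top (H1 (f, NW.I (dN f), g, gf) \<odot> tr k f (G k, u', m1', f))" by simp
    then have "w = sq_top (tr k f (G k, u', m1', f))"
      by (simp add: \<tau>'_def)
    then show ?thesis using sq_conv[of "tr k f (G k, u', m1', f)" M] by (simp add: p3_def)
  qed
  have trm2: "tr m f (G m, u, m1, f) = (m, a, p3, H f)"
  proof -
    have "tr m f ((G k, u', m1', f) \<otimes> G1 \<kappa>2) = tr k f (G k, u', m1', f) \<odot> \<kappa>2"
      by (rule A2.transp_nat_left) simp_all
    moreover have "p3 \<in> Arr M" "dM p3 = cM k" by (simp_all add: p3_def)
    moreover have "(G k, u', m1', f) \<otimes> G1 \<kappa>2 = (G m, u, m1, f)" by (simp add: G1k uu' mm')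
    ultimately show ?thesis by (simp add: tr3) (simp add: \<kappa>2_def wsol)
  qed
  have sqm2: "square M m a p3 (H f)"
    using A2.transp_arr(1)[of "(G m, u, m1, f)" m f] Sm'(12) by (simp add: trm2 arrow_Arr)
  have "ta (cM k) (dN f) (two_step m x f r g s u v) = MW.canonical (\<alpha> f r) x (m, a, p3, H f)"
    unfolding two_step_def m1_def[symmetric] trm2[symmetric]
    using transpose_canonical(1)[OF mx fr arrow_HomI[OF Sm'(12)]] by simp
  also have "\<dots> = MW.canonical (\<alpha> f r) q (k, w, p3, H f)"
    unfolding comp1[OF fr sqm2] ell1[OF fr Sm'(12) trm2]
    by (simp add: mm' n1 w_def w'_def two_step_def) (simp add: n1_def)
  also have "\<dots> = ta (cM k) (dN f) (two_step k q f r g s u' v')"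
    unfolding two_step_def m1'_def[symmetric] tr3[symmetric]
    using transpose_canonical(1)[OF k fr arrow_HomI[OF Sk'(12)]] by simp
  finally show ?thesis
    using \<theta>j by (simp add: \<theta>_def m_def[symmetric] gf_def[symmetric] x_def[symmetric] uv[unfolded \<tau>_def] uv'[unfolded \<tau>'_def])
qed


text \<open>The transposed two-step solutions form a lifting operation on \<open>H (g \<star> f)\<close>, hence come from an algebra
  structure \<open>r'\<close>. On the generating arrows they agree with \<open>\<alpha> (g \<star> f)\<close>, because the prescribed
  structures are coalgebras and so solve in two steps. As an algebra is determined by its solutions
  against the generating arrows, \<open>r'\<close> is \<open>\<alpha> (g \<star> f)\<close>, and the two ways of solving agree for all
  coalgebras.\<close>

lemma transpose_two_step:
  assumes j: "is_coalg M W j t" and fr: "is_alg N W' f r" and gs: "is_alg N W' g s"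
    and fg: "cN f = dN g" and sq: "square N (G j) u v (g \<star> f)"
  shows "ell j t (NW.comp_alg f r g s) (G j, u, v, g \<star> f) = two_step j t f r g s u v"
proof -
  define gf z where "gf = g \<star> f" and "z = NW.comp_alg f r g s"
  have gfz: "is_alg N W' gf z" unfolding gf_def z_def by (rule NW.comp_alg[OF fr gs fg])
  have [simp]: "f \<in> Arr N" "g \<in> Arr N" using fr gs by (simp_all add: NW.is_alg_iff)
  note [simp] = fg
  have gf [simp]: "gf \<in> Arr N" "dN gf = dN f" "cN gf = cN g" by (simp_all add: gf_def)
  define \<theta> where "\<theta> = (\<lambda>j t \<tau>. ta (cM j) (dN f) (two_step j t f r g s (sq_top (tri j gf \<tau>)) (sq_bot (tri j gf \<tau>))))"
  have \<theta>: "\<exists>u v. tri j gf \<tau> = (G j, u, v, gf) \<and> square N (G j) u v (g \<star> f) \<and>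
      tr j gf (G j, u, v, gf) = \<tau> \<and> \<theta> j t \<tau> = ta (cM j) (dN f) (two_step j t f r g s u v)"
    if \<tau>: "\<tau> \<in> Hom (arrow_cat M) j (H gf)" for j t \<tau>
  proof -
    obtain u v where uv: "tri j gf \<tau> = (G j, u, v, gf)" "square N (G j) u v gf"
      using tri_Hom[OF \<tau>] by (auto elim!: arrow_HomE)
    moreover have "tr j gf (tri j gf \<tau>) = \<tau>"
      using \<tau> by (intro A2.itransp_arr(4)) (auto simp: Hom_def)
    ultimately show ?thesis by (simp add: \<theta>_def gf_def[symmetric])
  qed
  obtain r' where r': "is_alg M W (H gf) r'"
    "\<And>j t \<tau>. is_coalg M W j t \<Longrightarrow> \<tau> \<in> Hom (arrow_cat M) j (H gf) \<Longrightarrow> \<theta> j t \<tau> = MW.canonical r' t \<tau>"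
  proof (rule MW.lifting_operation_alg[of "H gf" \<theta>])
    show "H gf \<in> Arr M" by simp
  next
    fix j t \<tau> assume j: "is_coalg M W j t" and \<tau>: "\<tau> \<in> Hom (arrow_cat M) j (H gf)"
    have [simp]: "j \<in> Arr M" using j by (simp add: MW.is_coalg_iff)
    obtain u v where uv: "square N (G j) u v (g \<star> f)"
      "tr j gf (G j, u, v, gf) = \<tau>" "\<theta> j t \<tau> = ta (cM j) (dN f) (two_step j t f r g s u v)"
      using \<theta>[OF \<tau>] by blast
    note S = two_step_solution[OF j fr gs fg uv(1)]
    show "solution M \<tau> (\<theta> j t \<tau>)"
      using solution_transp[of j gf "(G j, u, v, gf)" "two_step j t f r g s u v"] S(6-8,13) uv
      by (simp add: Hom_def arrow_Arr gf_def)
  next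
    fix j t k q \<kappa> \<tau>
    assume j: "is_coalg M W j t" and k: "is_coalg M W k q" and \<kappa>: "MW.coalg_map_sq j t \<kappa> k q"
      and \<tau>: "\<tau> \<in> Hom (arrow_cat M) k (H gf)"
    have kH: "\<kappa> \<in> Hom (arrow_cat M) j k" using \<kappa> by (simp add: MW.coalg_map_sq_def)
    then have kA [simp]: "\<kappa> \<in> Arr (arrow_cat M)" "Dom (arrow_cat M) \<kappa> = j" "Cod (arrow_cat M) \<kappa> = k"
      by (auto simp: Hom_def)
    note [simp] = MW.arrow_elem[OF kA(1), simplified kA(2,3)]
    obtain u v where uv: "tri k gf \<tau> = (G k, u, v, gf)" "square N (G k) u v (g \<star> f)"
       "\<theta> k q \<tau> = ta (cM k) (dN f) (two_step k q f r g s u v)"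
      using \<theta>[OF \<tau>] by blast
    note S = two_step_solution[OF k fr gs fg uv(2)]
    have "tri j gf (\<tau> \<odot> \<kappa>) = tri k gf \<tau> \<otimes> G1 \<kappa>"
      using \<tau> by (intro A2.itransp_nat_left) (auto simp: Hom_def)
    then have "sq_top (tri j gf (\<tau> \<odot> \<kappa>)) = u \<star> sq_top (G1 \<kappa>)" "sq_bot (tri j gf (\<tau> \<odot> \<kappa>)) = v \<star> T1 (sq_bot \<kappa>)"
      by (simp_all add: uv(1))
    then have "\<theta> j t (\<tau> \<odot> \<kappa>) = ta (cM j) (dN f) (two_step k q f r g s u v \<star> T1 (sq_bot \<kappa>))"
      by (simp add: \<theta>_def two_step_nat[OF j k \<kappa> fr gs fg uv(2)])
    also have "\<dots> = \<theta> k q \<tau> \<bullet> sq_bot \<kappa>"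
      unfolding uv(3) by (rule A.transp_nat_left) (simp_all add: S)
    finally show "\<theta> j t (\<tau> \<odot> \<kappa>) = \<theta> k q \<tau> \<bullet> sq_bot \<kappa>" .
  next
    fix j t k q a b
    assume "is_coalg M W j t" "is_coalg M W k q" "cM j = dM k" "square M (k \<bullet> j) a b (H gf)"
    then show "\<theta> (k \<bullet> j) (MW.comp_coalg j t k q) (k \<bullet> j, a, b, H gf) = \<theta> k q (k, \<theta> j t (j, a, b \<bullet> k, H gf), b, H gf)"
      unfolding \<theta>_def gf_def by (rule two_step_comp[OF _ _ _ fr gs fg])
  qed (rule that)
  have \<alpha>r': "\<alpha> gf z = r'"
  proof (rule \<alpha>_eqI[OF r'(1)])
    fix x \<tau> assume x: "x \<in> Obj J" and \<tau>: "\<tau> \<in> Hom (arrow_cat M) (omap U x) (H gf)"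
    note ux = MW.unit_obj(2)[OF x]
    obtain u v where uv: "tri (omap U x) gf \<tau> = (G (omap U x), u, v, gf)" "square N (G (omap U x)) u v (g \<star> f)"
       "\<theta> (omap U x) (MW.st x) \<tau> = ta (cM (omap U x)) (dN f) (two_step (omap U x) (MW.st x) f r g s u v)"
      using \<theta>[OF \<tau>] by blast
    have "NW.canonical z (st' x) (G (omap U x), u, v, gf) = two_step (omap U x) (MW.st x) f r g s u v"
      using NW.canonical_comp_alg[OF \<Phi>_obj(2)[OF x] fr gs fg uv(2)]
      by (simp add: two_step_def lam_unit[OF x] z_def gf_def)
    then show "MW.canonical r' (MW.st x) \<tau> = ta (cM (omap U x)) (dN gf) (NW.canonical z (st' x) (tri (omap U x) gf \<tau>))"
      using r'(2)[OF ux \<tau>] uv by simp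
  qed
  have [simp]: "j \<in> Arr M" using j by (simp add: MW.is_coalg_iff)
  have sH: "(G j, u, v, gf) \<in> Hom (arrow_cat N) (G j) gf"
    using sq by (intro arrow_HomI) (simp add: gf_def)
  have "tri j gf (tr j gf (G j, u, v, gf)) = (G j, u, v, gf)"
    using sH by (intro A2.itransp_transp) (auto simp: Hom_def)
  then have "\<theta> j t (tr j gf (G j, u, v, gf)) = ta (cM j) (dN f) (two_step j t f r g s u v)"
    by (simp add: \<theta>_def)
  moreover note r'(2)[OF j tr_Hom[OF sH]] transpose_canonical(1,2)[OF j gfz sH]
  ultimately have "ta (cM j) (dN f) (ell j t z (G j, u, v, gf)) = ta (cM j) (dN f) (two_step j t f r g s u v)"
    by (simp add: \<alpha>r')
  then have "ell j t z (G j, u, v, gf) = two_step j t f r g s u v"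
    using transpose_canonical(2)[OF j gfz sH] two_step_solution(6-8)[OF j fr gs fg sq]
    by (intro A.transp_eqD[of "cM j" "dN f"]) (auto simp: Hom_def)
  then show ?thesis by (simp add: gf_def z_def)
qed

subsection \<open>Lifting the left adjoint to coalgebras\<close>

text \<open>Since \<open>\<delta>\<close> is an algebra map into the composite of two free algebras, the coassociativity law is the
  two-step property for the problem \<open>(L (L f), 1)\<close> against that composite, where \<open>f = G j\<close>.\<close>

lemma lam_coalg:
  assumes j: "is_coalg M W j t"
  shows "is_coalg N W' (G j) (lam j \<star> T1 t)"
proof -
  note [simp] = j[unfolded MW.is_coalg_iff]
  define f s where "f = G j" and "s = lam j \<star> T1 t"
  have f [simp]: "f \<in> Arr N" "cN f = T (cM j)" by (simp_all add: f_def)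
  have s [simp]: "s \<in> Arr N" "dN s = T (cM j)" "cN s = E0 f" by (simp_all add: s_def f_def)
  have "solution N (eta N W' f) (ell j t (NW.\<mu> f) (eta N W' f))"
    using transpose_canonical(3)[OF j NW.free_alg, of f "eta N W' f"] eta_Hom[of f] by (simp add: f_def)
  then have "solution N (eta N W' f) s"
    using NW.canonical_eta[of f s] by (simp add: s_def f_def)
  then have sf [simp]: "s \<star> f = NW.L f" "NW.R f \<star> s = NW.I (cN f)"
    by (simp_all add: solution_def eta_def)
  have sqs [simp]: "square N f (NW.I (dN f)) s (NW.L f)" by (simp add: square_def)
  have sqL [simp]: "square N (NW.L f) (NW.L (NW.L f)) (NW.I (E0 f)) (NW.R (NW.L f))" by (simp add: square_def)
  have sqe [simp]: "square N f (NW.L f) (NW.I (T (cM j))) (NW.R f)" by (simp add: square_def)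
  define gf c where "gf = NW.R f \<star> NW.R (NW.L f)" and "c = NW.comp_alg (NW.R (NW.L f)) (NW.\<mu> (NW.L f)) (NW.R f) (NW.\<mu> f)"
  have gf [simp]: "gf \<in> Arr N" "dN gf = E0 (NW.L f)" "cN gf = T (cM j)" by (simp_all add: gf_def)
  have gfc: "is_alg N W' gf c"
    unfolding gf_def c_def by (rule NW.comp_alg) (simp_all add: NW.free_alg)
  have c [simp]: "c \<in> Arr N" "dN c = E0 gf" "cN c = E0 (NW.L f)" using gfc by (auto simp: NW.is_alg_iff)
  have gL: "gf \<star> NW.L (NW.L f) = f" by (simp add: gf_def NW.assoc)
  have g\<delta>: "gf \<star> NW.\<delta> f = NW.R f" by (simp add: gf_def NW.assoc NW.comult_laws)
  have sq\<delta> [simp]: "square N (NW.R f) (NW.\<delta> f) (NW.I (T (cM j))) gf" by (simp add: square_def g\<delta>)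
  have cE: "c \<star> NW.Mid (NW.R f) (NW.\<delta> f) (NW.I (T (cM j))) gf = NW.\<delta> f \<star> NW.\<mu> f"
    using NW.comult_alg_map[of f] by (simp add: NW.alg_map_sq_def gf_def[symmetric] c_def[symmetric])
  have sq0: "square N f (NW.L (NW.L f)) (NW.I (T (cM j))) gf" by (simp add: square_def gL)
  have "NW.\<delta> f \<star> s = NW.\<delta> f \<star> NW.\<mu> f \<star> NW.Mid f (NW.L f) (NW.I (T (cM j))) (NW.R f) \<star> s"
    using NW.canonical_eta[of f s] by (simp add: NW.canonical_def eta_def)
  also have "\<dots> = c \<star> NW.Mid (NW.R f) (NW.\<delta> f) (NW.I (T (cM j))) gf \<star> NW.Mid f (NW.L f) (NW.I (T (cM j))) (NW.R f) \<star> s"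
    using NW.comp_ext[OF cE] by (simp add: NW.assoc)
  also have "\<dots> = ell j t c (G j, NW.L (NW.L f), NW.I (T (cM j)), gf)"
    by (subst NW.Mid_comp_ext) (simp_all add: NW.canonical_def f_def[symmetric] s_def[symmetric])
  also have "\<dots> = two_step j t (NW.R (NW.L f)) (NW.\<mu> (NW.L f)) (NW.R f) (NW.\<mu> f) (NW.L (NW.L f)) (NW.I (T (cM j)))"
    unfolding c_def gf_def
    by (rule transpose_two_step[OF j]) (use sq0 in \<open>simp_all add: NW.free_alg f_def[symmetric] gf_def[symmetric]\<close>)
  also have "\<dots> = ell j t (NW.\<mu> (NW.L f)) (G j, NW.L (NW.L f), s, NW.R (NW.L f))"
    using NW.canonical_eta[of f s] by (simp add: two_step_def eta_def f_def[symmetric] s_def[symmetric])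
  also have "\<dots> = NW.\<mu> (NW.L f) \<star> NW.Mid (NW.L f) (NW.L (NW.L f)) (NW.I (E0 f)) (NW.R (NW.L f)) \<star> NW.Mid f (NW.I (dN f)) s (NW.L f) \<star> s"
    by (subst NW.Mid_comp_ext) (simp_all add: NW.canonical_def f_def[symmetric] s_def[symmetric])
  also have "\<dots> = NW.Mid f (NW.I (dN f)) s (NW.L f) \<star> s"
    using NW.comp_ext[OF NW.mult_laws(2)[of "NW.L f"]] by simp
  finally have "NW.\<delta> f \<star> s = NW.Mid f (NW.I (dN f)) s (NW.L f) \<star> s" .
  then show ?thesis
    unfolding f_def[symmetric] s_def[symmetric] by (simp add: NW.is_coalg_iff)
qed

lemma lam_coalg_map:
  assumes j: "is_coalg M W j t" and k: "is_coalg M W k q" and \<kappa>: "MW.coalg_map_sq j t \<kappa> k q"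
  shows "NW.coalg_map_sq (G j) (lam j \<star> T1 t) (G1 \<kappa>) (G k) (lam k \<star> T1 q)"
proof -
  note [simp] = j[unfolded MW.is_coalg_iff] k[unfolded MW.is_coalg_iff]
  have kH: "\<kappa> \<in> Hom (arrow_cat M) j k" and eq: "Q1 \<kappa> \<bullet> t = q \<bullet> sq_bot \<kappa>"
    using \<kappa> by (simp_all add: MW.coalg_map_sq_def)
  from kH have kA [simp]: "\<kappa> \<in> Arr (arrow_cat M)" "Dom (arrow_cat M) \<kappa> = j" "Cod (arrow_cat M) \<kappa> = k"
    by (auto simp: Hom_def)
  note [simp] = MW.arrow_elem[OF kA(1), simplified kA(2,3)]
  have "E1 (G1 \<kappa>) \<star> lam j \<star> T1 t = (E1 (G1 \<kappa>) \<star> lam j) \<star> T1 t" by (simp add: NW.assoc)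
  also have "\<dots> = lam k \<star> T1 (Q1 \<kappa> \<bullet> t)"
    by (simp add: lam_nat[OF kA, symmetric] NW.assoc A.F.amap_comp)
  also have "\<dots> = (lam k \<star> T1 q) \<star> T1 (sq_bot \<kappa>)"
    unfolding eq by (simp add: NW.assoc A.F.amap_comp)
  finally show ?thesis by (simp add: NW.coalg_map_sq_def Hom_def)
qed

end

section \<open>The adjunction of awfs and its uniqueness\<close>

lemma comp_is_functor:
  assumes "is_functor C D F" "is_functor D E G"
  shows "is_functor C E (comp_func G F)"
proof -
  interpret F: is_functor C D F by fact
  interpret G: is_functor D E G by fact
  show ?thesis
    by (rule is_functorI) (simp_all add: F.source.category_axioms G.target.category_axioms comp_func_def
        Hom_def F.amap_comp G.amap_comp)
qed

lemma structured_functor: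
  assumes F: "is_functor (arrow_cat M) (arrow_cat N) F"
    and C: "category (structured_cat M X P)" and D: "category (structured_cat N Y Q)"
    and obj: "\<And>x. x \<in> X \<Longrightarrow> fst x \<in> Arr M \<and> F0 x \<in> Y \<and> fst (F0 x) = omap F (fst x)"
    and arr: "\<And>x \<sigma> y. x \<in> X \<Longrightarrow> y \<in> X \<Longrightarrow> \<sigma> \<in> Hom (arrow_cat M) (fst x) (fst y) \<Longrightarrow> P x \<sigma> y \<Longrightarrow>
      Q (F0 x) (amap F \<sigma>) (F0 y)"
  shows "is_functor (structured_cat M X P) (structured_cat N Y Q)
    \<lparr>omap = F0, amap = (\<lambda>(x, \<sigma>, y). (F0 x, amap F \<sigma>, F0 y))\<rparr>"
proof -
  interpret F: is_functor "arrow_cat M" "arrow_cat N" F by fact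
  let ?F = "\<lparr>omap = F0, amap = \<lambda>(x, \<sigma>, y). (F0 x, amap F \<sigma>, F0 y)\<rparr>"
  let ?S = "structured_cat M X P" and ?S' = "structured_cat N Y Q"
  show ?thesis
  proof (rule is_functorI[OF C D])
    fix z assume "z \<in> Arr ?S"
    then obtain x \<sigma> y where z: "z = (x, \<sigma>, y)" "x \<in> X" "y \<in> X" "\<sigma> \<in> Hom (arrow_cat M) (fst x) (fst y)" "P x \<sigma> y"
      by (cases z) (auto simp: structured_cat_def)
    then show "amap ?F z
      \<in> Hom ?S' (omap ?F (Dom ?S z))
         (omap ?F (Cod ?S z))"
      using obj[OF z(2)] obj[OF z(3)] arr[OF z(2-5)] F.amap_Hom[OF z(4)]
      by (simp add: structured_cat_def Hom_def[of "\<lparr>Obj = _, Arr = _, Dom = _, Cod = _, Idt = _, Comp = _\<rparr>"])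
  next
    fix x assume "x \<in> Obj ?S"
    then have x: "x \<in> X" by (simp add: structured_cat_def)
    show "amap ?F (Idt ?S x)
       = Idt ?S' (omap ?F x)"
      using obj[OF x] F.amap_Idt[of "fst x"] by (simp add: structured_cat_def)
  next
    fix a b assume "a \<in> Arr ?S" "b \<in> Arr ?S"
      "Cod ?S a = Dom ?S b"
    then obtain x \<sigma> y \<tau> z where "a = (x, \<sigma>, y)" "b = (y, \<tau>, z)" "\<sigma> \<in> Hom (arrow_cat M) (fst x) (fst y)" "\<tau> \<in> Hom (arrow_cat M) (fst y) (fst z)"
      by (cases a; cases b) (auto simp: structured_cat_def)
    then show "amap ?F (b \<cdot>\<^bsub>?S\<^esub> a)
      = amap ?F b \<cdot>\<^bsub>?S'\<^esub>
        amap ?F a"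
      by (simp add: structured_cat_def F.amap_Comp)
  next
    fix x assume "x \<in> Obj ?S"
    then show "omap ?F x \<in> Obj ?S'"
      using obj by (simp add: structured_cat_def)
  qed
qed

lemma (in adj_on) counit_transp:
  assumes "h \<in> Arr D" "Dom D h = omap (ladj A) c" "Cod D h = d" "c \<in> Obj C"
  shows "adj_counit C D A d \<cdot>\<^bsub>D\<^esub> amap (ladj A) (transp A c d h) = h"
proof -
  have d: "d \<in> Obj D" using assms by auto
  have "itransp c d (Idt C (omap (radj A) d) \<cdot>\<^bsub>C\<^esub> transp A c d h)
    = itransp (omap (radj A) d) d (Idt C (omap (radj A) d)) \<cdot>\<^bsub>D\<^esub> amap (ladj A) (transp A c d h)"
    by (rule itransp_nat_left) (use assms d in simp_all)
  then show ?thesis using assms d by (simp add: counit_def')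
qed

lemma (in generated) unit_on_arr:
  assumes "y \<in> Arr J"
  shows "amap \<upsilon> y = (omap \<upsilon> (Dom J y), amap U y, omap \<upsilon> (Cod J y))"
proof -
  interpret P: is_functor J "coalg_cat M W" \<upsilon> by (rule unit_functor)
  obtain a \<sigma> b where y: "amap \<upsilon> y = (a, \<sigma>, b)" by (metis surj_pair)
  have "a = omap \<upsilon> (Dom J y)" "b = omap \<upsilon> (Cod J y)"
    using P.amap_arr(2,3)[OF assms] by (auto simp: y coalg_cat_def structured_cat_def)
  moreover have "\<sigma> = amap U y"
    using unit_over assms by (auto simp: func_eq_def comp_func_def forget_def y)
  ultimately show ?thesis using y by simp
qed

context awfs_on
begin

lemma coalg_map_sq_iff:
  assumes "is_coalg M W j t" "is_coalg M W k s" "\<sigma> \<in> Hom (arrow_cat M) j k"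
  shows "amap (Lfun W) \<sigma> \<cdot>\<^bsub>arrow_cat M\<^esub> coalg_sq M W (j, t) = coalg_sq M W (k, s) \<cdot>\<^bsub>arrow_cat M\<^esub> \<sigma>
    \<longleftrightarrow> coalg_map_sq j t \<sigma> k s"
proof -
  obtain u v where s: "\<sigma> = (j, u, v, k)" "square M j u v k"
    using assms(3) by (rule arrow_HomE)
  have "u \<in> Arr M" "dm u = dm j" "cd u = dm k" using s(2) by (auto simp: square_def)
  then show ?thesis using s(2) by (simp add: s(1) coalg_map_sq_def coalg_sq_def arrow_Hom_iff)
qed

lemma coalg_obj:
  "x \<in> {x. coalgebra (arrow_cat M) (Lfun W) (eps M W) (delta M W) (fst x) (coalg_sq M W x)}
     \<longleftrightarrow> is_coalg M W (fst x) (snd x)"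
  by (simp add: is_coalg_def coalg_cat_def structured_cat_def)

lemma alg_obj:
  "x \<in> {x. algebra (arrow_cat M) (Rfun W) (eta M W) (mu M W) (fst x) (alg_sq M W x)}
     \<longleftrightarrow> is_alg M W (fst x) (snd x)"
  by (simp add: is_alg_def alg_cat_def structured_cat_def)

end

context lifting_adjunction
begin

lemma lift_coalg_functor: "is_functor (coalg_cat M W) (coalg_cat N W') (lift_coalg N A2 A lam)"
proof -
  let ?F = "\<lambda>(j, t). (G j, lam j \<star> T1 t)"
  have 1: "category (coalg_cat M W)" "category (coalg_cat N W')"
    using MW.unit_functor \<Phi>_functor by (simp_all add: is_functor_def)
  have 2: "lift_coalg N A2 A lam = \<lparr>omap = ?F,
     amap = \<lambda>(x, \<sigma>, y). (?F x, G1 \<sigma>, ?F y)\<rparr>"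
    by (simp add: lift_coalg_def Let_def)
  show ?thesis unfolding 2 coalg_cat_def
  proof (rule structured_functor[OF A2.F.is_functor_axioms 1[unfolded coalg_cat_def]], unfold MW.coalg_obj NW.coalg_obj)
    fix x assume "is_coalg M W (fst x) (snd x)"
    then show "fst x \<in> Arr M \<and> is_coalg N W' (fst (?F x))
         (snd (?F x)) \<and> fst (?F x) = G (fst x)"
      using lam_coalg[of "fst x" "snd x"] by (simp add: split_beta MW.is_coalg_iff)
  next
    fix x \<sigma> y
    assume x: "is_coalg M W (fst x) (snd x)" and y: "is_coalg M W (fst y) (snd y)"
      and s: "\<sigma> \<in> Hom (arrow_cat M) (fst x) (fst y)"
      and eq: "amap (Lfun W) \<sigma> \<odot> coalg_sq M W x = coalg_sq M W y \<odot> \<sigma>"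
    have "MW.coalg_map_sq (fst x) (snd x) \<sigma> (fst y) (snd y)"
      using MW.coalg_map_sq_iff[OF x y s] eq by simp
    from lam_coalg_map[OF x y this]
    show "amap (Lfun W') (G1 \<sigma>) \<otimes> coalg_sq N W' (?F x)
      = coalg_sq N W' (?F y) \<otimes> G1 \<sigma>"
      using NW.coalg_map_sq_iff[OF lam_coalg[OF x] lam_coalg[OF y], of "G1 \<sigma>"]
      by (simp add: split_beta NW.coalg_map_sq_def)
  qed
qed

lemma lift_alg_functor: "is_functor (alg_cat N W') (alg_cat M W) (lift_alg M A2 A \<rho>)"
proof -
  let ?F = "\<lambda>(f, t). (H f, S1 t \<bullet> \<rho> f)"
  have 2: "lift_alg M A2 A \<rho> = \<lparr>omap = ?F,
     amap = \<lambda>(x, \<sigma>, y). (?F x, H1 \<sigma>, ?F y)\<rparr>"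
    by (simp add: lift_alg_def Let_def)
  show ?thesis unfolding 2 alg_cat_def
  proof (rule structured_functor[OF A2.R.is_functor_axioms NW.alg_category[unfolded alg_cat_def] MW.alg_category[unfolded alg_cat_def]],
      unfold MW.alg_obj NW.alg_obj)
    fix x assume x: "is_alg N W' (fst x) (snd x)"
    then show "fst x \<in> Arr N \<and> is_alg M W (fst (?F x))
         (snd (?F x)) \<and> fst (?F x) = H (fst x)"
      using \<alpha>(1)[OF x] by (simp add: split_beta NW.is_alg_iff \<rho>_alg[OF x])
  next
    fix x \<sigma> y
    assume x: "is_alg N W' (fst x) (snd x)" and y: "is_alg N W' (fst y) (snd y)"
      and s: "\<sigma> \<in> Hom (arrow_cat N) (fst x) (fst y)"
      and eq: "alg_sq N W' y \<otimes> amap (Rfun W') \<sigma> = \<sigma> \<otimes> alg_sq N W' x"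
    have "NW.alg_map_sq (fst x) (snd x) \<sigma> (fst y) (snd y)"
      using NW.alg_map_sq_iff[OF x y s] eq by simp
    from \<alpha>_map[OF x y this]
    show "alg_sq M W (?F y) \<odot> amap (Rfun W) (H1 \<sigma>)
      = H1 \<sigma> \<odot> alg_sq M W (?F x)"
      using MW.alg_map_sq_iff[OF \<alpha>(1)[OF x] \<alpha>(1)[OF y], of "H1 \<sigma>"]
      by (simp add: split_beta MW.alg_map_sq_def \<rho>_alg[OF x] \<rho>_alg[OF y])
  qed
qed

lemma TQ_functor: "is_functor (arrow_cat M) N (comp_func (ladj A) (mid W))"
  and EG_functor: "is_functor (arrow_cat M) N (comp_func (mid W') (ladj A2))"
  and QH_functor: "is_functor (arrow_cat N) M (comp_func (mid W) (radj A2))"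
  and SE_functor: "is_functor (arrow_cat N) M (comp_func (radj A) (mid W'))"
  by (rule comp_is_functor[OF Q.is_functor_axioms A.F.is_functor_axioms]
    comp_is_functor[OF A2.F.is_functor_axioms E.is_functor_axioms]
    comp_is_functor[OF A2.R.is_functor_axioms Q.is_functor_axioms]
    comp_is_functor[OF E.is_functor_axioms A.R.is_functor_axioms])+

lemma mates_lam_\<rho>: "mates (arrow_cat M) (arrow_cat N) A2 M N A (mid W) (mid W') lam \<rho>"
proof -
  have "nat_trans (arrow_cat M) N (comp_func (ladj A) (mid W)) (comp_func (mid W') (ladj A2)) lam"
    using TQ_functor EG_functor lam_nat by (simp add: nat_trans_def comp_func_def Hom_def)
  moreover have "nat_trans (arrow_cat N) M (comp_func (mid W) (radj A2)) (comp_func (radj A) (mid W')) \<rho>"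
    using QH_functor SE_functor \<rho>_nat by (simp add: nat_trans_def comp_func_def Hom_def)
  moreover have "\<rho> f = (S1 (E1 (adj_counit (arrow_cat M) (arrow_cat N) A2 f)) \<bullet> S1 (lam (H f))) \<bullet> adj_unit N A (Q0 (H f))"
    if f: "f \<in> Arr N" for f
  proof -
    let ?e = "adj_counit (arrow_cat M) (arrow_cat N) A2 f"
    note [simp] = f
    have "(S1 (E1 ?e) \<bullet> S1 (lam (H f))) \<bullet> adj_unit N A (Q0 (H f))
      = S1 (E1 ?e) \<bullet> ta (Q0 (H f)) (E0 (G (H f))) (lam (H f))"
      by (subst A.transp_unit) (simp_all add: MW.assoc)
    also have "\<dots> = (S1 (E1 ?e) \<bullet> \<rho> (G (H f))) \<bullet> Q1 (unit2 (H f))"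
      by (simp add: MW.assoc)
    also have "\<dots> = \<rho> f \<bullet> Q1 (H1 ?e \<odot> unit2 (H f))"
      by (simp add: \<rho>_nat MW.assoc Q.amap_comp)
    also have "\<dots> = \<rho> f"
      using Q.amap_idt[of "H f"] by (subst A2.triangle_radj) (simp_all del: arrow_sel(4))
    finally show ?thesis by simp
  qed
  ultimately show ?thesis by (simp add: mates_def)
qed

lemma awfs_adjunction_lam_\<rho>: "awfs_adjunction M W N W' A2 A lam \<rho>"
  unfolding awfs_adjunction_def using mates_lam_\<rho> lift_coalg_functor lift_alg_functor by blast

lemma lift_coalg_unit: "func_eq J \<Phi> (comp_func (lift_coalg N A2 A lam) \<upsilon>)"
proof -
  have obj: "omap \<Phi> x = omap (lift_coalg N A2 A lam) (omap \<upsilon> x)" if x: "x \<in> Obj J" for x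
    by (subst MW.unit_obj(1)[OF x], subst \<Phi>_obj(1)[OF x]) (simp add: lift_coalg_def Let_def lam_unit[OF x])
  have arr: "amap \<Phi> y = amap (lift_coalg N A2 A lam) (amap \<upsilon> y)" if y: "y \<in> Arr J" for y
  proof -
    have "Dom J y \<in> Obj J" "Cod J y \<in> Obj J" using y by auto
    then show ?thesis
      using obj by (simp add: \<Phi>_arr(1)[OF y] MW.unit_on_arr[OF y]) (simp add: lift_coalg_def Let_def)
  qed
  show ?thesis using obj arr by (simp add: func_eq_def comp_func_def)
qed

text \<open>For any adjunction of awfs inducing \<open>\<Phi>\<close>, the structure on \<open>H f\<close> that it induces from an algebra
  \<open>(f, z)\<close> has the same solutions against the generating arrows as \<open>\<alpha> f z\<close>, by the mate relation. So
  the lifts to algebras agree, and they determine \<open>r\<close>, which determines \<open>l\<close>.\<close>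

lemma awfs_adjunction_unique:
  assumes adj: "awfs_adjunction M W N W' A2 A l r"
    and \<Phi>: "func_eq J \<Phi> (comp_func (lift_coalg N A2 A l) \<upsilon>)"
  shows "\<And>j. j \<in> Arr M \<Longrightarrow> l j = lam j" "\<And>f. f \<in> Arr N \<Longrightarrow> r f = \<rho> f"
proof -
  let ?e = "adj_counit (arrow_cat M) (arrow_cat N) A2"
  have mates: "mates (arrow_cat M) (arrow_cat N) A2 M N A (mid W) (mid W') l r"
    and alg: "is_functor (alg_cat N W') (alg_cat M W) (lift_alg M A2 A r)"
    using adj by (auto simp: awfs_adjunction_def)
  have l [simp]: "l j \<in> Arr N" "dN (l j) = T (Q0 j)" "cN (l j) = E0 (G j)" if "j \<in> Arr M" for j
    using mates that by (auto simp: mates_def nat_trans_def comp_func_def Hom_def)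
  have r [simp]: "r f \<in> Arr M" "dM (r f) = Q0 (H f)" "cM (r f) = S (E0 f)" if "f \<in> Arr N" for f
    using mates that by (auto simp: mates_def nat_trans_def comp_func_def Hom_def)
  have l_nat: "E1 (G1 \<sigma>) \<star> l (Dom (arrow_cat M) \<sigma>) = l (Cod (arrow_cat M) \<sigma>) \<star> T1 (Q1 \<sigma>)"
    if "\<sigma> \<in> Arr (arrow_cat M)" for \<sigma>
    using mates that by (simp add: mates_def nat_trans_def comp_func_def)
  have r_nat: "S1 (E1 \<sigma>) \<bullet> r (Dom (arrow_cat N) \<sigma>) = r (Cod (arrow_cat N) \<sigma>) \<bullet> Q1 (H1 \<sigma>)"
    if "\<sigma> \<in> Arr (arrow_cat N)" for \<sigma>
    using mates that by (simp add: mates_def nat_trans_def comp_func_def)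
  have r_eq: "r f = ta (Q0 (H f)) (E0 f) (E1 (?e f) \<star> l (H f))" if f: "f \<in> Arr N" for f
  proof -
    have "r f = (S1 (E1 (?e f)) \<bullet> S1 (l (H f))) \<bullet> adj_unit N A (Q0 (H f))"
      using mates f by (simp add: mates_def)
    also have "\<dots> = ta (Q0 (H f)) (E0 f) (E1 (?e f) \<star> l (H f))"
      using f by (subst A.transp_unit) (simp_all add: A.R.amap_comp)
    finally show ?thesis .
  qed
  have r_tr: "r f \<bullet> Q1 (tr j f \<sigma>) = ta (Q0 j) (E0 f) (E1 \<sigma> \<star> l j)"
    if s: "\<sigma> \<in> Hom (arrow_cat N) (G j) f" and j [simp]: "j \<in> Arr M" for j f \<sigma>
  proof -
    have s' [simp]: "\<sigma> \<in> Arr (arrow_cat N)" "Dom (arrow_cat N) \<sigma> = G j" "Cod (arrow_cat N) \<sigma> = f"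
      using s by (auto simp: Hom_def)
    have f [simp]: "f \<in> Arr N" using NW.arrow_elem(4)[OF s'(1)] by simp
    have "r f \<bullet> Q1 (tr j f \<sigma>) = ta (Q0 j) (E0 f) ((E1 (?e f) \<star> l (H f)) \<star> T1 (Q1 (tr j f \<sigma>)))"
      unfolding r_eq[OF f] by (rule A.transp_nat_left[symmetric]) simp_all
    also have "(E1 (?e f) \<star> l (H f)) \<star> T1 (Q1 (tr j f \<sigma>)) = (E1 (?e f) \<star> E1 (G1 (tr j f \<sigma>))) \<star> l j"
      using l_nat[of "tr j f \<sigma>"] by (simp add: NW.assoc)
    also have "E1 (?e f) \<star> E1 (G1 (tr j f \<sigma>)) = E1 \<sigma>"
      using A2.counit_transp[of \<sigma> j f] by (simp add: E.amap_comp[symmetric])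
    finally show ?thesis .
  qed
  have lU: "l (omap U x) \<star> T1 (MW.st x) = st' x" if x: "x \<in> Obj J" for x
  proof -
    have "omap \<Phi> x = omap (lift_coalg N A2 A l) (omap U x, MW.st x)"
      using \<Phi> x MW.unit_obj(1)[OF x] by (simp add: func_eq_def comp_func_def)
    then show ?thesis using \<Phi>_obj(1)[OF x] by (simp add: lift_coalg_def Let_def)
  qed
  have r_alg: "S1 z \<bullet> r f = \<alpha> f z" if fz: "is_alg N W' f z" for f z
  proof (rule \<alpha>_eqI[symmetric])
    note [simp] = fz[unfolded NW.is_alg_iff]
    show "is_alg M W (H f) (S1 z \<bullet> r f)"
      using is_functor.omap_obj[OF alg, of "(f, z)"] fz by (simp add: is_alg_def lift_alg_def Let_def)
    fix x \<tau> assume x: "x \<in> Obj J" and \<tau>: "\<tau> \<in> Hom (arrow_cat M) (omap U x) (H f)"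
    note [simp] = MW.unit_obj(2)[OF x, unfolded MW.is_coalg_iff]
    let ?j = "omap U x" and ?\<sigma> = "tri (omap U x) f \<tau>"
    have t' [simp]: "\<tau> \<in> Arr (arrow_cat M)" "Dom (arrow_cat M) \<tau> = ?j" "Cod (arrow_cat M) \<tau> = H f"
      using \<tau> by (auto simp: Hom_def)
    have s: "?\<sigma> \<in> Hom (arrow_cat N) (G ?j) f" using tri_Hom[OF \<tau>] by simp
    have "MW.canonical (S1 z \<bullet> r f) (MW.st x) \<tau> = S1 z \<bullet> ((r f \<bullet> Q1 (tr ?j f ?\<sigma>)) \<bullet> MW.st x)"
      by (simp add: MW.canonical_def MW.assoc)
    also have "\<dots> = S1 z \<bullet> ta (cM ?j) (E0 f) ((E1 ?\<sigma> \<star> l ?j) \<star> T1 (MW.st x))"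
      unfolding r_tr[OF s MW.unit_obj(3)[OF x]]
      by (subst A.transp_nat_left[of _ _ _ _ "Q0 ?j"]) simp_all
    also have "\<dots> = ta (cM ?j) (dN f) (z \<star> ((E1 ?\<sigma> \<star> l ?j) \<star> T1 (MW.st x)))"
      by (rule A.transp_nat_right[symmetric]) simp_all
    also have "z \<star> ((E1 ?\<sigma> \<star> l ?j) \<star> T1 (MW.st x)) = NW.canonical z (st' x) ?\<sigma>"
      by (simp add: NW.canonical_def NW.assoc lU[OF x])
    finally show "MW.canonical (S1 z \<bullet> r f) (MW.st x) \<tau> = ta (cM ?j) (dN f) (NW.canonical z (st' x) ?\<sigma>)" .
  qed
  show r\<rho>: "r f = \<rho> f" if f [simp]: "f \<in> Arr N" for f
  proof -
    have "NW.\<mu> f \<star> E1 (eta N W' f) = NW.I (E0 f)"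
      by (simp add: eta_def NW.mult_laws)
    then have "S1 (NW.\<mu> f) \<bullet> S1 (E1 (eta N W' f)) = MW.I (S (E0 f))"
      using A.R.amap_comp[of "E1 (eta N W' f)" "NW.\<mu> f"] by simp
    then have "r f = (S1 (NW.\<mu> f) \<bullet> S1 (E1 (eta N W' f))) \<bullet> r f" by simp
    also have "\<dots> = (S1 (NW.\<mu> f) \<bullet> r (NW.R f)) \<bullet> Q1 (H1 (eta N W' f))"
      using r_nat[of "eta N W' f"] by (simp add: MW.assoc)
    finally show ?thesis by (simp add: r_alg[OF NW.free_alg] \<rho>_def)
  qed
  show "l j = lam j" if j [simp]: "j \<in> Arr M" for j
  proof -
    have i: "Idt (arrow_cat N) (G j) \<in> Hom (arrow_cat N) (G j) (G j)"
      by (rule aN.Idt_Hom) simp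
    have "E1 (Idt (arrow_cat N) (G j)) = NW.I (E0 (G j))" using E.amap_idt[of "G j"] by simp
    then have "ta (Q0 j) (E0 (G j)) (l j) = ta (Q0 j) (E0 (G j)) (lam j)"
      using r_tr[OF i j] \<rho>_tr[OF i j] by (simp add: r\<rho> del: arrow_sel(4) lam_arr(4))
    then show ?thesis by (rule A.transp_eqD) simp_all
  qed
qed

lemma unique_awfs_adjunction:
  "\<exists>!(l, r). l \<in> extensional (Arr M) \<and> r \<in> extensional (Arr N) \<and>
     awfs_adjunction M W N W' A2 A l r \<and> func_eq J \<Phi> (comp_func (lift_coalg N A2 A l) \<upsilon>)"
proof -
  have "lam \<in> extensional (Arr M)" "\<rho> \<in> extensional (Arr N)" by (simp_all add: lam_def \<rho>_def)
  then show ?thesis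
    using awfs_adjunction_lam_\<rho> lift_coalg_unit
    by (intro ex1I[of _ "(lam, \<rho>)"])
      (auto intro: extensionalityI dest: awfs_adjunction_unique)
qed

end

section \<open>The three forms of adjunction transport lifting problems\<close>

lemma adjunctionI:
  assumes "is_functor C D (ladj A)" "is_functor D C (radj A)"
    and "\<And>c d h. c \<in> Obj C \<Longrightarrow> d \<in> Obj D \<Longrightarrow> h \<in> Hom D (omap (ladj A) c) d \<Longrightarrow>
      transp A c d h \<in> Hom C c (omap (radj A) d)"
    and "\<And>c d h h'. c \<in> Obj C \<Longrightarrow> d \<in> Obj D \<Longrightarrow> h \<in> Hom D (omap (ladj A) c) d \<Longrightarrow>
      h' \<in> Hom D (omap (ladj A) c) d \<Longrightarrow> transp A c d h = transp A c d h' \<Longrightarrow> h = h'"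
    and "\<And>c d k. c \<in> Obj C \<Longrightarrow> d \<in> Obj D \<Longrightarrow> k \<in> Hom C c (omap (radj A) d) \<Longrightarrow>
      \<exists>h\<in>Hom D (omap (ladj A) c) d. transp A c d h = k"
    and "\<And>a b h. a \<in> Arr C \<Longrightarrow> b \<in> Arr D \<Longrightarrow> h \<in> Hom D (omap (ladj A) (Cod C a)) (Dom D b) \<Longrightarrow>
      transp A (Dom C a) (Cod D b) (b \<cdot>\<^bsub>D\<^esub> h \<cdot>\<^bsub>D\<^esub> amap (ladj A) a)
          = amap (radj A) b \<cdot>\<^bsub>C\<^esub> transp A (Cod C a) (Dom D b) h \<cdot>\<^bsub>C\<^esub> a"
  shows "adjunction C D A"
proof -
  have "bij_betw (transp A c d) (Hom D (omap (ladj A) c) d) (Hom C c (omap (radj A) d))"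
    if "c \<in> Obj C" "d \<in> Obj D" for c d
    unfolding bij_betw_def
  proof
    show "inj_on (transp A c d) (Hom D (omap (ladj A) c) d)"
      using assms(4)[OF that] by (auto intro: inj_onI)
    show "transp A c d ` Hom D (omap (ladj A) c) d = Hom C c (omap (radj A) d)"
    proof (intro equalityI subsetI)
      fix k assume "k \<in> transp A c d ` Hom D (omap (ladj A) c) d"
      then show "k \<in> Hom C c (omap (radj A) d)" using assms(3)[OF that] by auto
    next
      fix k assume "k \<in> Hom C c (omap (radj A) d)"
      from assms(5)[OF that this] show "k \<in> transp A c d ` Hom D (omap (ladj A) c) d" by auto
    qed
  qed
  then show ?thesis using assms(1,2,6) unfolding adjunction_def by auto
qed

lemma (in is_functor) square_amap:
  assumes "square C f u v g"
  shows "square D (amap F f) (amap F u) (amap F v) (amap F g)"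
  using assms by (auto simp: square_def amap_comp[symmetric])

lemma arrow_func_functor:
  assumes "is_functor C D F"
  shows "is_functor (arrow_cat C) (arrow_cat D) (arrow_func F)"
proof -
  interpret F: is_functor C D F by fact
  show ?thesis
  proof (rule is_functorI[OF F.source.arrow_category F.target.arrow_category])
    fix \<sigma> \<tau> assume "\<sigma> \<in> Arr (arrow_cat C)" "\<tau> \<in> Arr (arrow_cat C)" "Cod (arrow_cat C) \<sigma> = Dom (arrow_cat C) \<tau>"
    then show "amap (arrow_func F) (\<tau> \<cdot>\<^bsub>arrow_cat C\<^esub> \<sigma>) = amap (arrow_func F) \<tau> \<cdot>\<^bsub>arrow_cat D\<^esub> amap (arrow_func F) \<sigma>"
      by (cases \<sigma>; cases \<tau>) (simp add: arrow_func_def arrow_Arr square_def F.amap_comp)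
  next
    fix \<sigma> assume "\<sigma> \<in> Arr (arrow_cat C)"
    then show "amap (arrow_func F) \<sigma> \<in> Hom (arrow_cat D) (omap (arrow_func F) (Dom (arrow_cat C) \<sigma>))
        (omap (arrow_func F) (Cod (arrow_cat C) \<sigma>))"
      by (cases \<sigma>) (simp add: arrow_func_def arrow_Arr arrow_Hom_iff F.square_amap)
  qed (simp_all add: arrow_func_def)
qed

text \<open>For \<open>T\<^sup>2 \<stileturn> S\<^sup>2\<close> everything is transposed componentwise along \<open>T \<stileturn> S\<close>, and a solution is given by
  two equations, which transpose separately.\<close>

lemma arrow_form_lifting:
  assumes "arrow_form M N A2 A"
  shows "lifting_adj M N A2 A"
proof -
  have adj: "adjunction M N A" and A2: "A2 = arrow_adj M N A"
    using assms by (auto simp: arrow_form_def)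
  interpret A: adj_on M N A by (unfold_locales) (rule adj)
  let ?T = "amap (ladj A)" and ?S = "amap (radj A)"
  have tr: "transp A2 j f (e, u, v, g) = (j, transp A (Dom M j) (Dom N f) u, transp A (Cod M j) (Cod N f) v, ?S f)" for j f e u v g
    by (simp add: A2 arrow_adj_def)
  have sel: "ladj A2 = arrow_func (ladj A)" "radj A2 = arrow_func (radj A)"
    "omap (arrow_func F) = amap F" "amap (arrow_func F) (f, u, v, g) = (amap F f, amap F u, amap F v, amap F g)" for F :: "('e,'f,'g,'h) func" and f u v g
    by (simp_all add: A2 arrow_adj_def arrow_func_def)
  have eqs: "transp A (Dom M j) (Cod N f) (f \<cdot>\<^bsub>N\<^esub> u) = ?S f \<cdot>\<^bsub>M\<^esub> transp A (Dom M j) (Dom N f) u"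
      "transp A (Dom M j) (Cod N f) (v \<cdot>\<^bsub>N\<^esub> ?T j) = transp A (Cod M j) (Cod N f) v \<cdot>\<^bsub>M\<^esub> j"
    if "j \<in> Arr M" "f \<in> Arr N" "u \<in> Hom N (omap (ladj A) (Dom M j)) (Dom N f)" "v \<in> Hom N (omap (ladj A) (Cod M j)) (Cod N f)"
    for j f u v
    using that by (auto simp: Hom_def intro!: A.transp_nat_left A.transp_nat_right)
  have sq_iff: "square N (?T j) u v f \<longleftrightarrow> square M j (transp A (Dom M j) (Dom N f) u) (transp A (Cod M j) (Cod N f) v) (?S f)"
    if jf: "j \<in> Arr M" "f \<in> Arr N" and uv: "u \<in> Hom N (omap (ladj A) (Dom M j)) (Dom N f)" "v \<in> Hom N (omap (ladj A) (Cod M j)) (Cod N f)"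
    for j f u v
  proof
    assume "square N (?T j) u v f"
    then show "square M j (transp A (Dom M j) (Dom N f) u) (transp A (Cod M j) (Cod N f) v) (?S f)"
      using jf uv eqs[OF jf uv] by (auto simp: square_def Hom_def)
  next
    assume "square M j (transp A (Dom M j) (Dom N f) u) (transp A (Cod M j) (Cod N f) v) (?S f)"
    then have "transp A (Dom M j) (Cod N f) (f \<cdot>\<^bsub>N\<^esub> u) = transp A (Dom M j) (Cod N f) (v \<cdot>\<^bsub>N\<^esub> ?T j)"
      using eqs[OF jf uv] by (simp add: square_def)
    then have "f \<cdot>\<^bsub>N\<^esub> u = v \<cdot>\<^bsub>N\<^esub> ?T j"
      by (rule A.transp_eqD) (use jf uv in \<open>auto simp: Hom_def\<close>)
    then show "square N (?T j) u v f" using jf uv by (auto simp: square_def Hom_def)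
  qed
  have adj2: "adjunction (arrow_cat M) (arrow_cat N) A2"
  proof (rule adjunctionI)
    show "is_functor (arrow_cat M) (arrow_cat N) (ladj A2)" "is_functor (arrow_cat N) (arrow_cat M) (radj A2)"
      by (simp_all add: sel(1,2) arrow_func_functor A.F.is_functor_axioms A.R.is_functor_axioms)
  next
    fix j f \<sigma> assume jf: "j \<in> Obj (arrow_cat M)" "f \<in> Obj (arrow_cat N)" and "\<sigma> \<in> Hom (arrow_cat N) (omap (ladj A2) j) f"
    then obtain u v where s: "\<sigma> = (?T j, u, v, f)" "square N (?T j) u v f"
      by (auto elim!: arrow_HomE simp: sel)
    moreover from s jf have "u \<in> Hom N (omap (ladj A) (Dom M j)) (Dom N f)" "v \<in> Hom N (omap (ladj A) (Cod M j)) (Cod N f)"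
      by (auto simp: square_def Hom_def)
    ultimately show "transp A2 j f \<sigma> \<in> Hom (arrow_cat M) j (omap (radj A2) f)"
      using sq_iff jf by (simp add: tr sel arrow_Hom_iff)
  next
    fix j f \<sigma> \<sigma>' assume jf: "j \<in> Obj (arrow_cat M)" "f \<in> Obj (arrow_cat N)"
      and "\<sigma> \<in> Hom (arrow_cat N) (omap (ladj A2) j) f" "\<sigma>' \<in> Hom (arrow_cat N) (omap (ladj A2) j) f"
      and eq: "transp A2 j f \<sigma> = transp A2 j f \<sigma>'"
    then obtain u v u' v' where s: "\<sigma> = (?T j, u, v, f)" "square N (?T j) u v f" "\<sigma>' = (?T j, u', v', f)" "square N (?T j) u' v' f"
      by (auto elim!: arrow_HomE simp: sel)
    have "u = u'" by (rule A.transp_eqD[of "Dom M j" "Dom N f"]) (use s jf eq in \<open>auto simp: tr square_def\<close>)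
    moreover have "v = v'" by (rule A.transp_eqD[of "Cod M j" "Cod N f"]) (use s jf eq in \<open>auto simp: tr square_def\<close>)
    ultimately show "\<sigma> = \<sigma>'" by (simp add: s)
  next
    fix j f \<tau> assume jf: "j \<in> Obj (arrow_cat M)" "f \<in> Obj (arrow_cat N)" and "\<tau> \<in> Hom (arrow_cat M) j (omap (radj A2) f)"
    then obtain a b where t: "\<tau> = (j, a, b, ?S f)" "square M j a b (?S f)"
      by (auto elim!: arrow_HomE simp: sel)
    define u v where "u = A.itransp (Dom M j) (Dom N f) a" and "v = A.itransp (Cod M j) (Cod N f) b"
    have uv: "u \<in> Hom N (omap (ladj A) (Dom M j)) (Dom N f)" "v \<in> Hom N (omap (ladj A) (Cod M j)) (Cod N f)"
        "transp A (Dom M j) (Dom N f) u = a" "transp A (Cod M j) (Cod N f) v = b"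
      using t jf by (auto simp: u_def v_def square_def Hom_def)
    then have "square N (?T j) u v f" using sq_iff[of j f u v] t jf by simp
    then show "\<exists>\<sigma>\<in>Hom (arrow_cat N) (omap (ladj A2) j) f. transp A2 j f \<sigma> = \<tau>"
      using uv by (intro bexI[of _ "(?T j, u, v, f)"]) (auto simp: tr t sel arrow_Hom_iff)
  next
    fix \<sigma> \<tau> \<rho> assume s: "\<sigma> \<in> Arr (arrow_cat M)" "\<tau> \<in> Arr (arrow_cat N)"
      and r: "\<rho> \<in> Hom (arrow_cat N) (omap (ladj A2) (Cod (arrow_cat M) \<sigma>)) (Dom (arrow_cat N) \<tau>)"
    obtain j u v k where j: "\<sigma> = (j, u, v, k)" "square M j u v k" using s by (cases \<sigma>) (auto simp: arrow_Arr)
    obtain f u' v' g where f: "\<tau> = (f, u', v', g)" "square N f u' v' g" using s by (cases \<tau>) (auto simp: arrow_Arr)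
    obtain a b where r': "\<rho> = (?T k, a, b, f)" "square N (?T k) a b f"
      using r by (auto elim!: arrow_HomE simp: sel j f)
    show "transp A2 (Dom (arrow_cat M) \<sigma>) (Cod (arrow_cat N) \<tau>) (\<tau> \<cdot>\<^bsub>arrow_cat N\<^esub> \<rho> \<cdot>\<^bsub>arrow_cat N\<^esub> amap (ladj A2) \<sigma>)
      = amap (radj A2) \<tau> \<cdot>\<^bsub>arrow_cat M\<^esub> transp A2 (Cod (arrow_cat M) \<sigma>) (Dom (arrow_cat N) \<tau>) \<rho> \<cdot>\<^bsub>arrow_cat M\<^esub> \<sigma>"
      using j(2) f(2) r'(2) A.transp_nat[of u u' a] A.transp_nat[of v v' b]
      by (simp add: j(1) f(1) r'(1) sel tr square_def)
  qed
  show ?thesis unfolding lifting_adj_def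
  proof (intro conjI ballI)
    show "adjunction (arrow_cat M) (arrow_cat N) A2" "adjunction M N A" by fact+
  next
    fix j f \<sigma> w assume jf: "j \<in> Arr M" "f \<in> Arr N" and s: "\<sigma> \<in> Hom (arrow_cat N) (omap (ladj A2) j) f"
      and w: "w \<in> Hom N (omap (ladj A) (Cod M j)) (Dom N f)"
    obtain u v where uv: "\<sigma> = (?T j, u, v, f)" "square N (?T j) u v f"
      using s by (auto elim!: arrow_HomE simp: sel)
    have 1: "w \<cdot>\<^bsub>N\<^esub> ?T j = u \<longleftrightarrow> transp A (Cod M j) (Dom N f) w \<cdot>\<^bsub>M\<^esub> j = transp A (Dom M j) (Dom N f) u"
    proof -
      have "transp A (Dom M j) (Dom N f) (w \<cdot>\<^bsub>N\<^esub> ?T j) = transp A (Cod M j) (Dom N f) w \<cdot>\<^bsub>M\<^esub> j"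
        using w jf by (intro A.transp_nat_left) (auto simp: Hom_def)
      moreover have "w \<cdot>\<^bsub>N\<^esub> ?T j = u" if "transp A (Dom M j) (Dom N f) (w \<cdot>\<^bsub>N\<^esub> ?T j) = transp A (Dom M j) (Dom N f) u"
        by (rule A.transp_eqD[OF that]) (use w jf uv in \<open>auto simp: Hom_def square_def\<close>)
      ultimately show ?thesis by auto
    qed
    have 2: "f \<cdot>\<^bsub>N\<^esub> w = v \<longleftrightarrow> ?S f \<cdot>\<^bsub>M\<^esub> transp A (Cod M j) (Dom N f) w = transp A (Cod M j) (Cod N f) v"
    proof -
      have "transp A (Cod M j) (Cod N f) (f \<cdot>\<^bsub>N\<^esub> w) = ?S f \<cdot>\<^bsub>M\<^esub> transp A (Cod M j) (Dom N f) w"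
        using w jf by (intro A.transp_nat_right) (auto simp: Hom_def)
      moreover have "f \<cdot>\<^bsub>N\<^esub> w = v" if "transp A (Cod M j) (Cod N f) (f \<cdot>\<^bsub>N\<^esub> w) = transp A (Cod M j) (Cod N f) v"
        by (rule A.transp_eqD[OF that]) (use w jf uv in \<open>auto simp: Hom_def square_def\<close>)
      ultimately show ?thesis by auto
    qed
    show "solution N \<sigma> w \<longleftrightarrow> solution M (transp A2 j f \<sigma>) (transp A (Cod M j) (Dom N f) w)"
      using w jf 1 2 by (auto simp: solution_def uv(1) tr Hom_def)
  next
    fix \<sigma> assume "\<sigma> \<in> Arr (arrow_cat M)"
    then show "sq_bot (amap (ladj A2) \<sigma>) = amap (ladj A) (sq_bot \<sigma>)" by (cases \<sigma>) (simp add: sel)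
  next
    fix \<sigma> assume "\<sigma> \<in> Arr (arrow_cat N)"
    then show "sq_top (amap (radj A2) \<sigma>) = amap (radj A) (sq_top \<sigma>)" by (cases \<sigma>) (simp add: sel)
  qed (simp_all add: sel)
qed

lemma comp_adjunction:
  assumes "adjunction C D A" "adjunction D E A'"
  shows "adjunction C E (comp_adj A' A)"
proof -
  interpret A: adj_on C D A by (unfold_locales) fact
  interpret A': adj_on D E A' by (unfold_locales) fact
  show ?thesis
  proof (rule adjunctionI)
    show "is_functor C E (ladj (comp_adj A' A))" "is_functor E C (radj (comp_adj A' A))"
      by (simp_all add: comp_adj_def comp_is_functor[OF A.F.is_functor_axioms A'.F.is_functor_axioms] comp_is_functor[OF A'.R.is_functor_axioms A.R.is_functor_axioms] A.F.is_functor_axioms A.R.is_functor_axioms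
         A'.F.is_functor_axioms A'.R.is_functor_axioms)
  next
    fix c d h assume "c \<in> Obj C" "d \<in> Obj E" "h \<in> Hom E (omap (ladj (comp_adj A' A)) c) d"
    then show "transp (comp_adj A' A) c d h \<in> Hom C c (omap (radj (comp_adj A' A)) d)"
      by (simp add: comp_adj_def comp_func_def Hom_def)
  next
    fix c d h h' assume *: "c \<in> Obj C" "d \<in> Obj E" "h \<in> Hom E (omap (ladj (comp_adj A' A)) c) d"
      "h' \<in> Hom E (omap (ladj (comp_adj A' A)) c) d" "transp (comp_adj A' A) c d h = transp (comp_adj A' A) c d h'"
    have "transp A' (omap (ladj A) c) d h = transp A' (omap (ladj A) c) d h'"
      by (rule A.transp_eqD[of c "omap (radj A') d"]) (use * in \<open>simp_all add: comp_adj_def comp_func_def Hom_def\<close>)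
    then show "h = h'"
      by (rule A'.transp_eqD) (use * in \<open>simp_all add: comp_adj_def comp_func_def Hom_def\<close>)
  next
    fix c d k assume *: "c \<in> Obj C" "d \<in> Obj E" "k \<in> Hom C c (omap (radj (comp_adj A' A)) d)"
    then show "\<exists>h\<in>Hom E (omap (ladj (comp_adj A' A)) c) d. transp (comp_adj A' A) c d h = k"
      by (intro bexI[of _ "A'.itransp (omap (ladj A) c) d (A.itransp c (omap (radj A') d) k)"])
        (simp_all add: comp_adj_def comp_func_def Hom_def)
  next
    fix a b h assume *: "a \<in> Arr C" "b \<in> Arr E" "h \<in> Hom E (omap (ladj (comp_adj A' A)) (Cod C a)) (Dom E b)"
    then show "transp (comp_adj A' A) (Dom C a) (Cod E b) (b \<cdot>\<^bsub>E\<^esub> h \<cdot>\<^bsub>E\<^esub> amap (ladj (comp_adj A' A)) a)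
          = amap (radj (comp_adj A' A)) b \<cdot>\<^bsub>C\<^esub> transp (comp_adj A' A) (Cod C a) (Dom E b) h \<cdot>\<^bsub>C\<^esub> a"
      using A'.transp_nat[of "amap (ladj A) a" b h] A.transp_nat[of a "amap (radj A') b" "transp A' (omap (ladj A) (Cod C a)) (Dom E b) h"]
      by (simp add: comp_adj_def comp_func_def Hom_def)
  qed
qed

lemma comp_lifting_adj:
  assumes B: "lifting_adj M P B2 B" and C: "lifting_adj P N C2 C"
  shows "lifting_adj M N (comp_adj C2 B2) (comp_adj C B)"
proof -
  have adj: "adjunction (arrow_cat M) (arrow_cat P) B2" "adjunction (arrow_cat P) (arrow_cat N) C2"
    "adjunction M P B" "adjunction P N C" using B C by (simp_all add: lifting_adj_def)
  interpret B2: adj_on "arrow_cat M" "arrow_cat P" B2 by (unfold_locales) fact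
  interpret C2: adj_on "arrow_cat P" "arrow_cat N" C2 by (unfold_locales) fact
  interpret B: adj_on M P B by (unfold_locales) fact
  interpret C: adj_on P N C by (unfold_locales) fact
  have objB: "omap (ladj B2) j \<in> Arr P" "Cod P (omap (ladj B2) j) = omap (ladj B) (Cod M j)" if "j \<in> Arr M" for j
    using B B2.F.omap_obj[of j] that by (simp_all add: lifting_adj_def)
  have objC: "omap (radj C2) f \<in> Arr P" "Dom P (omap (radj C2) f) = omap (radj C) (Dom N f)" if "f \<in> Arr N" for f
    using C C2.R.omap_obj[of f] that by (simp_all add: lifting_adj_def)
  show ?thesis unfolding lifting_adj_def
  proof (intro conjI ballI)
    show "adjunction (arrow_cat M) (arrow_cat N) (comp_adj C2 B2)" "adjunction M N (comp_adj C B)"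
      by (rule comp_adjunction; fact)+
  next
    fix j f \<sigma> w assume jf: "j \<in> Arr M" "f \<in> Arr N"
      and s: "\<sigma> \<in> Hom (arrow_cat N) (omap (ladj (comp_adj C2 B2)) j) f"
      and w: "w \<in> Hom N (omap (ladj (comp_adj C B)) (Cod M j)) (Dom N f)"
    let ?j = "omap (ladj B2) j" and ?f = "omap (radj C2) f"
    have s1: "\<sigma> \<in> Hom (arrow_cat N) (omap (ladj C2) ?j) f" using s by (simp add: comp_adj_def comp_func_def)
    have s2: "transp C2 ?j f \<sigma> \<in> Hom (arrow_cat P) ?j ?f"
      using s1 objB[OF jf(1)] by (simp add: Hom_def)
    have w1: "w \<in> Hom N (omap (ladj C) (Cod P ?j)) (Dom N f)" using w objB[OF jf(1)] by (simp add: comp_adj_def comp_func_def)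
    have w2: "transp C (Cod P ?j) (Dom N f) w \<in> Hom P (omap (ladj B) (Cod M j)) (Dom P ?f)"
      using w1 objB[OF jf(1)] objC[OF jf(2)] jf by (simp add: Hom_def)
    have "solution N \<sigma> w \<longleftrightarrow> solution P (transp C2 ?j f \<sigma>) (transp C (Cod P ?j) (Dom N f) w)"
      using C s1 w1 objB(1)[OF jf(1)] jf(2) unfolding lifting_adj_def by blast
    also have "\<dots> \<longleftrightarrow> solution M (transp B2 j ?f (transp C2 ?j f \<sigma>))
        (transp B (Cod M j) (Dom P ?f) (transp C (Cod P ?j) (Dom N f) w))"
      using B s2 w2 objC(1)[OF jf(2)] jf(1) unfolding lifting_adj_def by blast
    finally show "solution N \<sigma> w \<longleftrightarrow> solution M (transp (comp_adj C2 B2) j f \<sigma>) (transp (comp_adj C B) (Cod M j) (Dom N f) w)"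
      using objB[OF jf(1)] objC[OF jf(2)] by (simp add: comp_adj_def)
  qed (use B C objB objC in \<open>simp_all add: lifting_adj_def comp_adj_def comp_func_def\<close>)
qed

subsection \<open>Pushout-products and pullback-homs\<close>

lemma op_cat_simps [simp]:
  "Obj (op_cat C) = Obj C" "Arr (op_cat C) = Arr C" "Dom (op_cat C) = Cod C" "Cod (op_cat C) = Dom C"
  "Idt (op_cat C) = Idt C" "a' \<cdot>\<^bsub>op_cat C\<^esub> a = a \<cdot>\<^bsub>C\<^esub> a'"
  by (simp_all add: op_cat_def)

lemma Hom_op [simp]: "Hom (op_cat C) x y = Hom C y x"
  by (auto simp: Hom_def)

text \<open>Pullbacks are treated as pushouts in the opposite category.\<close>

lemma is_pullback_op: "is_pullback C f g c \<longleftrightarrow> is_pushout (op_cat C) f g c"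
  by (cases c) (simp add: is_pullback_def is_pushout_def)

lemma pair_op: "pair C c = copair (op_cat C) c"
  by (cases c) (simp add: pair_def copair_def fun_eq_iff)

context category
begin

lemma op_category: "category (op_cat C)"
  by standard (auto simp: Hom_def assoc)

lemma copair:
  assumes "is_pushout C f g (p, q)" and x: "x \<in> Arr C" "Dom C x = Cod C f" "y \<in> Arr C" "Dom C y = Cod C g"
    "Cod C x = z" "Cod C y = z" "x \<cdot> f = y \<cdot> g"
  shows "copair C (p, q) x y \<in> Arr C" "Dom C (copair C (p, q) x y) = Cod C p"
    "Cod C (copair C (p, q) x y) = z" "copair C (p, q) x y \<cdot> p = x" "copair C (p, q) x y \<cdot> q = y"
proof -
  have "\<exists>!h. h \<in> Hom C (Cod C p) z \<and> h \<cdot> p = x \<and> h \<cdot> q = y"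
    using assms(1) x unfolding is_pushout_def Hom_def by (simp only: prod.case mem_Collect_eq)
  from theI'[OF this] x(5)
  have "copair C (p, q) x y \<in> Hom C (Cod C p) z \<and> copair C (p, q) x y \<cdot> p = x \<and> copair C (p, q) x y \<cdot> q = y"
    by (simp add: copair_def)
  then show "copair C (p, q) x y \<in> Arr C" "Dom C (copair C (p, q) x y) = Cod C p"
    "Cod C (copair C (p, q) x y) = z" "copair C (p, q) x y \<cdot> p = x" "copair C (p, q) x y \<cdot> q = y"
    by (auto simp: Hom_def)
qed

lemma pushout_eqI:
  assumes po: "is_pushout C f g (p, q)" and "f \<in> Arr C" "g \<in> Arr C" "Dom C f = Dom C g"
    and h: "h \<in> Arr C" "Dom C h = Cod C p" "h' \<in> Arr C" "Dom C h' = Cod C p" "Cod C h' = Cod C h"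
    and "h \<cdot> p = h' \<cdot> p" "h \<cdot> q = h' \<cdot> q"
  shows "h = h'"
proof -
  have pq: "p \<in> Arr C" "q \<in> Arr C" "Dom C p = Cod C f" "Dom C q = Cod C g" "Cod C q = Cod C p" "p \<cdot> f = q \<cdot> g"
    using po by (auto simp: is_pushout_def Hom_def)
  have "(h \<cdot> p) \<cdot> f = (h \<cdot> q) \<cdot> g" using pq h assms(2-4) by (simp add: assoc)
  moreover have "h \<cdot> p \<in> Hom C (Cod C f) (Cod C h)" "h \<cdot> q \<in> Hom C (Cod C g) (Cod C h)"
    using pq h by (auto simp: Hom_def)
  ultimately have "\<exists>!k. k \<in> Hom C (Cod C p) (Cod C h) \<and> k \<cdot> p = h \<cdot> p \<and> k \<cdot> q = h \<cdot> q"
    using po by (simp add: is_pushout_def)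
  moreover have "h \<in> Hom C (Cod C p) (Cod C h)" "h' \<in> Hom C (Cod C p) (Cod C h)"
    using h by (auto simp: Hom_def)
  ultimately show ?thesis using assms(10,11) by metis
qed

lemmas pair = category.copair[OF op_category, folded is_pullback_op pair_op, simplified]
  and pullback_eqI = category.pushout_eqI[OF op_category, folded is_pullback_op, simplified]

end

lemma prod_cat_simps [simp]:
  "Obj (prod_cat C D) = Obj C \<times> Obj D" "Arr (prod_cat C D) = Arr C \<times> Arr D"
  "Dom (prod_cat C D) (a, b) = (Dom C a, Dom D b)" "Cod (prod_cat C D) (a, b) = (Cod C a, Cod D b)"
  "Idt (prod_cat C D) (x, y) = (Idt C x, Idt D y)"
  "(a', b') \<cdot>\<^bsub>prod_cat C D\<^esub> (a, b) = (a' \<cdot>\<^bsub>C\<^esub> a, b' \<cdot>\<^bsub>D\<^esub> b)"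
  by (simp_all add: prod_cat_def)

lemma swap_two_var_adjunction:
  assumes V: "two_var_adjunction M K N V"
  shows "two_var_adjunction K M N (tva_swap V)"
proof -
  interpret V: is_functor "prod_cat M K" N "tens V" using V by (simp add: two_var_adjunction_def)
  have cats: "category K" "category M" "category N" using V by (simp_all add: two_var_adjunction_def)
  interpret K: category K by fact
  interpret M: category M by fact
  have "category (prod_cat K M)"
    by standard (auto simp: Hom_def K.assoc M.assoc)
  then have "is_functor (prod_cat K M) N (tens (tva_swap V))"
    using cats by (intro is_functorI) (auto simp: tva_swap_def Hom_def V.amap_comp[symmetric]
        V.amap_idt[of "(b, a)" for a b, simplified])
  then show ?thesis using V unfolding two_var_adjunction_def
    by (auto simp: tva_swap_def)
qed

locale pushout_product =
  fixes K :: "('ok, 'ak) cat" and M :: "('o, 'a) cat" and N :: "('p, 'b) cat"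
    and V :: "('ok, 'ak, 'o, 'a, 'p, 'b) tva" and po pb and i :: 'ak
  assumes tva: "two_var_adjunction K M N V" and i [simp]: "i \<in> Arr K"
    and pb: "pullback_choice M pb" and po: "pushout_choice N po"
begin

sublocale K: category K using tva by (simp add: two_var_adjunction_def)
sublocale M: category M using tva by (simp add: two_var_adjunction_def)
sublocale N: category N using tva by (simp add: two_var_adjunction_def)
sublocale tens: is_functor "prod_cat K M" N "tens V" using tva by (simp add: two_var_adjunction_def)
sublocale ihom: is_functor "prod_cat (op_cat K) N" M "ihom V" using tva by (simp add: two_var_adjunction_def)

lemma tphi_nat:
  assumes "a \<in> Arr K" "b \<in> Arr M" "c \<in> Arr N" "h \<in> Hom N (omap (tens V) (Cod K a, Cod M b)) (Dom N c)"
  shows "tphi V (Dom K a) (Dom M b) (Cod N c) (c \<cdot>\<^bsub>N\<^esub> h \<cdot>\<^bsub>N\<^esub> amap (tens V) (a, b))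
          = amap (ihom V) (a, c) \<cdot>\<^bsub>M\<^esub> tphi V (Cod K a) (Cod M b) (Dom N c) h \<cdot>\<^bsub>M\<^esub> b"
  using tva assms unfolding two_var_adjunction_def by blast

lemma tens_adjunction:
  assumes k: "k \<in> Obj K"
  shows "adjunction M N (tens_adj K V k)"
proof -
  have "is_functor M N (ladj (tens_adj K V k))"
    using k by (intro is_functorI) (auto simp: tens_adj_def Hom_def M.category_axioms N.category_axioms tens.amap_comp[symmetric]
        tens.amap_idt[simplified, symmetric])
  moreover have "is_functor N M (radj (tens_adj K V k))"
    using k by (intro is_functorI) (auto simp: tens_adj_def Hom_def M.category_axioms N.category_axioms ihom.amap_comp[symmetric]
        ihom.amap_idt[simplified, symmetric])
  moreover have "\<forall>m\<in>Obj M. \<forall>n\<in>Obj N. bij_betw (tphi V k m n) (Hom N (omap (tens V) (k, m)) n) (Hom M m (omap (ihom V) (k, n)))"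
    using tva k unfolding two_var_adjunction_def by blast
  ultimately show ?thesis
    using tphi_nat[of "Idt K k"] k by (auto simp: adjunction_def tens_adj_def)
qed

abbreviation AA where "AA \<equiv> tens_adj K V (Dom K i)"
abbreviation BB where "BB \<equiv> tens_adj K V (Cod K i)"

sublocale A: adj_on M N AA by (unfold_locales) (simp add: tens_adjunction)
sublocale B: adj_on M N BB by (unfold_locales) (simp add: tens_adjunction)

abbreviation compM (infixr "\<bullet>" 70) where "g \<bullet> f \<equiv> g \<cdot>\<^bsub>M\<^esub> f"
abbreviation compN (infixr "\<star>" 70) where "g \<star> f \<equiv> g \<cdot>\<^bsub>N\<^esub> f"
abbreviation dM where "dM \<equiv> Dom M"
abbreviation cM where "cM \<equiv> Cod M"
abbreviation dN where "dN \<equiv> Dom N"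
abbreviation cN where "cN \<equiv> Cod N"
abbreviation TA where "TA \<equiv> amap (ladj AA)"
abbreviation TB where "TB \<equiv> amap (ladj BB)"
abbreviation SA where "SA \<equiv> amap (radj AA)"
abbreviation SB where "SB \<equiv> amap (radj BB)"
abbreviation tA where "tA \<equiv> transp AA"
abbreviation tB where "tB \<equiv> transp BB"

text \<open>The transformations \<open>A \<otimes> - \<Rightarrow> B \<otimes> -\<close> and \<open>hom(B, -) \<Rightarrow> hom(A, -)\<close> induced by \<open>i\<close>.\<close>

definition ti where "ti m = amap (tens V) (i, Idt M m)"
definition hi where "hi n = amap (ihom V) (i, Idt N n)"

lemma ti_arr [simp]:
  assumes "m \<in> Obj M"
  shows "ti m \<in> Arr N" "dN (ti m) = omap (ladj AA) m" "cN (ti m) = omap (ladj BB) m"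
  using assms tens.amap_arr[of "(i, Idt M m)"] by (simp_all add: ti_def tens_adj_def)

lemma hi_arr [simp]:
  assumes "n \<in> Obj N"
  shows "hi n \<in> Arr M" "dM (hi n) = omap (radj BB) n" "cM (hi n) = omap (radj AA) n"
  using assms ihom.amap_arr[of "(i, Idt N n)"] by (simp_all add: hi_def tens_adj_def)

lemma ti_nat:
  assumes "b \<in> Arr M"
  shows "ti (cM b) \<star> TA b = TB b \<star> ti (dM b)"
  using assms tens.amap_comp[of "(Idt K (Dom K i), b)" "(i, Idt M (cM b))"]
    tens.amap_comp[of "(i, Idt M (dM b))" "(Idt K (Cod K i), b)"]
  by (simp add: ti_def tens_adj_def)

lemma hi_nat:
  assumes "c \<in> Arr N"
  shows "hi (cN c) \<bullet> SB c = SA c \<bullet> hi (dN c)"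
  using assms ihom.amap_comp[of "(Idt K (Cod K i), c)" "(i, Idt N (cN c))"]
    ihom.amap_comp[of "(i, Idt N (dN c))" "(Idt K (Dom K i), c)"]
  by (simp add: hi_def tens_adj_def)

text \<open>The two transformations are conjugate: this is naturality of the two-variable adjunction in its
  first argument. Together with naturality in the other arguments it is all that is used to compare
  pushout-products with pullback-homs.\<close>

lemma transp_ti:
  assumes "w \<in> Arr N" "dN w = omap (ladj BB) m" "cN w = n" "m \<in> Obj M"
  shows "tA m n (w \<star> ti m) = hi n \<bullet> tB m n w"
proof -
  have n: "n \<in> Obj N" using assms by auto
  have "tB m n w \<in> Arr M" "dM (tB m n w) = m" "cM (tB m n w) = omap (radj BB) n"
    using assms by simp_all
  then show ?thesis
    using tphi_nat[of i "Idt M m" "Idt N n" w] assms n by (simp add: ti_def hi_def tens_adj_def Hom_def)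
qed

subsection \<open>The chosen pushouts and pullbacks\<close>

definition pin where "pin j = fst (ptens_cocone K M V po i j)"
definition qin where "qin j = snd (ptens_cocone K M V po i j)"
definition ppr where "ppr f = fst (phom_cone K N V pb i f)"
definition qpr where "qpr f = snd (phom_cone K N V pb i f)"

lemma cocone: "ptens_cocone K M V po i j = (pin j, qin j)"
  and cone: "phom_cone K N V pb i f = (ppr f, qpr f)"
  by (simp_all add: pin_def qin_def ppr_def qpr_def)

lemma ptens_pushout:
  assumes "j \<in> Arr M"
  shows "is_pushout N (TA j) (ti (dM j)) (pin j, qin j)"
proof -
  have "ptens_cocone K M V po i j = po (TA j) (ti (dM j))"
    by (simp add: ptens_cocone_def ti_def tens_adj_def)
  then show ?thesis using po assms cocone[of j] unfolding pushout_choice_def by simp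
qed

lemma phom_pullback:
  assumes "f \<in> Arr N"
  shows "is_pullback M (hi (cN f)) (SA f) (ppr f, qpr f)"
proof -
  have "phom_cone K N V pb i f = pb (hi (cN f)) (SA f)"
    by (simp add: phom_cone_def hi_def tens_adj_def)
  then show ?thesis using pb assms cone[of f] unfolding pullback_choice_def by simp
qed

lemma in_arr [simp]:
  assumes "j \<in> Arr M"
  shows "pin j \<in> Arr N" "dN (pin j) = omap (ladj AA) (cM j)" "qin j \<in> Arr N" "dN (qin j) = omap (ladj BB) (dM j)"
    "cN (qin j) = cN (pin j)" "pin j \<star> TA j = qin j \<star> ti (dM j)"
  using ptens_pushout[OF assms] assms by (auto simp: is_pushout_def Hom_def)

lemma pr_arr [simp]:
  assumes "f \<in> Arr N"
  shows "ppr f \<in> Arr M" "cM (ppr f) = omap (radj BB) (cN f)" "qpr f \<in> Arr M" "cM (qpr f) = omap (radj AA) (dN f)"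
    "dM (qpr f) = dM (ppr f)" "hi (cN f) \<bullet> ppr f = SA f \<bullet> qpr f"
  using phom_pullback[OF assms] assms by (auto simp: is_pullback_def Hom_def)

definition cop where "cop j x y = copair N (pin j, qin j) x y"
definition par where "par f x y = pair M (ppr f, qpr f) x y"

lemma cop [simp]:
  assumes "j \<in> Arr M" "x \<in> Arr N" "dN x = omap (ladj AA) (cM j)" "y \<in> Arr N" "dN y = omap (ladj BB) (dM j)"
    "cN y = cN x" "x \<star> TA j = y \<star> ti (dM j)"
  shows "cop j x y \<in> Arr N" "dN (cop j x y) = cN (pin j)" "cN (cop j x y) = cN x"
    "cop j x y \<star> pin j = x" "cop j x y \<star> qin j = y"
  unfolding cop_def by (rule N.copair[OF ptens_pushout[OF assms(1)], of x y "cN x"]; use assms in simp)+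

lemma par [simp]:
  assumes "f \<in> Arr N" "x \<in> Arr M" "cM x = omap (radj BB) (cN f)" "y \<in> Arr M" "cM y = omap (radj AA) (dN f)"
    "dM y = dM x" "hi (cN f) \<bullet> x = SA f \<bullet> y"
  shows "par f x y \<in> Arr M" "cM (par f x y) = dM (ppr f)" "dM (par f x y) = dM x"
    "ppr f \<bullet> par f x y = x" "qpr f \<bullet> par f x y = y"
  unfolding par_def by (rule M.pair[OF phom_pullback[OF assms(1)], of x y "dM x"]; use assms in simp)+

lemma in_eqI:
  assumes "j \<in> Arr M" "h \<in> Arr N" "dN h = cN (pin j)" "h' \<in> Arr N" "dN h' = cN (pin j)" "cN h' = cN h"
    "h \<star> pin j = h' \<star> pin j" "h \<star> qin j = h' \<star> qin j"
  shows "h = h'"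
  by (rule N.pushout_eqI[OF ptens_pushout[OF assms(1)]]) (use assms in simp_all)

lemma pr_eqI:
  assumes "f \<in> Arr N" "h \<in> Arr M" "cM h = dM (ppr f)" "h' \<in> Arr M" "cM h' = dM (ppr f)" "dM h' = dM h"
    "ppr f \<bullet> h = ppr f \<bullet> h'" "qpr f \<bullet> h = qpr f \<bullet> h'"
  shows "h = h'"
  by (rule M.pullback_eqI[OF phom_pullback[OF assms(1)]]) (use assms in simp_all)

abbreviation G where "G \<equiv> ptens K M N V po i"
abbreviation H where "H \<equiv> phom K M N V pb i"
abbreviation A2 where "A2 \<equiv> ptens_adj K M N V po pb i"

lemma G_eq: "G j = cop j (ti (cM j)) (TB j)"
  by (simp add: ptens_def cocone cop_def ti_def tens_adj_def)

lemma H_eq: "H f = par f (SB f) (hi (dN f))"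
  by (simp add: phom_def cone par_def hi_def tens_adj_def)

lemma G_arr [simp]:
  assumes "j \<in> Arr M"
  shows "G j \<in> Arr N" "dN (G j) = cN (pin j)" "cN (G j) = omap (ladj BB) (cM j)"
    "G j \<star> pin j = ti (cM j)" "G j \<star> qin j = TB j"
  using assms ti_nat[of j] by (simp_all add: G_eq)

lemma H_arr [simp]:
  assumes "f \<in> Arr N"
  shows "H f \<in> Arr M" "dM (H f) = omap (radj BB) (dN f)" "cM (H f) = dM (ppr f)"
    "ppr f \<bullet> H f = SB f" "qpr f \<bullet> H f = hi (dN f)"
  using assms hi_nat[of f] by (simp_all add: H_eq)

text \<open>The components of the pushout-product and pullback-hom of a square that are induced by the universal
  properties.\<close>

definition Gtop where "Gtop j u v k = cop j (pin k \<star> TA v) (qin k \<star> TB u)"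
definition Hbot where "Hbot f u v g = par g (SB v \<bullet> ppr f) (SA u \<bullet> qpr f)"

lemma A2_sel:
  "omap (ladj A2) = G" "omap (radj A2) = H"
  "amap (ladj A2) (j, u, v, k) = (G j, Gtop j u v k, TB v, G k)"
  "amap (radj A2) (f, u', v', g) = (H f, SB u', Hbot f u' v' g, H g)"
  "transp A2 j' f' (e, a, b, e') = (j', tB (dM j') (dN f') (a \<star> qin j'),
     par f' (tB (cM j') (cN f') b) (tA (cM j') (dN f') (a \<star> pin j')), H f')"
  by (simp_all add: ptens_adj_def ptens_func_def phom_func_def Gtop_def Hbot_def cop_def par_def cocone cone tens_adj_def)

lemma Gtop:
  assumes sq: "square M j u v k"
  shows "Gtop j u v k \<in> Arr N" "dN (Gtop j u v k) = cN (pin j)" "cN (Gtop j u v k) = cN (pin k)"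
    "Gtop j u v k \<star> pin j = pin k \<star> TA v" "Gtop j u v k \<star> qin j = qin k \<star> TB u"
proof -
  note s [simp] = sq[unfolded square_def]
  have "pin k \<star> TA v \<star> TA j = pin k \<star> TA k \<star> TA u"
    by (simp add: A.F.amap_comp[symmetric])
  also have "\<dots> = qin k \<star> ti (dM k) \<star> TA u"
    by (simp add: N.comp_ext[OF in_arr(6)] N.assoc)
  also have "ti (dM k) \<star> TA u = TB u \<star> ti (dM j)"
    using ti_nat[of u] by simp
  finally have "(pin k \<star> TA v) \<star> TA j = (qin k \<star> TB u) \<star> ti (dM j)" by (simp add: N.assoc)
  then show "Gtop j u v k \<in> Arr N" "dN (Gtop j u v k) = cN (pin j)" "cN (Gtop j u v k) = cN (pin k)"
    "Gtop j u v k \<star> pin j = pin k \<star> TA v" "Gtop j u v k \<star> qin j = qin k \<star> TB u"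
    by (simp_all add: Gtop_def)
qed

lemma Hbot:
  assumes sq: "square N f u v g"
  shows "Hbot f u v g \<in> Arr M" "dM (Hbot f u v g) = dM (ppr f)" "cM (Hbot f u v g) = dM (ppr g)"
    "ppr g \<bullet> Hbot f u v g = SB v \<bullet> ppr f" "qpr g \<bullet> Hbot f u v g = SA u \<bullet> qpr f"
proof -
  note s [simp] = sq[unfolded square_def]
  have "SA g \<bullet> SA u \<bullet> qpr f = (SA v \<bullet> SA f) \<bullet> qpr f"
    by (simp add: A.R.amap_comp[symmetric] M.assoc[symmetric])
  also have "\<dots> = SA v \<bullet> hi (cN f) \<bullet> ppr f"
    by (simp add: M.assoc)
  also have "\<dots> = (SA v \<bullet> hi (cN f)) \<bullet> ppr f"
    by (rule M.assoc[symmetric]) simp_all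
  also have "\<dots> = (hi (cN g) \<bullet> SB v) \<bullet> ppr f"
    using hi_nat[of v] by simp
  finally have "hi (cN g) \<bullet> SB v \<bullet> ppr f = SA g \<bullet> SA u \<bullet> qpr f" by (simp add: M.assoc)
  then show "Hbot f u v g \<in> Arr M" "dM (Hbot f u v g) = dM (ppr f)" "cM (Hbot f u v g) = dM (ppr g)"
    "ppr g \<bullet> Hbot f u v g = SB v \<bullet> ppr f" "qpr g \<bullet> Hbot f u v g = SA u \<bullet> qpr f"
    by (simp_all add: Hbot_def)
qed

lemma G_square:
  assumes sq: "square M j u v k"
  shows "square N (G j) (Gtop j u v k) (TB v) (G k)"
proof -
  note s [simp] = sq[unfolded square_def] and Gtop[OF sq, simp]
  have "G k \<star> Gtop j u v k = TB v \<star> G j"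
  proof (rule in_eqI[of j])
    show "(G k \<star> Gtop j u v k) \<star> pin j = (TB v \<star> G j) \<star> pin j"
      using ti_nat[of v] by (simp add: N.assoc N.comp_ext[OF G_arr(4)])
    show "(G k \<star> Gtop j u v k) \<star> qin j = (TB v \<star> G j) \<star> qin j"
      by (simp add: N.assoc N.comp_ext[OF G_arr(5)] B.F.amap_comp[symmetric])
  qed simp_all
  then show ?thesis by (simp add: square_def)
qed

lemma H_square:
  assumes sq: "square N f u v g"
  shows "square M (H f) (SB u) (Hbot f u v g) (H g)"
proof -
  note s [simp] = sq[unfolded square_def] and Hbot[OF sq, simp]
  have "H g \<bullet> SB u = Hbot f u v g \<bullet> H f"
  proof (rule pr_eqI[of g])
    show "ppr g \<bullet> H g \<bullet> SB u = ppr g \<bullet> Hbot f u v g \<bullet> H f"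
      by (simp add: M.comp_ext[OF Hbot(4)[OF sq]] M.comp_ext[OF H_arr(4)] M.assoc B.R.amap_comp[symmetric])
    show "qpr g \<bullet> H g \<bullet> SB u = qpr g \<bullet> Hbot f u v g \<bullet> H f"
      using hi_nat[of u] by (simp add: M.comp_ext[OF Hbot(5)[OF sq]] M.comp_ext[OF H_arr(5)] M.assoc)
  qed simp_all
  then show ?thesis by (simp add: square_def)
qed

lemma G_functor: "is_functor (arrow_cat M) (arrow_cat N) (ladj A2)"
proof (rule is_functorI[OF M.arrow_category N.arrow_category])
  fix \<sigma> assume "\<sigma> \<in> Arr (arrow_cat M)"
  then show "amap (ladj A2) \<sigma> \<in> Hom (arrow_cat N) (omap (ladj A2) (Dom (arrow_cat M) \<sigma>)) (omap (ladj A2) (Cod (arrow_cat M) \<sigma>))"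
    by (cases \<sigma>) (simp add: A2_sel arrow_Arr arrow_Hom_iff G_square)
next
  fix j assume "j \<in> Obj (arrow_cat M)"
  then have j [simp]: "j \<in> Arr M" by simp
  have sq: "square M j (Idt M (dM j)) (Idt M (cM j)) j" by (simp add: square_def)
  have "Gtop j (Idt M (dM j)) (Idt M (cM j)) j = Idt N (cN (pin j))"
    by (rule in_eqI[OF j]) (simp_all add: Gtop[OF sq])
  then show "amap (ladj A2) (Idt (arrow_cat M) j) = Idt (arrow_cat N) (omap (ladj A2) j)"
    by (simp add: A2_sel)
next
  fix \<sigma> \<tau> assume "\<sigma> \<in> Arr (arrow_cat M)" "\<tau> \<in> Arr (arrow_cat M)" "Cod (arrow_cat M) \<sigma> = Dom (arrow_cat M) \<tau>"
  then obtain j u v k u' v' l where s: "\<sigma> = (j, u, v, k)" "\<tau> = (k, u', v', l)"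
    and sq: "square M j u v k" "square M k u' v' l"
    by (cases \<sigma>; cases \<tau>) (auto simp: arrow_Arr)
  note [simp] = sq[unfolded square_def] and Gtop[OF sq(1), simp] and Gtop[OF sq(2), simp]
    and Gtop[OF M.square_comp[OF sq], simp]
  have "Gtop j (u' \<bullet> u) (v' \<bullet> v) l = Gtop k u' v' l \<star> Gtop j u v k"
    by (rule in_eqI[of j]) (simp_all add: N.assoc N.comp_ext[OF Gtop(4)[OF sq(2)]] N.comp_ext[OF Gtop(5)[OF sq(2)]] A.F.amap_comp B.F.amap_comp)
  then show "amap (ladj A2) (\<tau> \<cdot>\<^bsub>arrow_cat M\<^esub> \<sigma>) = amap (ladj A2) \<tau> \<cdot>\<^bsub>arrow_cat N\<^esub> amap (ladj A2) \<sigma>"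
    by (simp add: s A2_sel B.F.amap_comp)
qed (simp add: A2_sel)

lemma H_functor: "is_functor (arrow_cat N) (arrow_cat M) (radj A2)"
proof (rule is_functorI[OF N.arrow_category M.arrow_category])
  fix \<sigma> assume "\<sigma> \<in> Arr (arrow_cat N)"
  then show "amap (radj A2) \<sigma> \<in> Hom (arrow_cat M) (omap (radj A2) (Dom (arrow_cat N) \<sigma>)) (omap (radj A2) (Cod (arrow_cat N) \<sigma>))"
    by (cases \<sigma>) (simp add: A2_sel arrow_Arr arrow_Hom_iff H_square)
next
  fix j assume "j \<in> Obj (arrow_cat N)"
  then have j [simp]: "j \<in> Arr N" by simp
  have sq: "square N j (Idt N (dN j)) (Idt N (cN j)) j" by (simp add: square_def)
  have "Hbot j (Idt N (dN j)) (Idt N (cN j)) j = Idt M (dM (ppr j))"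
    by (rule pr_eqI[OF j]) (simp_all add: Hbot[OF sq])
  then show "amap (radj A2) (Idt (arrow_cat N) j) = Idt (arrow_cat M) (omap (radj A2) j)"
    by (simp add: A2_sel)
next
  fix \<sigma> \<tau> assume "\<sigma> \<in> Arr (arrow_cat N)" "\<tau> \<in> Arr (arrow_cat N)" "Cod (arrow_cat N) \<sigma> = Dom (arrow_cat N) \<tau>"
  then obtain j u v k u' v' l where s: "\<sigma> = (j, u, v, k)" "\<tau> = (k, u', v', l)"
    and sq: "square N j u v k" "square N k u' v' l"
    by (cases \<sigma>; cases \<tau>) (auto simp: arrow_Arr)
  note [simp] = sq[unfolded square_def] and Hbot[OF sq(1), simp] and Hbot[OF sq(2), simp]
    and Hbot[OF N.square_comp[OF sq], simp]
  have "Hbot j (u' \<star> u) (v' \<star> v) l = Hbot k u' v' l \<bullet> Hbot j u v k"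
    by (rule pr_eqI[of l]) (simp_all add: M.assoc M.comp_ext[OF Hbot(4)[OF sq(2)]] M.comp_ext[OF Hbot(5)[OF sq(2)]] A.R.amap_comp B.R.amap_comp)
  then show "amap (radj A2) (\<tau> \<cdot>\<^bsub>arrow_cat N\<^esub> \<sigma>) = amap (radj A2) \<tau> \<cdot>\<^bsub>arrow_cat M\<^esub> amap (radj A2) \<sigma>"
    by (simp add: s A2_sel B.R.amap_comp)
qed (simp add: A2_sel)

subsection \<open>Transposition of squares\<close>

text \<open>The bottom of the transpose of the square \<open>(u, v) : G j \<Rightarrow> f\<close>.\<close>

definition trbot where "trbot j f u v = par f (tB (cM j) (cN f) v) (tA (cM j) (dN f) (u \<star> pin j))"

lemma trbot:
  assumes j [simp]: "j \<in> Arr M" and sq: "square N (G j) u v f"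
  shows "trbot j f u v \<in> Arr M" "dM (trbot j f u v) = cM j" "cM (trbot j f u v) = dM (ppr f)"
    "ppr f \<bullet> trbot j f u v = tB (cM j) (cN f) v" "qpr f \<bullet> trbot j f u v = tA (cM j) (dN f) (u \<star> pin j)"
proof -
  note [simp] = sq[unfolded square_def]
  have "hi (cN f) \<bullet> tB (cM j) (cN f) v = tA (cM j) (cN f) (v \<star> ti (cM j))"
    by (rule transp_ti[symmetric]) simp_all
  also have "v \<star> ti (cM j) = f \<star> u \<star> pin j"
    using sq by (simp add: N.assoc[symmetric]) (simp add: N.assoc)
  also have "tA (cM j) (cN f) \<dots> = SA f \<bullet> tA (cM j) (dN f) (u \<star> pin j)"
    by (rule A.transp_nat_right) simp_all
  finally have "hi (cN f) \<bullet> tB (cM j) (cN f) v = SA f \<bullet> tA (cM j) (dN f) (u \<star> pin j)" .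
  then show "trbot j f u v \<in> Arr M" "dM (trbot j f u v) = cM j" "cM (trbot j f u v) = dM (ppr f)"
    "ppr f \<bullet> trbot j f u v = tB (cM j) (cN f) v" "qpr f \<bullet> trbot j f u v = tA (cM j) (dN f) (u \<star> pin j)"
    by (simp_all add: trbot_def)
qed

lemma tr_eq: "transp A2 j f (e, u, v, e') = (j, tB (dM j) (dN f) (u \<star> qin j), trbot j f u v, H f)"
  by (simp add: A2_sel trbot_def)

lemma tr_square:
  assumes j [simp]: "j \<in> Arr M" and sq: "square N (G j) u v f"
  shows "square M j (tB (dM j) (dN f) (u \<star> qin j)) (trbot j f u v) (H f)"
proof -
  note s [simp] = sq[unfolded square_def] and trbot[OF j sq, simp]
  have "H f \<bullet> tB (dM j) (dN f) (u \<star> qin j) = trbot j f u v \<bullet> j"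
  proof (rule pr_eqI[of f])
    have "SB f \<bullet> tB (dM j) (dN f) (u \<star> qin j) = tB (dM j) (cN f) (f \<star> u \<star> qin j)"
      by (rule B.transp_nat_right[symmetric]) simp_all
    also have "f \<star> u \<star> qin j = v \<star> TB j"
      by (simp add: N.comp_ext[of f u "v \<star> G j"] N.assoc)
    also have "tB (dM j) (cN f) \<dots> = tB (cM j) (cN f) v \<bullet> j"
      by (rule B.transp_nat_left) simp_all
    finally show "ppr f \<bullet> H f \<bullet> tB (dM j) (dN f) (u \<star> qin j) = ppr f \<bullet> trbot j f u v \<bullet> j"
      by (simp add: M.comp_ext[OF H_arr(4)] M.comp_ext[OF trbot(4)[OF j sq]])
    have "hi (dN f) \<bullet> tB (dM j) (dN f) (u \<star> qin j) = tA (dM j) (dN f) ((u \<star> qin j) \<star> ti (dM j))"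
      by (rule transp_ti[symmetric]) simp_all
    also have "(u \<star> qin j) \<star> ti (dM j) = (u \<star> pin j) \<star> TA j"
      by (simp add: N.assoc)
    also have "tA (dM j) (dN f) \<dots> = tA (cM j) (dN f) (u \<star> pin j) \<bullet> j"
      by (rule A.transp_nat_left) simp_all
    finally show "qpr f \<bullet> H f \<bullet> tB (dM j) (dN f) (u \<star> qin j) = qpr f \<bullet> trbot j f u v \<bullet> j"
      by (simp add: M.comp_ext[OF H_arr(5)] M.comp_ext[OF trbot(5)[OF j sq]])
  qed simp_all
  then show ?thesis by (simp add: square_def)
qed

lemma tr_inj:
  assumes j [simp]: "j \<in> Arr M" and sq: "square N (G j) u v f" "square N (G j) u' v' f"
    and top: "tB (dM j) (dN f) (u \<star> qin j) = tB (dM j) (dN f) (u' \<star> qin j)"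
    and bot: "trbot j f u v = trbot j f u' v'"
  shows "u = u'" "v = v'"
proof -
  note [simp] = sq[unfolded square_def]
  have "tB (cM j) (cN f) v = tB (cM j) (cN f) v'"
    using trbot(4)[OF j sq(1)] trbot(4)[OF j sq(2)] bot by simp
  then show "v = v'" by (rule B.transp_eqD) simp_all
  have "tA (cM j) (dN f) (u \<star> pin j) = tA (cM j) (dN f) (u' \<star> pin j)"
    using trbot(5)[OF j sq(1)] trbot(5)[OF j sq(2)] bot by simp
  then have p: "u \<star> pin j = u' \<star> pin j" by (rule A.transp_eqD) simp_all
  from top have q: "u \<star> qin j = u' \<star> qin j" by (rule B.transp_eqD) simp_all
  show "u = u'" by (rule in_eqI[OF j _ _ _ _ _ p q]) simp_all
qed

lemma tr_surj:
  assumes j [simp]: "j \<in> Arr M" and f [simp]: "f \<in> Arr N" and sq: "square M j a b (H f)"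
  obtains u v where "square N (G j) u v f" "tB (dM j) (dN f) (u \<star> qin j) = a" "trbot j f u v = b"
proof -
  note s [simp] = sq[unfolded square_def]
  \<comment> \<open>The two components of \<open>b\<close> and the arrow \<open>a\<close> transpose to \<open>v\<close> and to the two components of \<open>u\<close>.\<close>
  define v y x where "v = B.itransp (cM j) (cN f) (ppr f \<bullet> b)" and "y = B.itransp (dM j) (dN f) a"
    and "x = A.itransp (cM j) (dN f) (qpr f \<bullet> b)"
  have v [simp]: "v \<in> Arr N" "dN v = omap (ladj BB) (cM j)" "cN v = cN f" "tB (cM j) (cN f) v = ppr f \<bullet> b"
    by (simp_all add: v_def)
  have y [simp]: "y \<in> Arr N" "dN y = omap (ladj BB) (dM j)" "cN y = dN f" "tB (dM j) (dN f) y = a"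
    by (simp_all add: y_def)
  have x [simp]: "x \<in> Arr N" "dN x = omap (ladj AA) (cM j)" "cN x = dN f" "tA (cM j) (dN f) x = qpr f \<bullet> b"
    by (simp_all add: x_def)
  have xy: "x \<star> TA j = y \<star> ti (dM j)"
  proof (rule A.transp_eqD[of "dM j" "dN f"])
    have "tA (dM j) (dN f) (x \<star> TA j) = (qpr f \<bullet> b) \<bullet> j"
      unfolding x(4)[symmetric] by (rule A.transp_nat_left) simp_all
    also have "\<dots> = hi (dN f) \<bullet> tB (dM j) (dN f) y"
      using s by (simp add: M.assoc M.comp_ext[OF H_arr(5), symmetric])
    also have "\<dots> = tA (dM j) (dN f) (y \<star> ti (dM j))"
      by (rule transp_ti[symmetric]) simp_all
    finally show "tA (dM j) (dN f) (x \<star> TA j) = tA (dM j) (dN f) (y \<star> ti (dM j))" .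
  qed simp_all
  define u where "u = cop j x y"
  have u [simp]: "u \<in> Arr N" "dN u = cN (pin j)" "cN u = dN f" "u \<star> pin j = x" "u \<star> qin j = y"
    by (simp_all add: u_def xy)
  have "f \<star> u = v \<star> G j"
  proof (rule in_eqI[OF j])
    have "tA (cM j) (cN f) (f \<star> x) = SA f \<bullet> qpr f \<bullet> b"
      unfolding x(4)[symmetric] by (rule A.transp_nat_right) simp_all
    also have "\<dots> = hi (cN f) \<bullet> tB (cM j) (cN f) v"
      by (simp add: M.comp_ext[OF pr_arr(6)] M.assoc)
    also have "\<dots> = tA (cM j) (cN f) (v \<star> ti (cM j))"
      by (rule transp_ti[symmetric]) simp_all
    finally have "f \<star> x = v \<star> ti (cM j)" by (rule A.transp_eqD) simp_all
    then show "(f \<star> u) \<star> pin j = (v \<star> G j) \<star> pin j" by (simp add: N.assoc)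
    have "tB (dM j) (cN f) (f \<star> y) = SB f \<bullet> a"
      unfolding y(4)[symmetric] by (rule B.transp_nat_right) simp_all
    also have "\<dots> = tB (cM j) (cN f) v \<bullet> j"
      using s by (simp add: M.assoc M.comp_ext[OF H_arr(4), symmetric])
    also have "\<dots> = tB (dM j) (cN f) (v \<star> TB j)"
      by (rule B.transp_nat_left[symmetric]) simp_all
    finally have "f \<star> y = v \<star> TB j" by (rule B.transp_eqD) simp_all
    then show "(f \<star> u) \<star> qin j = (v \<star> G j) \<star> qin j" by (simp add: N.assoc)
  qed simp_all
  then have sqN: "square N (G j) u v f" by (simp add: square_def)
  moreover have "trbot j f u v = b"
    by (rule pr_eqI[OF f]) (simp_all add: trbot[OF j sqN])
  ultimately show ?thesis by (intro that[of u v]) simp_all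
qed

lemma ptens_adjunction: "adjunction (arrow_cat M) (arrow_cat N) A2"
proof (rule adjunctionI[OF G_functor H_functor])
  fix j f \<sigma> assume "j \<in> Obj (arrow_cat M)" "f \<in> Obj (arrow_cat N)" "\<sigma> \<in> Hom (arrow_cat N) (omap (ladj A2) j) f"
  then show "transp A2 j f \<sigma> \<in> Hom (arrow_cat M) j (omap (radj A2) f)"
    by (auto elim!: arrow_HomE simp: A2_sel(1,2) tr_eq arrow_Hom_iff tr_square)
next
  fix j f \<sigma> \<sigma>' assume "j \<in> Obj (arrow_cat M)" "f \<in> Obj (arrow_cat N)"
    "\<sigma> \<in> Hom (arrow_cat N) (omap (ladj A2) j) f" "\<sigma>' \<in> Hom (arrow_cat N) (omap (ladj A2) j) f"
    "transp A2 j f \<sigma> = transp A2 j f \<sigma>'"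
  then show "\<sigma> = \<sigma>'"
    by (auto elim!: arrow_HomE simp: A2_sel(1,2) tr_eq dest: tr_inj)
next
  fix j f \<tau> assume jf: "j \<in> Obj (arrow_cat M)" "f \<in> Obj (arrow_cat N)" and "\<tau> \<in> Hom (arrow_cat M) j (omap (radj A2) f)"
  then obtain a b where t: "\<tau> = (j, a, b, H f)" "square M j a b (H f)"
    by (auto elim!: arrow_HomE simp: A2_sel)
  obtain u v where uv: "square N (G j) u v f" "tB (dM j) (dN f) (u \<star> qin j) = a" "trbot j f u v = b"
    using tr_surj[OF _ _ t(2)] jf by auto
  then show "\<exists>\<sigma>\<in>Hom (arrow_cat N) (omap (ladj A2) j) f. transp A2 j f \<sigma> = \<tau>"
    by (intro bexI[of _ "(G j, u, v, f)"]) (simp_all add: tr_eq t A2_sel(1) arrow_Hom_iff)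
next
  fix \<sigma> \<tau> \<rho> assume s: "\<sigma> \<in> Arr (arrow_cat M)" "\<tau> \<in> Arr (arrow_cat N)"
    and r: "\<rho> \<in> Hom (arrow_cat N) (omap (ladj A2) (Cod (arrow_cat M) \<sigma>)) (Dom (arrow_cat N) \<tau>)"
  obtain j u v k where j: "\<sigma> = (j, u, v, k)" "square M j u v k" using s by (cases \<sigma>) (auto simp: arrow_Arr)
  obtain f u' v' g where f: "\<tau> = (f, u', v', g)" "square N f u' v' g" using s by (cases \<tau>) (auto simp: arrow_Arr)
  obtain a b where r': "\<rho> = (G k, a, b, f)" "square N (G k) a b f"
    using r by (auto elim!: arrow_HomE simp: A2_sel(1) j f)
  note sqs [simp] = j(2)[unfolded square_def] f(2)[unfolded square_def] r'(2)[unfolded square_def]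
  note [simp] = Gtop[OF j(2)] Hbot[OF f(2)] trbot[OF _ r'(2)]
  let ?x = "(u' \<star> a) \<star> Gtop j u v k" and ?y = "(v' \<star> b) \<star> TB v"
  have sq: "square N (G j) ?x ?y g"
    by (rule N.square_comp[OF G_square[OF j(2)] N.square_comp[OF r'(2) f(2)]])
  have "tB (dM j) (dN g) (?x \<star> qin j) = (SB u' \<bullet> tB (dM k) (dN f) (a \<star> qin k)) \<bullet> u"
    using B.transp_nat[of u u' "a \<star> qin k"] by (simp add: N.assoc M.assoc)
  moreover have "trbot j g ?x ?y = (Hbot f u' v' g \<bullet> trbot k f a b) \<bullet> v"
  proof (rule pr_eqI[of g])
    have "tB (cM j) (cN g) ?y = (SB v' \<bullet> tB (cM k) (cN f) b) \<bullet> v"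
      using B.transp_nat[of v v' b] by simp
    then show "ppr g \<bullet> trbot j g ?x ?y = ppr g \<bullet> (Hbot f u' v' g \<bullet> trbot k f a b) \<bullet> v"
      by (simp add: trbot[OF _ sq] M.assoc M.comp_ext[OF Hbot(4)[OF f(2)]] M.comp_ext[OF trbot(4)[OF _ r'(2)]])
    have "tA (cM j) (dN g) (?x \<star> pin j) = (SA u' \<bullet> tA (cM k) (dN f) (a \<star> pin k)) \<bullet> v"
      using A.transp_nat[of v u' "a \<star> pin k"] by (simp add: N.assoc)
    then show "qpr g \<bullet> trbot j g ?x ?y = qpr g \<bullet> (Hbot f u' v' g \<bullet> trbot k f a b) \<bullet> v"
      by (simp add: trbot[OF _ sq] M.assoc M.comp_ext[OF Hbot(5)[OF f(2)]] M.comp_ext[OF trbot(5)[OF _ r'(2)]])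
  qed (simp_all add: trbot[OF _ sq])
  ultimately show "transp A2 (Dom (arrow_cat M) \<sigma>) (Cod (arrow_cat N) \<tau>) (\<tau> \<cdot>\<^bsub>arrow_cat N\<^esub> \<rho> \<cdot>\<^bsub>arrow_cat N\<^esub> amap (ladj A2) \<sigma>)
    = amap (radj A2) \<tau> \<cdot>\<^bsub>arrow_cat M\<^esub> transp A2 (Cod (arrow_cat M) \<sigma>) (Dom (arrow_cat N) \<tau>) \<rho> \<cdot>\<^bsub>arrow_cat M\<^esub> \<sigma>"
    by (simp add: j(1) f(1) r'(1) tr_eq A2_sel(3,4))
qed

text \<open>On the side of \<open>N\<close> a solution \<open>w\<close> satisfies one equation for each leg of the pushout and the equation
  \<open>f \<star> w = v\<close>; on the side of \<open>M\<close> its transpose satisfies one equation for the top of the problem and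
  one for each leg of the pullback. The three equations correspond.\<close>

lemma ptens_solution:
  assumes j [simp]: "j \<in> Arr M" and sq: "square N (G j) u v f" and w: "w \<in> Hom N (omap (ladj BB) (cM j)) (dN f)"
  shows "solution N (G j, u, v, f) w \<longleftrightarrow> solution M (transp A2 j f (G j, u, v, f)) (tB (cM j) (dN f) w)"
proof -
  note [simp] = sq[unfolded square_def] and trbot[OF j sq, simp]
  have w' [simp]: "w \<in> Arr N" "dN w = omap (ladj BB) (cM j)" "cN w = dN f" using w by (auto simp: Hom_def)
  let ?w = "tB (cM j) (dN f) w"
  have wq: "w \<star> TB j = u \<star> qin j \<longleftrightarrow> ?w \<bullet> j = tB (dM j) (dN f) (u \<star> qin j)"
  proof -
    have "tB (dM j) (dN f) (w \<star> TB j) = ?w \<bullet> j" by (rule B.transp_nat_left) simp_all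
    moreover have "w \<star> TB j = u \<star> qin j" if "tB (dM j) (dN f) (w \<star> TB j) = tB (dM j) (dN f) (u \<star> qin j)"
      by (rule B.transp_eqD[OF that]) simp_all
    ultimately show ?thesis by auto
  qed
  have wp: "w \<star> ti (cM j) = u \<star> pin j \<longleftrightarrow> hi (dN f) \<bullet> ?w = tA (cM j) (dN f) (u \<star> pin j)"
  proof -
    have "tA (cM j) (dN f) (w \<star> ti (cM j)) = hi (dN f) \<bullet> ?w" by (rule transp_ti) simp_all
    moreover have "w \<star> ti (cM j) = u \<star> pin j" if "tA (cM j) (dN f) (w \<star> ti (cM j)) = tA (cM j) (dN f) (u \<star> pin j)"
      by (rule A.transp_eqD[OF that]) simp_all
    ultimately show ?thesis by auto
  qed
  have wf: "f \<star> w = v \<longleftrightarrow> SB f \<bullet> ?w = tB (cM j) (cN f) v"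
  proof -
    have "tB (cM j) (cN f) (f \<star> w) = SB f \<bullet> ?w" by (rule B.transp_nat_right) simp_all
    moreover have "f \<star> w = v" if "tB (cM j) (cN f) (f \<star> w) = tB (cM j) (cN f) v"
      by (rule B.transp_eqD[OF that]) simp_all
    ultimately show ?thesis by auto
  qed
  have wG: "w \<star> G j = u \<longleftrightarrow> w \<star> ti (cM j) = u \<star> pin j \<and> w \<star> TB j = u \<star> qin j"
  proof
    assume "w \<star> G j = u"
    then have "(w \<star> G j) \<star> pin j = u \<star> pin j" "(w \<star> G j) \<star> qin j = u \<star> qin j" by simp_all
    then show "w \<star> ti (cM j) = u \<star> pin j \<and> w \<star> TB j = u \<star> qin j" by (simp add: N.assoc)
  next
    assume *: "w \<star> ti (cM j) = u \<star> pin j \<and> w \<star> TB j = u \<star> qin j"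
    show "w \<star> G j = u"
    proof (rule in_eqI[OF j])
      show "(w \<star> G j) \<star> pin j = u \<star> pin j" "(w \<star> G j) \<star> qin j = u \<star> qin j"
        using * by (simp_all add: N.assoc)
    qed simp_all
  qed
  have wH: "H f \<bullet> ?w = trbot j f u v \<longleftrightarrow> SB f \<bullet> ?w = tB (cM j) (cN f) v \<and> hi (dN f) \<bullet> ?w = tA (cM j) (dN f) (u \<star> pin j)"
  proof
    assume "H f \<bullet> ?w = trbot j f u v"
    then have "ppr f \<bullet> H f \<bullet> ?w = ppr f \<bullet> trbot j f u v" "qpr f \<bullet> H f \<bullet> ?w = qpr f \<bullet> trbot j f u v" by simp_all
    then show "SB f \<bullet> ?w = tB (cM j) (cN f) v \<and> hi (dN f) \<bullet> ?w = tA (cM j) (dN f) (u \<star> pin j)"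
      by (simp add: M.comp_ext[OF H_arr(4)] M.comp_ext[OF H_arr(5)])
  next
    assume *: "SB f \<bullet> ?w = tB (cM j) (cN f) v \<and> hi (dN f) \<bullet> ?w = tA (cM j) (dN f) (u \<star> pin j)"
    show "H f \<bullet> ?w = trbot j f u v"
    proof (rule pr_eqI[of f])
      show "ppr f \<bullet> H f \<bullet> ?w = ppr f \<bullet> trbot j f u v" "qpr f \<bullet> H f \<bullet> ?w = qpr f \<bullet> trbot j f u v"
        using * by (simp_all add: M.comp_ext[OF H_arr(4)] M.comp_ext[OF H_arr(5)])
    qed simp_all
  qed
  have "solution N (G j, u, v, f) w \<longleftrightarrow> w \<star> G j = u \<and> f \<star> w = v"
    by (simp add: solution_def Hom_def)
  moreover have "solution M (transp A2 j f (G j, u, v, f)) ?w \<longleftrightarrow>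
      ?w \<bullet> j = tB (dM j) (dN f) (u \<star> qin j) \<and> H f \<bullet> ?w = trbot j f u v"
    by (simp add: solution_def tr_eq Hom_def)
  ultimately show ?thesis using wq wp wf wG wH by blast
qed

lemma ptens_lifting: "lifting_adj M N A2 BB"
  unfolding lifting_adj_def
proof (intro conjI ballI)
  show "adjunction (arrow_cat M) (arrow_cat N) A2" by (rule ptens_adjunction)
  show "adjunction M N BB" by (rule B.adj)
next
  fix j f \<sigma> w assume jf: "j \<in> Arr M" "f \<in> Arr N" "\<sigma> \<in> Hom (arrow_cat N) (omap (ladj A2) j) f"
    and w: "w \<in> Hom N (omap (ladj BB) (Cod M j)) (Dom N f)"
  then show "solution N \<sigma> w \<longleftrightarrow> solution M (transp A2 j f \<sigma>) (tB (Cod M j) (Dom N f) w)"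
    by (auto elim!: arrow_HomE simp: A2_sel(1) ptens_solution)
next
  fix \<sigma> assume "\<sigma> \<in> Arr (arrow_cat M)"
  then show "sq_bot (amap (ladj A2) \<sigma>) = TB (sq_bot \<sigma>)" by (cases \<sigma>) (simp add: A2_sel)
next
  fix \<sigma> assume "\<sigma> \<in> Arr (arrow_cat N)"
  then show "sq_top (amap (radj A2) \<sigma>) = SB (sq_top \<sigma>)" by (cases \<sigma>) (simp add: A2_sel)
qed (simp_all add: A2_sel)

end

lemma ptens_form_lifting:
  assumes "ptens_form K M N A2 A"
  shows "lifting_adj M N A2 A"
proof -
  obtain i po pb V where V: "i \<in> Arr K" "pullback_choice M pb" "pushout_choice N po" "two_var_adjunction K M N V"
    and A: "A2 = ptens_adj K M N V po pb i" "A = tens_adj K V (Cod K i)"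
    using assms swap_two_var_adjunction[of M K N] unfolding ptens_form_def by blast
  interpret pushout_product K M N V po pb i by (unfold_locales) (fact V)+
  show ?thesis unfolding A by (rule ptens_lifting)
qed

theorem theorem6p13:
  fixes M :: "('o, 'a) cat" and N :: "('p, 'b) cat" and J :: "('x, 'y) cat"
    and U :: "('x, 'y, 'a, 'a sq) func"
    and W :: "('o, 'a) awfs_data" and W' :: "('p, 'b) awfs_data"
    and u :: "('x, 'y, 'a \<times> 'a, 'a str_arr) func"
    and K :: "('ok, 'ak) cat" and P :: "('q, 'c) cat"
    and A2 :: "('a, 'a sq, 'b, 'b sq) adj" and A :: "('o, 'a, 'p, 'b) adj"
    and \<Phi> :: "('x, 'y, 'b \<times> 'b, 'b str_arr) func"
  assumes "generated_awfs M J U W u"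
    and "awfs N W'"
    and "arrow_form M N A2 A \<or> ptens_form K M N A2 A \<or> composite_form K M P N A2 A"
    and "is_functor J (coalg_cat N W') \<Phi>"
    and "func_eq J (comp_func forget \<Phi>) (comp_func (ladj A2) U)"
  shows "\<exists>!(l, r). l \<in> extensional (Arr M) \<and> r \<in> extensional (Arr N) \<and>
           awfs_adjunction M W N W' A2 A l r \<and>
           func_eq J \<Phi> (comp_func (lift_coalg N A2 A l) u)"
proof -
  have "lifting_adj M N A2 A"
    using assms(3)
  proof (elim disjE)
    assume "composite_form K M P N A2 A"
    then obtain B2 B C2 C where forms: "arrow_form M P B2 B \<and> ptens_form K P N C2 C \<or>
        ptens_form K M P B2 B \<and> arrow_form P N C2 C"
      and A: "A2 = comp_adj C2 B2" "A = comp_adj C B"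
      unfolding composite_form_def by blast
    have "lifting_adj M P B2 B" "lifting_adj P N C2 C"
      using forms arrow_form_lifting[of M P B2 B] ptens_form_lifting[of K P N C2 C]
        ptens_form_lifting[of K M P B2 B] arrow_form_lifting[of P N C2 C] by blast+
    then show ?thesis unfolding A by (rule comp_lifting_adj)
  qed (fact arrow_form_lifting ptens_form_lifting)+
  moreover have "awfs M W" "category M" "category N"
    using assms(1,2) by (simp_all add: generated_awfs_def awfs_def)
  ultimately interpret lifting_adjunction M W J U u N W' A2 A \<Phi>
    using assms unfolding lifting_adjunction_def lifting_adjunction_axioms_def
      generated_def generated_axioms_def awfs_on_def awfs_on_axioms_def by blast
  show ?thesis by (rule unique_awfs_adjunction)
qed

end
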